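(* Let $H$ be a complex Hilbert space and let $A$ be a compact operator in $H$ represented as $A=C+T$, where $C$ is a non-negative compact operator in $H$ such that, for some slowly varying function $\ell$ and some $a$ with $0<a<\infty$, $\lim_{n\to\infty}\frac{1}{\ell(n)}s_n(C)=a$, and where $T\in\mathfrak{S}_q(H)$ for some $q$ with $0<q<\infty$. Then $A$ is not a Volterra operator.
   Context: For a compact operator $T$ in a Hilbert space $H$, the $s$-numbers $s_n(T)$, $n=1,2,\dots$, are the eigenvalues of $|T|=(T^*T)^{1/2}$, counted with multiplicity and arranged in non-increasing order. For $0<p<\infty$, $\mathfrak{S}_p(H)$ denotes the set of all compact operators $T$ in $H$ with $\sum_{j=1}^{\infty}s_j^p(T)<\infty$. A bounded operator is called quasinilpotent if its spectrum consists of the single point zero. An operator $A$ in $H$ is called a Volterra operator if $A$ is compact and quasinilpotent. A non-negative operator is a self-adjoint operator $C$ with $(Cf,f)\ge 0$ for all $f$. A function $\ell(x)$, $b\le x<\infty$ (with some $b>0$), is called slowly varying if it is positive and continuously differentiable and $\lim_{x\to\infty}\frac{x\,\ell'(x)}{\ell(x)}=0$. *)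

theory Defs
  imports "HOL-Analysis.Analysis"
begin

text \<open>
  A complex Hilbert space is a complete space with a sesquilinear inner product \<open>cinner\<close>, linear in
  its first argument. The library classes for real inner product spaces are kept underneath, so that
  norm, topology and completeness are the library ones: the real inner product is the real part of
  the complex one, which makes \<open>norm x = sqrt (Re (cinner x x))\<close>, and real scaling is the restriction
  of complex scaling.
\<close>

class complex_hilbert_space = real_inner + complete_space +
  fixes scaleC :: "complex \<Rightarrow> 'a \<Rightarrow> 'a" (infixr "*\<^sub>C" 75)
    and cinner :: "'a \<Rightarrow> 'a \<Rightarrow> complex"
  assumes scaleC_add_right: "c *\<^sub>C (x + y) = c *\<^sub>C x + c *\<^sub>C y"
    and scaleC_add_left: "(c + d) *\<^sub>C x = c *\<^sub>C x + d *\<^sub>C x"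
    and scaleC_scaleC: "c *\<^sub>C (d *\<^sub>C x) = (c * d) *\<^sub>C x"
    and scaleC_one: "1 *\<^sub>C x = x"
    and scaleC_of_real: "complex_of_real r *\<^sub>C x = r *\<^sub>R x"
    and cinner_commute: "cinner x y = cnj (cinner y x)"
    and cinner_add_left: "cinner (x + y) z = cinner x z + cinner y z"
    and cinner_scaleC_left: "cinner (c *\<^sub>C x) y = c * cinner x y"
    and Re_cinner: "Re (cinner x y) = inner x y"

interpretation complex_vector: vector_space
  "scaleC :: complex \<Rightarrow> 'a \<Rightarrow> 'a::complex_hilbert_space"
  by unfold_locales (simp_all add: scaleC_add_right scaleC_add_left scaleC_scaleC scaleC_one)

definition bounded_clinear :: "('a::complex_hilbert_space \<Rightarrow> 'a) \<Rightarrow> bool" where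
  "bounded_clinear T \<longleftrightarrow> bounded_linear T \<and> (\<forall>c x. T (c *\<^sub>C x) = c *\<^sub>C T x)"

definition compact_operator :: "('a::complex_hilbert_space \<Rightarrow> 'a) \<Rightarrow> bool" where
  "compact_operator T \<longleftrightarrow> bounded_clinear T \<and> (\<forall>S. bounded S \<longrightarrow> compact (closure (T ` S)))"

definition spectrum :: "('a::complex_hilbert_space \<Rightarrow> 'a) \<Rightarrow> complex set" where
  "spectrum T = {c. \<not> (\<exists>R. bounded_clinear R \<and>
     (\<forall>x. R (T x - c *\<^sub>C x) = x) \<and> (\<forall>x. T (R x) - c *\<^sub>C R x = x))}"

definition quasinilpotent :: "('a::complex_hilbert_space \<Rightarrow> 'a) \<Rightarrow> bool" where
  "quasinilpotent T \<longleftrightarrow> bounded_clinear T \<and> spectrum T = {0}"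

definition volterra_operator :: "('a::complex_hilbert_space \<Rightarrow> 'a) \<Rightarrow> bool" where
  "volterra_operator T \<longleftrightarrow> compact_operator T \<and> quasinilpotent T"

definition selfadjoint :: "('a::complex_hilbert_space \<Rightarrow> 'a) \<Rightarrow> bool" where
  "selfadjoint T \<longleftrightarrow> bounded_clinear T \<and> (\<forall>f g. cinner (T f) g = cinner f (T g))"

definition nonneg_operator :: "('a::complex_hilbert_space \<Rightarrow> 'a) \<Rightarrow> bool" where
  "nonneg_operator T \<longleftrightarrow> selfadjoint T \<and> (\<forall>f. cinner (T f) f \<in> \<real>\<^sub>\<ge>\<^sub>0)"

definition hilbert_adjoint ::
  "('a::complex_hilbert_space \<Rightarrow> 'a) \<Rightarrow> 'a \<Rightarrow> 'a" where
  "hilbert_adjoint T = (THE S. \<forall>f g. cinner (T f) g = cinner f (S g))"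

definition operator_sqrt ::
  "('a::complex_hilbert_space \<Rightarrow> 'a) \<Rightarrow> 'a \<Rightarrow> 'a" where
  "operator_sqrt B = (THE P. nonneg_operator P \<and> P \<circ> P = B)"

definition operator_abs ::
  "('a::complex_hilbert_space \<Rightarrow> 'a) \<Rightarrow> 'a \<Rightarrow> 'a" where
  "operator_abs T = operator_sqrt (hilbert_adjoint T \<circ> T)"

definition eigenspace ::
  "('a::complex_hilbert_space \<Rightarrow> 'a) \<Rightarrow> complex \<Rightarrow> 'a set" where
  "eigenspace T c = {x. T x = c *\<^sub>C x}"

text \<open>
  For compact \<open>T\<close>, exactly one sequence is non-increasing and takes each positive value as often as
  that value is an eigenvalue of \<open>|T|\<close>, counted with its (finite) multiplicity. If \<open>|T|\<close> has only
  finitely many positive eigenvalues, the sequence continues with zeros; otherwise the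
  eigenvalue zero is not listed. Finiteness of the level sets has to be
  required separately because \<open>card\<close> is zero on infinite sets.
\<close>

definition s_number_sequence ::
  "('a::complex_hilbert_space \<Rightarrow> 'a) \<Rightarrow> (nat \<Rightarrow> real) \<Rightarrow> bool" where
  "s_number_sequence T s \<longleftrightarrow> decseq s \<and> (\<forall>n. 0 \<le> s n) \<and>
     (\<forall>\<mu>>0. finite {n. s n = \<mu>} \<and>
        card {n. s n = \<mu>} = complex_vector.dim (eigenspace (operator_abs T) (complex_of_real \<mu>)))"

text \<open>The \<open>s\<close>-numbers are indexed from \<open>n = 1\<close>; the value at \<open>n = 0\<close> is meaningless.\<close>

definition s_number :: "('a::complex_hilbert_space \<Rightarrow> 'a) \<Rightarrow> nat \<Rightarrow> real" where
  "s_number T n = (THE s. s_number_sequence T s) (n - 1)"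

definition schatten_class :: "real \<Rightarrow> ('a::complex_hilbert_space \<Rightarrow> 'a) set" where
  "schatten_class p =
     {T. compact_operator T \<and> summable (\<lambda>j. s_number T (Suc j) powr p)}"

text \<open>Only the values on some half-line \<open>[b, \<infinity>)\<close> matter; the derivative at \<open>b\<close> is one-sided.\<close>

definition slowly_varying :: "(real \<Rightarrow> real) \<Rightarrow> bool" where
  "slowly_varying l \<longleftrightarrow> (\<exists>b>0. \<exists>l'. (\<forall>x\<ge>b. 0 < l x) \<and>
     (\<forall>x\<ge>b. (l has_real_derivative l' x) (at x within {b..})) \<and>
     continuous_on {b..} l' \<and>
     ((\<lambda>x. x * l' x / l x) \<longlongrightarrow> 0) at_top)"

end

theory Submission
  imports Defs "HOL-Computational_Algebra.Fundamental_Theorem_Algebra"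
begin

text \<open>
  If \<open>A\<close> is a Volterra operator, its compressions to large finite-dimensional subspaces have only
  small eigenvalues. In a triangular basis, subtract from such a compression the real part of its
  diagonal, which has norm at most \<open>\<epsilon>\<close>. The result \<open>M\<close> is triangular with imaginary diagonal, and
  \<open>M - M\<^sup>*\<close> is a compression of \<open>T - T\<^sup>*\<close>, since \<open>C\<close> is self-adjoint. By a version of Matsaev's
  inequality, power decay of the \<open>s\<close>-numbers of \<open>M - M\<^sup>*\<close> forces power decay of those of \<open>M + M\<^sup>*\<close>,
  with constants independent of the compression. For exponent \<open>p = 2\<close> this is the trace formula for
  \<open>M\<^sup>2\<close>; one passes from \<open>p\<close> to \<open>2p\<close> by applying the inequality to \<open>M\<^sup>2\<close> with its (non-positive)
  diagonal removed. As \<open>\<epsilon> \<rightarrow> 0\<close>, the \<open>s\<close>-numbers of \<open>C\<close> decay like a power, which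
  a slowly varying function does not.
\<close>

section \<open>Complex Hilbert spaces\<close>

text \<open>All estimates are bounds of the form b (m+1)^(-s) on Gelfand numbers. Such bounds pass
  through sums, products, adjoints and compressions by uniting finite sets of orthogonality
  constraints. The index then grows by a fixed factor, which a power weight turns into a constant.
  The price is a fixed surplus g > 0 in the exponent, which makes a Hilbert-Schmidt sum converge in
  the case p = 2. Each doubling of p keeps g and halves the rest r: decay g + r of the skew part
  yields decay r of the Hermitian part. Only some power decay of \<open>C\<close> is wanted, so r
  may be taken as small as the given q requires.

  The obstacle is that a compression of a quasinilpotent operator need not be quasinilpotent; only
  smallness of its eigenvalues survives. Hence the error \<epsilon> and the insistence on constants
  that do not depend on the dimension. Removing the imaginary part of the diagonal as well would add
  to M - M* a diagonal operator about which nothing but the bound 2 \<epsilon> is known. Left in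
  place it does no harm, because it enters the estimates only through its square, with a favourable
  sign.\<close>

lemma cinner_add_right: "cinner x (y + z) = cinner x y + cinner x (z::'a::complex_hilbert_space)"
  by (metis cinner_add_left cinner_commute complex_cnj_add)

lemma cinner_scaleC_right:
  "cinner x (c *\<^sub>C y) = cnj c * cinner x (y::'a::complex_hilbert_space)"
  by (metis cinner_commute cinner_scaleC_left complex_cnj_mult)

lemma cinner_self: "cinner x x = complex_of_real ((norm (x::'a::complex_hilbert_space))\<^sup>2)"
proof (rule complex_eqI)
  show "Re (cinner x x) = Re (complex_of_real ((norm x)\<^sup>2))"
    by (simp add: Re_cinner power2_norm_eq_inner)
  have "Im (cinner x x) = Im (cnj (cinner x x))"
    by (metis cinner_commute)
  then show "Im (cinner x x) = Im (complex_of_real ((norm x)\<^sup>2))"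
    by simp
qed

lemma norm_scaleC [simp]: "norm (c *\<^sub>C x) = cmod c * norm (x::'a::complex_hilbert_space)"
proof -
  have "complex_of_real ((norm (c *\<^sub>C x))\<^sup>2) = c * (cnj c * cinner x x)"
    by (simp only: cinner_self[symmetric] cinner_scaleC_left cinner_scaleC_right mult.left_commute)
  also have "\<dots> = complex_of_real ((cmod c * norm x)\<^sup>2)"
    unfolding cinner_self
    by (simp add: power_mult_distrib flip: mult.assoc)
      (simp add: complex_norm_square flip: of_real_power)
  finally have "(norm (c *\<^sub>C x))\<^sup>2 = (cmod c * norm x)\<^sup>2"
    using of_real_eq_iff by blast
  then show ?thesis
    by (simp add: power2_eq_iff_nonneg)
qed

lemma cinner_bound: "cmod (cinner x y) \<le> norm x * norm (y::'a::complex_hilbert_space)"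
proof (cases "cinner x y = 0")
  case False
  define c where "c = cnj (cinner x y) / cmod (cinner x y)"
  have c: "cmod c = 1"
    using False by (simp add: c_def norm_divide)
  have "cinner (c *\<^sub>C x) y = cmod (cinner x y)"
    using False by (simp add: c_def cinner_scaleC_left mult.commute complex_norm_square[symmetric]
        power2_eq_square)
  then have "cmod (cinner x y) = inner (c *\<^sub>C x) y"
    by (metis Re_cinner Re_complex_of_real)
  also have "\<dots> \<le> norm (c *\<^sub>C x) * norm y"
    by (rule norm_cauchy_schwarz)
  finally show ?thesis
    using c by simp
qed simp

lemma scaleR_scaleC: "r *\<^sub>R x = complex_of_real r *\<^sub>C (x::'a::complex_hilbert_space)"
  by (simp add: scaleC_of_real)

interpretation cinner: bounded_bilinear
  "cinner :: 'a::complex_hilbert_space \<Rightarrow> 'a \<Rightarrow> complex"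
proof
  fix a a' b b' :: 'a and r :: real
  show "cinner (a + a') b = cinner a b + cinner a' b"
    by (rule cinner_add_left)
  show "cinner a (b + b') = cinner a b + cinner a b'"
    by (rule cinner_add_right)
  show "cinner (r *\<^sub>R a) b = r *\<^sub>R cinner a b"
    by (simp add: scaleR_scaleC cinner_scaleC_left scaleR_conv_of_real)
  show "cinner a (r *\<^sub>R b) = r *\<^sub>R cinner a b"
    by (simp add: scaleR_scaleC cinner_scaleC_right scaleR_conv_of_real)
  show "\<exists>K. \<forall>a b. cmod (cinner (a::'a) b) \<le> norm a * norm b * K"
    by (rule exI[of _ 1]) (simp add: cinner_bound)
qed

interpretation scaleC: bounded_bilinear
  "scaleC :: complex \<Rightarrow> 'a::complex_hilbert_space \<Rightarrow> 'a"
proof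
  fix a a' :: complex and b b' :: 'a and r :: real
  show "(a + a') *\<^sub>C b = a *\<^sub>C b + a' *\<^sub>C b"
    by (rule scaleC_add_left)
  show "a *\<^sub>C (b + b') = a *\<^sub>C b + a *\<^sub>C b'"
    by (rule scaleC_add_right)
  show "(r *\<^sub>R a) *\<^sub>C b = r *\<^sub>R (a *\<^sub>C b)"
    by (simp add: scaleR_scaleC scaleC_scaleC scaleR_conv_of_real)
  show "a *\<^sub>C (r *\<^sub>R b) = r *\<^sub>R (a *\<^sub>C b)"
    by (simp add: scaleR_scaleC scaleC_scaleC mult.commute)
  show "\<exists>K. \<forall>a b. norm (a *\<^sub>C (b::'a)) \<le> norm a * norm b * K"
    by (rule exI[of _ 1]) simp
qed

declare cinner.zero_left [simp] cinner.zero_right [simp]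
  scaleC.zero_left [simp] scaleC.zero_right [simp]

lemmas cinner_simps = cinner.add_left cinner.add_right cinner.diff_left cinner.diff_right
  cinner.minus_left cinner.minus_right cinner_scaleC_left cinner_scaleC_right

lemma cinner_eq_0_iff: "cinner x x = 0 \<longleftrightarrow> (x::'a::complex_hilbert_space) = 0"
  by (simp add: cinner_self)

lemma cinner_sym_0: "cinner x y = 0 \<Longrightarrow> cinner y (x::'a::complex_hilbert_space) = 0"
  by (metis cinner_commute complex_cnj_zero)

lemma cinner_ext: "(\<And>z. cinner x z = cinner y z) \<Longrightarrow> x = (y::'a::complex_hilbert_space)"
  by (metis cinner.diff_left cinner_eq_0_iff diff_self eq_iff_diff_eq_0)

lemma cinner_ext_right: "(\<And>z. cinner z x = cinner z y) \<Longrightarrow> x = (y::'a::complex_hilbert_space)"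
  by (metis cinner_commute cinner_ext)

lemma cinner_mult_cnj:
  "cinner x y * cinner y x = complex_of_real ((cmod (cinner x y))\<^sup>2)"
  for x y :: "'a::complex_hilbert_space"
  by (metis cinner_commute complex_norm_square)

lemma scaleC_2: "x + x = 2 *\<^sub>C (x::'a::complex_hilbert_space)"
  by (metis one_add_one scaleC_add_left scaleC_one)

subsection \<open>Linear operators and adjoints\<close>

definition clinear :: "('a::complex_hilbert_space \<Rightarrow> 'a) \<Rightarrow> bool" where
  "clinear T \<longleftrightarrow> (\<forall>x y. T (x + y) = T x + T y) \<and> (\<forall>c x. T (c *\<^sub>C x) = c *\<^sub>C T x)"

lemma clinearI:
  "(\<And>x y. T (x + y) = T x + T y) \<Longrightarrow> (\<And>c x. T (c *\<^sub>C x) = c *\<^sub>C T x) \<Longrightarrow> clinear T"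
  by (simp add: clinear_def)

lemma clinear_add: "clinear T \<Longrightarrow> T (x + y) = T x + T y"
  by (simp add: clinear_def)

lemma clinear_scaleC: "clinear T \<Longrightarrow> T (c *\<^sub>C x) = c *\<^sub>C T x"
  by (simp add: clinear_def)

lemma clinear_0: "clinear T \<Longrightarrow> T 0 = 0"
  by (metis clinear_add add_cancel_right_right)

lemma clinear_diff: "clinear T \<Longrightarrow> T (x - y) = T x - T y"
  by (metis add_diff_cancel clinear_add diff_add_cancel)

lemma clinear_sum: "clinear T \<Longrightarrow> T (\<Sum>i\<in>I. f i) = (\<Sum>i\<in>I. T (f i))"
  by (induction I rule: infinite_finite_induct) (simp_all add: clinear_0 clinear_add)

lemma clinear_imp_linear:
  "clinear T \<Longrightarrow> Vector_Spaces.linear (*\<^sub>C) (*\<^sub>C) (T :: 'a::complex_hilbert_space \<Rightarrow> 'a)"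
  by unfold_locales (simp_all add: clinear_add clinear_scaleC)

lemma bounded_clinear_iff:
  "bounded_clinear T \<longleftrightarrow> clinear T \<and> (\<exists>K. \<forall>x. norm (T x) \<le> K * norm x)"
proof
  assume "bounded_clinear T"
  then show "clinear T \<and> (\<exists>K. \<forall>x. norm (T x) \<le> K * norm x)"
    unfolding bounded_clinear_def clinear_def
    using bounded_linear.bounded[of T]
    by (metis linear_add bounded_linear.linear mult.commute)
next
  assume *: "clinear T \<and> (\<exists>K. \<forall>x. norm (T x) \<le> K * norm x)"
  then obtain K where "\<forall>x. norm (T x) \<le> K * norm x"
    by blast
  then have "bounded_linear T"
    using * by (intro bounded_linear_intro[where K=K])
      (simp_all add: clinear_add clinear_scaleC scaleR_scaleC mult.commute)
  then show "bounded_clinear T"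
    using * by (simp add: bounded_clinear_def clinear_scaleC)
qed

lemma bounded_clinear_imp_clinear: "bounded_clinear T \<Longrightarrow> clinear T"
  by (simp add: bounded_clinear_iff)

lemma bounded_clinear_boundE:
  assumes "bounded_clinear T"
  obtains K where "0 \<le> K" "\<And>x. norm (T x) \<le> K * norm x"
proof -
  obtain K where K: "\<And>x. norm (T x) \<le> K * norm x"
    using assms by (auto simp: bounded_clinear_iff)
  have "norm (T x) \<le> \<bar>K\<bar> * norm x" for x
    by (meson K abs_ge_self mult_right_mono norm_ge_zero order_trans)
  then show thesis
    using that[of "\<bar>K\<bar>"] by auto
qed

text \<open>A relation instead of the function \<open>hilbert_adjoint\<close>: the adjoints of sums,
  products and compressions are given by explicit formulas, and the mere existence of a partner
  already makes both operators linear.\<close>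

definition adjoint_pair ::
  "('a::complex_hilbert_space \<Rightarrow> 'a) \<Rightarrow> ('a \<Rightarrow> 'a) \<Rightarrow> bool" where
  "adjoint_pair T S \<longleftrightarrow> (\<forall>f g. cinner (T f) g = cinner f (S g))"

lemma adjoint_pairD: "adjoint_pair T S \<Longrightarrow> cinner (T f) g = cinner f (S g)"
  by (simp add: adjoint_pair_def)

lemma adjoint_pair_sym: "adjoint_pair T S \<Longrightarrow> adjoint_pair S T"
  unfolding adjoint_pair_def by (metis cinner_commute)

lemma adjoint_pair_clinear:
  assumes "adjoint_pair T S"
  shows "clinear T"
proof (rule clinearI)
  fix x y c
  show "T (x + y) = T x + T y"
    by (rule cinner_ext) (simp add: adjoint_pairD[OF assms] cinner_simps)
  show "T (c *\<^sub>C x) = c *\<^sub>C T x"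
    by (rule cinner_ext) (simp add: adjoint_pairD[OF assms] cinner_simps)
qed

lemma adjoint_pair_bound:
  assumes "adjoint_pair T S" and "\<And>x. norm (T x) \<le> K * norm x"
  shows "norm (S x) \<le> K * norm x"
proof (cases "S x = 0")
  case True
  then show ?thesis
    by (metis assms(2) norm_ge_zero norm_zero order_trans)
next
  case False
  have "(norm (S x))\<^sup>2 = cmod (cinner (T (S x)) x)"
    by (simp add: adjoint_pairD[OF assms(1)] cinner_self norm_power)
  also have "\<dots> \<le> norm (T (S x)) * norm x"
    by (rule cinner_bound)
  also have "\<dots> \<le> K * norm (S x) * norm x"
    by (intro mult_right_mono assms) simp
  finally have "norm (S x) * norm (S x) \<le> norm (S x) * (K * norm x)"
    by (simp add: power2_eq_square algebra_simps)
  then show ?thesis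
    using False by (simp add: mult_le_cancel_left)
qed

section \<open>Riesz representation and existence of adjoints\<close>

text \<open>The minimiser of \<open>\<parallel>x\<parallel>\<^sup>2 - 2 \<phi> x\<close> represents \<open>\<phi>\<close>; a minimising sequence is Cauchy by
  the parallelogram law.\<close>

lemma riesz_representation:
  fixes \<phi> :: "'a::{real_inner, complete_space} \<Rightarrow> real"
  assumes "bounded_linear \<phi>"
  shows "\<exists>y. \<forall>x. \<phi> x = inner x y"
proof -
  interpret bounded_linear \<phi> by fact
  define J where "J x = (norm x)\<^sup>2 - 2 * \<phi> x" for x
  obtain K where K: "\<And>x. norm (\<phi> x) \<le> norm x * K"
    using bounded by blast
  have "- K\<^sup>2 \<le> J x" for x
  proof -
    have "0 \<le> (norm x - K)\<^sup>2" by simp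
    moreover have "\<phi> x \<le> norm x * K"
      using K[of x] by simp
    ultimately show ?thesis
      by (simp add: J_def power2_eq_square algebra_simps)
  qed
  then have bdd: "bdd_below (range J)"
    by (intro bdd_belowI[where m="- K\<^sup>2"]) auto
  define j where "j = Inf (range J)"
  have jle: "j \<le> J x" for x
    unfolding j_def using bdd by (simp add: cInf_lower)
  have "\<exists>x. J x < j + inverse (Suc n)" for n :: nat
    using cInf_lessD[of "range J" "j + inverse (Suc n)"] unfolding j_def by auto
  then obtain x where x: "\<And>n::nat. J (x n) < j + inverse (Suc n)"
    by metis
  have par: "(norm (u - v))\<^sup>2 \<le> 2 * (J u - j) + 2 * (J v - j)" for u v
  proof -
    have "(norm ((1/2) *\<^sub>R (u + v)))\<^sup>2 = (inner u u + 2 * inner u v + inner v v) / 4"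
      by (simp only: power2_norm_eq_inner inner_simps inner_commute[of v u])
        (simp add: field_simps)
    moreover have "(norm (u - v))\<^sup>2 = inner u u - 2 * inner u v + inner v v"
      by (simp only: power2_norm_eq_inner inner_simps inner_commute[of v u])
    moreover have "\<phi> ((1/2) *\<^sub>R (u + v)) = (\<phi> u + \<phi> v) / 2"
      by (simp add: scaleR add)
    ultimately show ?thesis
      using jle[of "(1/2) *\<^sub>R (u + v)"]
      unfolding J_def power2_norm_eq_inner[of u] power2_norm_eq_inner[of v]
      by (simp only:) (simp add: field_simps)
  qed
  have "Cauchy x"
  proof (rule metric_CauchyI)
    fix e :: real assume "0 < e"
    then obtain N where N: "inverse (real (Suc N)) < e\<^sup>2 / 4"
      using reals_Archimedean[of "e\<^sup>2 / 4"] by auto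
    have small: "J (x k) < j + e\<^sup>2 / 4" if "N \<le> k" for k
    proof -
      have "inverse (real (Suc k)) \<le> inverse (real (Suc N))"
        using that by (auto intro!: le_imp_inverse_le)
      then have "inverse (real (Suc k)) < e\<^sup>2 / 4"
        using N by (rule le_less_trans)
      then show ?thesis
        using x[of k] by (meson add_strict_left_mono less_trans)
    qed
    show "\<exists>M. \<forall>m\<ge>M. \<forall>n\<ge>M. dist (x m) (x n) < e"
    proof (intro exI allI impI)
      fix m n assume "N \<le> m" "N \<le> n"
      then have "J (x m) < j + e\<^sup>2 / 4" "J (x n) < j + e\<^sup>2 / 4"
        using small by blast+
      then have "(norm (x m - x n))\<^sup>2 < e\<^sup>2"
        using par[of "x m" "x n"] by simp
      then show "dist (x m) (x n) < e"
        using \<open>0 < e\<close> by (simp add: dist_norm power_less_imp_less_base)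
    qed
  qed
  then obtain y where y: "x \<longlonglongrightarrow> y"
    using Cauchy_convergent convergent_def by blast
  have "(\<lambda>n. J (x n)) \<longlonglongrightarrow> J y"
    unfolding J_def by (intro tendsto_intros y tendsto)
  moreover have "(\<lambda>n. j + inverse (real (Suc n))) \<longlonglongrightarrow> j + 0"
    by (intro tendsto_intros LIMSEQ_inverse_real_of_nat)
  ultimately have "J y \<le> j + 0"
    by (rule LIMSEQ_le) (use x less_imp_le in blast)
  then have min: "J y \<le> J z" for z
    using jle[of z] by simp
  show ?thesis
  proof (intro exI allI)
    fix z
    define d where "d = inner z y - \<phi> z"
    have q: "0 \<le> 2 * t * d + t\<^sup>2 * (norm z)\<^sup>2" for t
    proof -
      have "(norm (y + t *\<^sub>R z))\<^sup>2 = (norm y)\<^sup>2 + 2 * t * inner z y + t\<^sup>2 * (norm z)\<^sup>2"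
        by (simp only: power2_norm_eq_inner inner_simps inner_commute[of y z])
          (simp add: power2_eq_square algebra_simps)
      moreover have "\<phi> (y + t *\<^sub>R z) = \<phi> y + t * \<phi> z"
        by (simp add: scaleR add)
      ultimately show ?thesis
        using min[of "y + t *\<^sub>R z"] unfolding J_def d_def
        by (simp only:) (simp add: algebra_simps)
    qed
    \<comment> \<open>For d \<noteq> 0 the value t = - d / w in \<open>q\<close> would make the
      quadratic at most - d^2 / w < 0. The summand 1 in w covers z = 0.\<close>
    have "d = 0"
    proof (rule ccontr)
      assume "d \<noteq> 0"
      define w where "w = (norm z)\<^sup>2 + 1"
      have w: "w > 0" "(norm z)\<^sup>2 < w" by (auto simp: w_def add_nonneg_pos)
      have "0 \<le> - 2 * (d\<^sup>2 / w) + (d / w)\<^sup>2 * (norm z)\<^sup>2"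
        using q[of "- d / w"] by (simp add: power2_eq_square)
      moreover have "(d / w)\<^sup>2 * (norm z)\<^sup>2 \<le> (d / w)\<^sup>2 * w"
        using w by (intro mult_left_mono) auto
      moreover have "(d / w)\<^sup>2 * w = d\<^sup>2 / w"
        using w by (simp add: power2_eq_square)
      moreover have "d\<^sup>2 / w > 0" using \<open>d \<noteq> 0\<close> w by simp
      ultimately show False by linarith
    qed
    then show "\<phi> z = inner z y" by (simp add: d_def)
  qed
qed

text \<open>The imaginary part of the complex product is, up to sign, the real product after
  multiplying the first argument by \<i>. This transfers the real Riesz theorem to the complex inner
  product.\<close>

lemma cinner_eqI_Re:
  fixes x y x' y' :: "'a::complex_hilbert_space"
  assumes "inner x y = inner x' y'" and "inner (\<i> *\<^sub>C x) y = inner (\<i> *\<^sub>C x') y'"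
  shows "cinner x y = cinner x' y'"
  using assms by (simp add: complex_eq_iff flip: Re_cinner) (simp add: cinner_simps)

lemma adjoint_pair_exists:
  fixes T :: "'a::complex_hilbert_space \<Rightarrow> 'a"
  assumes "bounded_clinear T"
  shows "\<exists>S. adjoint_pair T S"
proof -
  have "bounded_linear (\<lambda>f. inner (T f) g)" for g
    using assms bounded_linear_compose[OF bounded_linear_inner_left, of T g]
    by (simp add: bounded_clinear_def comp_def)
  then have "\<forall>g. \<exists>y. \<forall>f. inner (T f) g = inner f y"
    using riesz_representation by blast
  then obtain S where S: "\<And>f g. inner (T f) g = inner f (S g)"
    by metis
  have "cinner (T f) g = cinner f (S g)" for f g
    by (rule cinner_eqI_Re)
      (simp_all add: S flip: clinear_scaleC[OF bounded_clinear_imp_clinear[OF assms]])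
  then show ?thesis
    by (auto simp: adjoint_pair_def)
qed

lemma adjoint_pair_unique: "adjoint_pair T S \<Longrightarrow> adjoint_pair T S' \<Longrightarrow> S = S'"
  unfolding adjoint_pair_def by (intro ext cinner_ext_right) metis

lemma hilbert_adjoint_eq: "adjoint_pair T S \<Longrightarrow> hilbert_adjoint T = S"
  unfolding hilbert_adjoint_def using adjoint_pair_unique[of T]
  by (intro the_equality) (auto simp: adjoint_pair_def)

subsection \<open>Orthonormal families\<close>

text \<open>Zero vectors are allowed, so that the list of singular vectors of a finite rank operator can
  be continued by zeros.\<close>

definition orthonormal0 :: "(nat \<Rightarrow> 'a::complex_hilbert_space) \<Rightarrow> nat set \<Rightarrow> bool" where
  "orthonormal0 e I \<longleftrightarrow> (\<forall>i\<in>I. \<forall>j\<in>I. i \<noteq> j \<longrightarrow> cinner (e i) (e j) = 0) \<and>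
     (\<forall>i\<in>I. norm (e i) = 1 \<or> e i = 0)"

definition orthonormal :: "(nat \<Rightarrow> 'a::complex_hilbert_space) \<Rightarrow> nat set \<Rightarrow> bool" where
  "orthonormal e I \<longleftrightarrow> (\<forall>i\<in>I. \<forall>j\<in>I. cinner (e i) (e j) = (if i = j then 1 else 0))"

lemma orthonormal_norm: "orthonormal e I \<Longrightarrow> i \<in> I \<Longrightarrow> norm (e i) = 1"
proof -
  assume "orthonormal e I" "i \<in> I"
  then have "cinner (e i) (e i) = 1"
    by (auto simp: orthonormal_def)
  then have "(norm (e i))\<^sup>2 = 1"
    unfolding cinner_self of_real_eq_1_iff .
  then show "norm (e i) = 1"
    using norm_ge_zero[of "e i"] by (auto simp: power2_eq_1_iff)
qed

lemma orthonormalI: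
  assumes "\<And>i j. i \<in> I \<Longrightarrow> j \<in> I \<Longrightarrow> i < j \<Longrightarrow> cinner (e j) (e i) = 0"
    and "\<And>i. i \<in> I \<Longrightarrow> norm (e i) = 1"
  shows "orthonormal e I"
proof -
  have "cinner (e i) (e j) = 0" if "i \<in> I" "j \<in> I" "i \<noteq> j" for i j
    using assms(1) that cinner_sym_0 by (metis nat_neq_iff)
  then show ?thesis
    using assms(2) by (auto simp: orthonormal_def cinner_self)
qed

lemma orthonormal_imp_0: "orthonormal e I \<Longrightarrow> orthonormal0 e I"
  using orthonormal_norm[of e I] by (auto simp: orthonormal_def orthonormal0_def)

lemma orthonormal_subset: "orthonormal e I \<Longrightarrow> J \<subseteq> I \<Longrightarrow> orthonormal e J"
  by (auto simp: orthonormal_def subset_iff)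

lemma orthonormal_inj: "orthonormal e I \<Longrightarrow> inj_on e I"
  unfolding orthonormal_def inj_on_def by (metis zero_neq_one)

lemma cinner_sum_orthonormal0:
  assumes "orthonormal0 e I" "finite I" "k \<in> I" "e k \<noteq> 0"
  shows "cinner (\<Sum>i\<in>I. c i *\<^sub>C e i) (e k) = c k"
proof -
  have "cinner (\<Sum>i\<in>I. c i *\<^sub>C e i) (e k) = (\<Sum>i\<in>I. if i = k then c k else 0)"
    unfolding cinner.sum_left using assms
    by (intro sum.cong) (auto simp: orthonormal0_def cinner_simps cinner_self)
  then show ?thesis using assms by simp
qed

definition oproj :: "(nat \<Rightarrow> 'a::complex_hilbert_space) \<Rightarrow> nat set \<Rightarrow> 'a \<Rightarrow> 'a" where
  "oproj e I x = (\<Sum>i\<in>I. cinner x (e i) *\<^sub>C e i)"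

lemma oproj_orthogonal:
  assumes "orthonormal0 e I" "finite I" "k \<in> I"
  shows "cinner (x - oproj e I x) (e k) = 0"
  using cinner_sum_orthonormal0[OF assms, of "\<lambda>i. cinner x (e i)"]
  by (cases "e k = 0") (auto simp: oproj_def cinner_simps)

lemma norm_sum_orthonormal0:
  assumes "orthonormal0 e I" "finite I"
  shows "(norm (\<Sum>i\<in>I. c i *\<^sub>C e i))\<^sup>2 = (\<Sum>i\<in>I. (cmod (c i) * norm (e i))\<^sup>2)"
proof -
  have "complex_of_real ((norm (\<Sum>i\<in>I. c i *\<^sub>C e i))\<^sup>2) =
      (\<Sum>k\<in>I. cnj (c k) * cinner (\<Sum>i\<in>I. c i *\<^sub>C e i) (e k))"
    unfolding cinner_self[symmetric] by (simp add: cinner.sum_right cinner_scaleC_right)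
  also have "\<dots> = (\<Sum>k\<in>I. complex_of_real ((cmod (c k) * norm (e k))\<^sup>2))"
  proof (rule sum.cong[OF refl])
    fix k assume "k \<in> I"
    show "cnj (c k) * cinner (\<Sum>i\<in>I. c i *\<^sub>C e i) (e k) =
        complex_of_real ((cmod (c k) * norm (e k))\<^sup>2)"
    proof (cases "e k = 0")
      case False
      then have "norm (e k) = 1"
        using assms \<open>k \<in> I\<close> by (auto simp: orthonormal0_def)
      then show ?thesis
        using cinner_sum_orthonormal0[OF assms \<open>k \<in> I\<close> False, of c]
        by (simp only: complex_norm_square mult_1_right) (simp add: mult.commute)
    qed simp
  qed
  also have "\<dots> = complex_of_real (\<Sum>k\<in>I. (cmod (c k) * norm (e k))\<^sup>2)"
    by simp
  finally show ?thesis
    using of_real_eq_iff by blast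
qed

lemma oproj_decomp:
  assumes "orthonormal0 e I" "finite I"
  shows "(norm x)\<^sup>2 = (norm (oproj e I x))\<^sup>2 + (norm (x - oproj e I x))\<^sup>2"
proof -
  have "cinner (x - oproj e I x) (oproj e I x) = 0"
    using oproj_orthogonal[OF assms]
    by (subst (2) oproj_def) (simp add: cinner.sum_right cinner_scaleC_right)
  then have "inner (x - oproj e I x) (oproj e I x) = 0"
    by (metis Re_cinner zero_complex.sel(1))
  then show ?thesis
    by (simp add: power2_norm_eq_inner inner_simps inner_commute)
qed

lemma oproj_norm_le: "orthonormal0 e I \<Longrightarrow> finite I \<Longrightarrow> norm (oproj e I x) \<le> norm x"
  using oproj_decomp[of e I x] by (metis le_add_same_cancel1 norm_ge_zero power2_le_imp_le
      zero_le_power2)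

lemma oproj_diff_norm_le:
  "orthonormal0 e I \<Longrightarrow> finite I \<Longrightarrow> norm (x - oproj e I x) \<le> norm x"
  using oproj_decomp[of e I x] by (metis le_add_same_cancel2 norm_ge_zero power2_le_imp_le
      zero_le_power2)

lemma bessel:
  assumes "orthonormal0 e I" "finite I"
  shows "(\<Sum>i\<in>I. (cmod (cinner x (e i)))\<^sup>2) \<le> (norm x)\<^sup>2"
proof -
  have "(cmod (cinner x (e i)))\<^sup>2 = (cmod (cinner x (e i)) * norm (e i))\<^sup>2" if "i \<in> I" for i
    using assms(1) that by (cases "e i = 0") (auto simp: orthonormal0_def)
  then have "(\<Sum>i\<in>I. (cmod (cinner x (e i)))\<^sup>2) = (norm (oproj e I x))\<^sup>2"
    unfolding oproj_def norm_sum_orthonormal0[OF assms] by (rule sum.cong[OF refl])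
  then show ?thesis
    using oproj_decomp[OF assms, of x] by simp
qed

lemma clinear_oproj: "clinear (oproj e I)"
  by (rule clinearI) (simp_all add: oproj_def cinner_simps scaleC_add_left sum.distrib
      complex_vector.scale_sum_right)

lemma adjoint_pair_oproj: "adjoint_pair (oproj e I) (oproj e I)"
  unfolding adjoint_pair_def oproj_def
  by (auto simp: cinner.sum_left cinner.sum_right cinner_simps mult.commute
      intro!: sum.cong) (metis cinner_commute)

lemma orthonormal_independent:
  fixes f :: "nat \<Rightarrow> 'a::complex_hilbert_space"
  assumes "orthonormal f I"
  shows "complex_vector.independent (f ` I)"
  unfolding complex_vector.independent_explicit_module
proof (intro allI impI)
  fix t and u :: "'a \<Rightarrow> complex" and v
  assume t: "finite t" "t \<subseteq> f ` I" and sum0: "(\<Sum>v\<in>t. u v *\<^sub>C v) = 0" and "v \<in> t"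
  have c: "cinner w v = (if w = v then 1 else 0)" if "w \<in> t" for w
  proof -
    obtain i j where "i \<in> I" "j \<in> I" "w = f i" "v = f j"
      using t(2) \<open>w \<in> t\<close> \<open>v \<in> t\<close> by blast
    then show ?thesis
      using assms inj_onD[OF orthonormal_inj[OF assms], of i j] by (auto simp: orthonormal_def)
  qed
  have "0 = cinner (\<Sum>v\<in>t. u v *\<^sub>C v) v" by (simp add: sum0)
  also have "\<dots> = (\<Sum>w\<in>t. if w = v then u v else 0)"
    unfolding cinner.sum_left by (intro sum.cong) (auto simp: cinner_simps c)
  also have "\<dots> = u v" using t(1) \<open>v \<in> t\<close> by simp
  finally show "u v = 0" by simp
qed

section \<open>Singular vectors of a compact operator\<close>

lemma compact_operatorD: "compact_operator T \<Longrightarrow> bounded_clinear T"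
  by (simp add: compact_operator_def)

lemma compact_operator_subseq:
  assumes "compact_operator T" and "\<And>n. norm (x n) \<le> B"
  shows "\<exists>r l. strict_mono (r :: nat \<Rightarrow> nat) \<and> (\<lambda>n. T (x (r n))) \<longlonglongrightarrow> l"
proof -
  have "bounded (range x)"
    using assms(2) by (auto simp: bounded_iff)
  then have "seq_compact (closure (T ` range x))"
    using assms(1) by (simp add: compact_operator_def compact_eq_seq_compact_metric)
  moreover have "\<forall>n. T (x n) \<in> closure (T ` range x)"
    by (meson closure_subset rangeI image_eqI subsetD)
  ultimately show ?thesis
    unfolding seq_compact_def comp_def by (auto dest!: spec[of _ "\<lambda>n. T (x n)"])
qed

locale compact_adjoint =
  fixes T S :: "'a::complex_hilbert_space \<Rightarrow> 'a"
  assumes compact: "compact_operator T" and adj: "adjoint_pair T S"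
begin

lemma clin: "clinear T" "clinear S"
  using adjoint_pair_clinear adj adjoint_pair_sym by blast+

lemma cinner_ST: "cinner (S (T x)) y = cinner (T x) (T y)"
  using adjoint_pairD[OF adjoint_pair_sym[OF adj]] by simp

lemma cinner_ST': "cinner x (S (T y)) = cinner (T x) (T y)"
  using adjoint_pairD[OF adj] by simp

lemma bound_S: obtains L where "0 \<le> L" "\<And>x. norm (S x) \<le> L * norm x"
proof -
  obtain L where "0 \<le> L" "\<And>x. norm (T x) \<le> L * norm x"
    using bounded_clinear_boundE[OF compact_operatorD[OF compact]] by blast
  then show thesis
    using that adjoint_pair_bound[OF adj] by blast
qed

text \<open>Compactness makes the norm m of \<open>T\<close> on \<open>V\<close> attained. For a
  maximising sequence of unit vectors x, expanding the square shows that S T x - m^2 x tends to 0;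
  invariance of \<open>V\<close> enters through the bound m^2 for S T. Along a subsequence T x
  converges, and then x itself converges, being m^(-2) times (S T x minus a null sequence).\<close>

lemma maximal_vector:
  assumes V: "complex_vector.subspace V" "closed V"
    and inv: "\<And>x. x \<in> V \<Longrightarrow> S (T x) \<in> V"
    and nz: "z \<in> V" "T z \<noteq> 0"
  shows "\<exists>e\<in>V. norm e = 1 \<and> T e \<noteq> 0 \<and> S (T e) = complex_of_real ((norm (T e))\<^sup>2) *\<^sub>C e \<and>
    (\<forall>x\<in>V. norm (T x) \<le> norm (T e) * norm x)"
proof -
  define U where "U = {x\<in>V. norm x = 1}"
  define m where "m = Sup ((\<lambda>x. norm (T x)) ` U)"
  obtain K where K: "0 \<le> K" "\<And>x. norm (T x) \<le> K * norm x"
    using bounded_clinear_boundE[OF compact_operatorD[OF compact]] by blast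
  have "z \<noteq> 0"
    using nz clinear_0[OF clin(1)] by auto
  define u where "u = complex_of_real (inverse (norm z)) *\<^sub>C z"
  have u: "u \<in> U" "T u \<noteq> 0"
    using nz \<open>z \<noteq> 0\<close> V(1)
    by (auto simp: u_def U_def clinear_scaleC[OF clin(1)] complex_vector.subspace_scale norm_inverse)
  have bdd: "bdd_above ((\<lambda>x. norm (T x)) ` U)"
    using K by (intro bdd_aboveI[where M=K]) (auto simp: U_def, metis mult.right_neutral)
  have le: "norm (T x) \<le> m" if "x \<in> U" for x
    unfolding m_def using that bdd by (simp add: cSup_upper)
  have "m > 0"
    using le[OF u(1)] u(2) by (meson less_le_trans zero_less_norm_iff)
  have le': "norm (T x) \<le> m * norm x" if "x \<in> V" for x
  proof (cases "x = 0")
    case False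
    have "complex_of_real (inverse (norm x)) *\<^sub>C x \<in> U"
      using that False V(1) by (auto simp: U_def complex_vector.subspace_scale norm_inverse)
    from le[OF this] show ?thesis
      using False by (simp add: clinear_scaleC[OF clin(1)] field_simps norm_divide)
  qed (simp add: clinear_0[OF clin(1)])
  have "\<exists>x\<in>U. m - inverse (Suc n) < norm (T x)" for n :: nat
    using less_cSupD[of "(\<lambda>x. norm (T x)) ` U" "m - inverse (Suc n)"] u(1)
    unfolding m_def by auto
  then obtain x where x: "\<And>n. x n \<in> U" "\<And>n::nat. m - inverse (Suc n) < norm (T (x n))"
    by metis
  have limm: "(\<lambda>n. norm (T (x n))) \<longlonglongrightarrow> m"
  proof (rule real_tendsto_sandwich[OF _ _ _ tendsto_const])
    show "(\<lambda>n. m - inverse (real (Suc n))) \<longlonglongrightarrow> m"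
      using tendsto_diff[OF tendsto_const LIMSEQ_inverse_real_of_nat] by simp
    show "\<forall>\<^sub>F n in sequentially. m - inverse (real (Suc n)) \<le> norm (T (x n))"
      by (intro always_eventually allI less_imp_le x(2))
  qed (use x(1) le in simp)
  have ST_le: "norm (S (T y)) \<le> m\<^sup>2" if "y \<in> U" for y
  proof (cases "S (T y) = 0")
    case False
    have yV: "y \<in> V" "norm y = 1" using that by (auto simp: U_def)
    have "(norm (S (T y)))\<^sup>2 = cmod (cinner (T y) (T (S (T y))))"
      by (metis cinner_ST cinner_self norm_of_real abs_of_nonneg zero_le_power2)
    also have "\<dots> \<le> norm (T y) * norm (T (S (T y)))"
      by (rule cinner_bound)
    also have "\<dots> \<le> m * (m * norm (S (T y)))"
      using le[OF that] le'[OF inv[OF yV(1)]] \<open>m > 0\<close> by (intro mult_mono) auto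
    finally show ?thesis
      using False by (simp add: power2_eq_square)
  qed simp
  define d where "d n = S (T (x n)) - complex_of_real (m\<^sup>2) *\<^sub>C x n" for n
  have dle: "(norm (d n))\<^sup>2 \<le> 2 * m\<^sup>2 * (m\<^sup>2 - (norm (T (x n)))\<^sup>2)" for n
  proof -
    have "(norm (d n))\<^sup>2 = (norm (S (T (x n))))\<^sup>2 + (m\<^sup>2 * norm (x n))\<^sup>2
        - 2 * Re (cinner (S (T (x n))) (complex_of_real (m\<^sup>2) *\<^sub>C x n))"
      unfolding d_def Re_cinner
      by (simp add: power2_norm_eq_inner inner_simps inner_commute)
        (use \<open>m > 0\<close> in \<open>simp add: norm_mult power2_eq_square flip: power2_norm_eq_inner\<close>)
    moreover have "Re (cinner (S (T (x n))) (complex_of_real (m\<^sup>2) *\<^sub>C x n)) =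
        m\<^sup>2 * (norm (T (x n)))\<^sup>2"
      unfolding cinner_scaleC_right cinner_ST cinner_self by (simp flip: of_real_power of_real_mult)
    moreover have "(norm (S (T (x n))))\<^sup>2 \<le> (m\<^sup>2)\<^sup>2"
      using ST_le[OF x(1)] by (intro power_mono) auto
    moreover have "norm (x n) = 1" using x(1) by (auto simp: U_def)
    ultimately show ?thesis by (simp add: power2_eq_square algebra_simps)
  qed
  have "(\<lambda>n. 2 * m\<^sup>2 * (m\<^sup>2 - (norm (T (x n)))\<^sup>2)) \<longlonglongrightarrow> 2 * m\<^sup>2 * (m\<^sup>2 - m\<^sup>2)"
    by (intro tendsto_intros limm)
  then have "(\<lambda>n. 2 * m\<^sup>2 * (m\<^sup>2 - (norm (T (x n)))\<^sup>2)) \<longlonglongrightarrow> 0"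
    by simp
  moreover have "\<forall>\<^sub>F n in sequentially. norm ((norm (d n))\<^sup>2) \<le> 2 * m\<^sup>2 * (m\<^sup>2 - (norm (T (x n)))\<^sup>2)"
    by (rule always_eventually) (simp only: real_norm_def abs_power2 dle simp_thms)
  ultimately have "(\<lambda>n. (norm (d n))\<^sup>2) \<longlonglongrightarrow> 0"
    by (rule Lim_null_comparison[rotated])
  then have "(\<lambda>n. sqrt ((norm (d n))\<^sup>2)) \<longlonglongrightarrow> sqrt 0"
    by (rule tendsto_real_sqrt)
  then have d0: "d \<longlonglongrightarrow> 0"
    by (simp add: tendsto_norm_zero_iff)
  obtain r l where r: "strict_mono (r :: nat \<Rightarrow> nat)" and l: "(\<lambda>n. T (x (r n))) \<longlonglongrightarrow> l"
    using compact_operator_subseq[OF compact, of x 1] x(1) by (auto simp: U_def)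
  have bl: "bounded_linear T" "bounded_linear S"
    using compact_operatorD[OF compact] clin(2) bound_S
    by (auto simp: bounded_clinear_def) (metis bounded_clinear_def bounded_clinear_iff)
  define e where "e = complex_of_real (inverse (m\<^sup>2)) *\<^sub>C S l"
  have "(\<lambda>n. complex_of_real (inverse (m\<^sup>2)) *\<^sub>C (S (T (x (r n))) - d (r n)))
      \<longlonglongrightarrow> complex_of_real (inverse (m\<^sup>2)) *\<^sub>C (S l - 0)"
    by (intro scaleC.tendsto tendsto_const tendsto_diff bounded_linear.tendsto[OF bl(2)] l
        LIMSEQ_subseq_LIMSEQ[OF d0 r, unfolded comp_def])
  moreover have "complex_of_real (inverse (m\<^sup>2)) *\<^sub>C (S (T (x n)) - d n) = x n" for n
    using \<open>m > 0\<close> by (simp add: d_def scaleC_scaleC scaleC_one flip: of_real_power of_real_mult)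
  ultimately have xe: "(\<lambda>n. x (r n)) \<longlonglongrightarrow> e"
    by (simp add: e_def)
  have "e \<in> V"
    using closed_sequentially[OF V(2) _ xe] x(1) by (auto simp: U_def)
  moreover have "norm e = 1"
    using LIMSEQ_unique[OF tendsto_norm[OF xe]] x(1) by (auto simp: U_def)
  moreover have Te: "norm (T e) = m"
    using LIMSEQ_unique[OF tendsto_norm[OF bounded_linear.tendsto[OF bl(1) xe]]]
      LIMSEQ_subseq_LIMSEQ[OF limm r] by (simp add: comp_def)
  moreover have "S (T e) = complex_of_real ((norm (T e))\<^sup>2) *\<^sub>C e"
  proof -
    have "(\<lambda>n. d (r n)) \<longlonglongrightarrow> S (T e) - complex_of_real (m\<^sup>2) *\<^sub>C e"
      unfolding d_def
      by (intro tendsto_intros bounded_linear.tendsto[OF bl(2)] bounded_linear.tendsto[OF bl(1)] xe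
          scaleC.tendsto)
    then have "S (T e) - complex_of_real (m\<^sup>2) *\<^sub>C e = 0"
      using LIMSEQ_subseq_LIMSEQ[OF d0 r] unfolding comp_def by (rule LIMSEQ_unique)
    then show ?thesis using Te by simp
  qed
  ultimately show ?thesis
    using le' \<open>m > 0\<close> by (intro bexI[of _ e]) auto
qed

text \<open>The last clause makes \<open>norm (T r)\<close> the norm of \<open>T\<close> on the
  complement of the earlier vectors. The vector r = 0 is taken once \<open>T\<close> vanishes there,
  so that the singular values continue with zeros as in \<open>s_number_sequence\<close>.\<close>

definition next_singular_vector :: "(nat \<Rightarrow> 'a) \<Rightarrow> nat \<Rightarrow> 'a \<Rightarrow> bool" where
  "next_singular_vector f n r \<longleftrightarrow> (\<forall>j<n. cinner r (f j) = 0) \<and>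
     (norm r = 1 \<and> T r \<noteq> 0 \<or> r = 0) \<and> S (T r) = complex_of_real ((norm (T r))\<^sup>2) *\<^sub>C r \<and>
     (\<forall>x. (\<forall>j<n. cinner x (f j) = 0) \<longrightarrow> norm (T x) \<le> norm (T r) * norm x)"

text \<open>The earlier vectors are eigenvectors of S T, which is symmetric; so their orthogonal
  complement is invariant under S T and the maximisation can be repeated there.\<close>

lemma singular_vectors_exist: "\<exists>e. \<forall>n. next_singular_vector e n (e n)"
proof (rule dependent_wellorder_choice)
  fix f :: "nat \<Rightarrow> 'a" and n
  assume IH: "\<And>y. y < n \<Longrightarrow> next_singular_vector f y (f y)"
  define V where "V = {x. \<forall>j<n. cinner x (f j) = 0}"
  have V: "complex_vector.subspace V"
    by (rule complex_vector.subspaceI) (auto simp: V_def cinner_simps)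
  have "V = (\<Inter>j\<in>{..<n}. {x. cinner x (f j) = 0})"
    by (auto simp: V_def)
  then have "closed V"
    by (auto intro!: closed_INT closed_Collect_eq
        linear_continuous_on[OF cinner.bounded_linear_left] continuous_on_const)
  have inv: "S (T x) \<in> V" if "x \<in> V" for x
    unfolding V_def
  proof (intro CollectI allI impI)
    fix j assume "j < n"
    then have "S (T (f j)) = complex_of_real ((norm (T (f j)))\<^sup>2) *\<^sub>C f j" "cinner x (f j) = 0"
      using IH[of j] that by (auto simp: next_singular_vector_def V_def)
    then show "cinner (S (T x)) (f j) = 0"
      unfolding cinner_ST cinner_ST'[symmetric] by (simp add: cinner_scaleC_right)
  qed
  show "\<exists>r. next_singular_vector f n r"
  proof (cases "\<forall>x\<in>V. T x = 0")
    case True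
    then show ?thesis
      by (intro exI[of _ 0])
        (auto simp: next_singular_vector_def V_def clinear_0[OF clin(1)] clinear_0[OF clin(2)])
  next
    case False
    then obtain z where "z \<in> V" "T z \<noteq> 0" by auto
    from maximal_vector[OF V \<open>closed V\<close> inv this] show ?thesis
      unfolding next_singular_vector_def V_def by blast
  qed
qed (simp add: next_singular_vector_def)

definition e :: "nat \<Rightarrow> 'a" where
  "e = (SOME e. \<forall>n. next_singular_vector e n (e n))"

definition \<sigma> :: "nat \<Rightarrow> real" where "\<sigma> n = norm (T (e n))"

lemma singular_vector:
  shows "j < n \<Longrightarrow> cinner (e n) (e j) = 0"
    and "norm (e n) = 1 \<and> T (e n) \<noteq> 0 \<or> e n = 0"
    and "S (T (e n)) = complex_of_real ((\<sigma> n)\<^sup>2) *\<^sub>C e n"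
    and "(\<And>j. j < n \<Longrightarrow> cinner x (e j) = 0) \<Longrightarrow> norm (T x) \<le> \<sigma> n * norm x"
proof -
  have *: "next_singular_vector e n (e n)"
    using someI_ex[OF singular_vectors_exist, folded e_def] by blast
  note * = *[unfolded next_singular_vector_def, folded \<sigma>_def]
  show "j < n \<Longrightarrow> cinner (e n) (e j) = 0"
    using *[THEN conjunct1] by blast
  show "norm (e n) = 1 \<and> T (e n) \<noteq> 0 \<or> e n = 0"
    by (rule *[THEN conjunct2, THEN conjunct1])
  show "S (T (e n)) = complex_of_real ((\<sigma> n)\<^sup>2) *\<^sub>C e n"
    by (rule *[THEN conjunct2, THEN conjunct2, THEN conjunct1])
  show "(\<And>j. j < n \<Longrightarrow> cinner x (e j) = 0) \<Longrightarrow> norm (T x) \<le> \<sigma> n * norm x"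
    using *[THEN conjunct2, THEN conjunct2, THEN conjunct2] by blast
qed

lemma \<sigma>_nonneg: "0 \<le> \<sigma> n"
  by (simp add: \<sigma>_def)

lemma \<sigma>_pos: "0 < \<sigma> n \<Longrightarrow> norm (e n) = 1"
  using singular_vector(2)[of n] clinear_0[OF clin(1)] by (auto simp: \<sigma>_def)

lemma orthonormal0_e: "orthonormal0 e I"
  unfolding orthonormal0_def using singular_vector(1,2) cinner_sym_0 by (metis nat_neq_iff)

lemma decseq_\<sigma>: "decseq \<sigma>"
proof (rule decseq_SucI)
  fix n
  have "\<sigma> (Suc n) \<le> \<sigma> n * norm (e (Suc n))"
    unfolding \<sigma>_def[of "Suc n"] by (rule singular_vector(4)) (simp add: singular_vector(1))
  also have "\<dots> \<le> \<sigma> n"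
    using singular_vector(2)[of "Suc n"] \<sigma>_nonneg[of n] by auto
  finally show "\<sigma> (Suc n) \<le> \<sigma> n" .
qed

lemma orthonormal_e: "0 < \<sigma> n \<Longrightarrow> I \<subseteq> {..n} \<Longrightarrow> orthonormal e I"
proof (rule orthonormalI)
  fix i assume "0 < \<sigma> n" "I \<subseteq> {..n}" "i \<in> I"
  then show "norm (e i) = 1"
    by (intro \<sigma>_pos) (metis atMost_iff decseqD decseq_\<sigma> less_le_trans subsetD)
qed (simp add: singular_vector(1))

text \<open>The vectors T e_n are pairwise orthogonal. If their norms stayed above c > 0, any two of
  them would be at distance at least c, and no subsequence could converge.\<close>

lemma \<sigma>_tendsto_0: "\<sigma> \<longlonglongrightarrow> 0"
proof (rule LIMSEQ_I)
  fix c :: real assume "0 < c"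
  have "\<exists>n. \<sigma> n < c"
  proof (rule ccontr)
    assume "\<not> (\<exists>n. \<sigma> n < c)"
    then have ge: "c \<le> \<sigma> n" for n by (simp add: not_less)
    then have pos: "0 < \<sigma> n" for n using \<open>0 < c\<close> by (meson less_le_trans)
    obtain r l where r: "strict_mono (r :: nat \<Rightarrow> nat)" and l: "(\<lambda>n. T (e (r n))) \<longlonglongrightarrow> l"
      using compact_operator_subseq[OF compact, of e 1] \<sigma>_pos[OF pos] by auto
    have "Cauchy (\<lambda>n. T (e (r n)))" using l by (rule LIMSEQ_imp_Cauchy)
    then obtain N where N: "\<And>m n. m \<ge> N \<Longrightarrow> n \<ge> N \<Longrightarrow> dist (T (e (r m))) (T (e (r n))) < c"
      using \<open>0 < c\<close> unfolding Cauchy_def by blast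
    have lt: "r N < r (Suc N)" using r by (simp add: strict_mono_Suc_iff)
    let ?a = "e (r (Suc N))" and ?b = "e (r N)"
    have "cinner (T ?a) (T ?b) = 0"
      unfolding cinner_ST[symmetric] singular_vector(3) cinner_scaleC_left using singular_vector(1)[OF lt] by simp
    then have "inner (T ?a) (T ?b) = 0"
      by (metis Re_cinner zero_complex.sel(1))
    then have "(norm (T ?a - T ?b))\<^sup>2 = (norm (T ?a))\<^sup>2 + (norm (T ?b))\<^sup>2"
      by (simp add: power2_norm_eq_inner inner_simps inner_commute)
    moreover have "c\<^sup>2 \<le> (norm (T ?a))\<^sup>2"
      using ge[of "r (Suc N)"] \<open>0 < c\<close> by (intro power_mono) (auto simp: \<sigma>_def)
    ultimately have "c\<^sup>2 \<le> (norm (T ?a - T ?b))\<^sup>2" by (simp add: add_increasing2)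
    then have "c \<le> norm (T ?a - T ?b)" by (rule power2_le_imp_le) simp
    then show False using N[of "Suc N" N] by (simp add: dist_norm)
  qed
  then obtain n where "\<sigma> n < c" by blast
  then show "\<exists>no. \<forall>n\<ge>no. norm (\<sigma> n - 0) < c"
    using decseqD[OF decseq_\<sigma>] \<sigma>_nonneg by (intro exI[of _ n]) (auto intro: le_less_trans)
qed

lemma residual: "norm (T (x - oproj e {..<n} x)) \<le> \<sigma> n * norm x"
proof -
  have "norm (T (x - oproj e {..<n} x)) \<le> \<sigma> n * norm (x - oproj e {..<n} x)"
    by (rule singular_vector(4)) (simp add: oproj_orthogonal[OF orthonormal0_e])
  also have "\<dots> \<le> \<sigma> n * norm x"
    by (intro mult_left_mono oproj_diff_norm_le orthonormal0_e \<sigma>_nonneg) simp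
  finally show ?thesis .
qed

subsection \<open>The square root\<close>

text \<open>Partial sums of the spectral expansion of |T|, whose eigenvectors are the
  \<open>e j\<close> with eigenvalues \<open>\<sigma> j\<close>. Zero vectors in the list contribute
  nothing.\<close>

definition sqrt_sum :: "nat \<Rightarrow> 'a \<Rightarrow> 'a" where
  "sqrt_sum n x = (\<Sum>j<n. (complex_of_real (\<sigma> j) * cinner x (e j)) *\<^sub>C e j)"

lemma sqrt_sum_dist: "m \<le> n \<Longrightarrow> norm (sqrt_sum n x - sqrt_sum m x) \<le> \<sigma> m * norm x"
proof -
  assume "m \<le> n"
  then have split: "{..<n} = {..<m} \<union> {m..<n}" by auto
  have "sqrt_sum n x = sqrt_sum m x + (\<Sum>j\<in>{m..<n}. (complex_of_real (\<sigma> j) * cinner x (e j)) *\<^sub>C e j)"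
    unfolding sqrt_sum_def split by (rule sum.union_disjoint) auto
  then have "sqrt_sum n x - sqrt_sum m x = (\<Sum>j\<in>{m..<n}. (complex_of_real (\<sigma> j) * cinner x (e j)) *\<^sub>C e j)"
    by simp
  then have "(norm (sqrt_sum n x - sqrt_sum m x))\<^sup>2 =
      (\<Sum>j\<in>{m..<n}. (cmod (complex_of_real (\<sigma> j) * cinner x (e j)) * norm (e j))\<^sup>2)"
    by (simp only: norm_sum_orthonormal0[OF orthonormal0_e finite_atLeastLessThan])
  also have "\<dots> \<le> (\<Sum>j\<in>{m..<n}. (\<sigma> m)\<^sup>2 * (cmod (cinner x (e j)))\<^sup>2)"
  proof (rule sum_mono)
    fix j assume "j \<in> {m..<n}"
    then have "\<sigma> j \<le> \<sigma> m" using decseqD[OF decseq_\<sigma>] by auto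
    moreover have "norm (e j) \<le> 1" using singular_vector(2)[of j] by auto
    ultimately have "\<sigma> j * cmod (cinner x (e j)) * norm (e j) \<le> \<sigma> m * cmod (cinner x (e j)) * 1"
      using \<sigma>_nonneg by (intro mult_mono) auto
    then have "(\<sigma> j * cmod (cinner x (e j)) * norm (e j))\<^sup>2 \<le> (\<sigma> m * cmod (cinner x (e j)))\<^sup>2"
      using \<sigma>_nonneg[of j] by (intro power_mono) auto
    then show "(cmod (complex_of_real (\<sigma> j) * cinner x (e j)) * norm (e j))\<^sup>2
        \<le> (\<sigma> m)\<^sup>2 * (cmod (cinner x (e j)))\<^sup>2"
      using \<sigma>_nonneg[of j] by (simp add: norm_mult power_mult_distrib)
  qed
  also have "\<dots> \<le> (\<sigma> m)\<^sup>2 * (norm x)\<^sup>2"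
    unfolding sum_distrib_left[symmetric]
    by (intro mult_left_mono bessel orthonormal0_e) auto
  finally show ?thesis
    using \<sigma>_nonneg[of m] by (simp add: power2_le_iff_abs_le flip: power_mult_distrib)
qed

definition sqrt_op :: "'a \<Rightarrow> 'a" where "sqrt_op x = lim (\<lambda>n. sqrt_sum n x)"

lemma sqrt_sum_tendsto: "(\<lambda>n. sqrt_sum n x) \<longlonglongrightarrow> sqrt_op x"
proof -
  have "Cauchy (\<lambda>n. sqrt_sum n x)"
  proof (rule CauchyI')
    fix c :: real assume "0 < c"
    have "(\<lambda>n. \<sigma> n * norm x) \<longlonglongrightarrow> 0 * norm x"
      by (intro tendsto_intros \<sigma>_tendsto_0)
    then have "\<forall>\<^sub>F n in sequentially. \<sigma> n * norm x < c"
      using \<open>0 < c\<close> by (auto intro: order_tendstoD)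
    then obtain N where N: "\<sigma> n * norm x < c" if "N \<le> n" for n
      by (auto simp: eventually_sequentially)
    have "dist (sqrt_sum m x) (sqrt_sum n x) < c" if "N \<le> m" "m < n" for m n
      using sqrt_sum_dist[of m n x] N[OF that(1)] that by (simp add: dist_norm norm_minus_commute)
    then show "\<exists>M. \<forall>m\<ge>M. \<forall>n>m. dist (sqrt_sum m x) (sqrt_sum n x) < c"
      by blast
  qed
  then show ?thesis
    unfolding sqrt_op_def by (simp add: Cauchy_convergent_iff convergent_LIMSEQ_iff)
qed

lemma sqrt_sum_sym: "cinner (sqrt_sum n x) y = cinner x (sqrt_sum n y)"
  unfolding sqrt_sum_def cinner.sum_left cinner.sum_right
  by (intro sum.cong) (auto simp: cinner_simps mult.assoc cinner_commute[of _ y])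

lemma sqrt_op_sym: "cinner (sqrt_op x) y = cinner x (sqrt_op y)"
proof (rule LIMSEQ_unique)
  show "(\<lambda>n. cinner (sqrt_sum n x) y) \<longlonglongrightarrow> cinner (sqrt_op x) y"
    by (intro cinner.tendsto sqrt_sum_tendsto tendsto_const)
  show "(\<lambda>n. cinner (sqrt_sum n x) y) \<longlonglongrightarrow> cinner x (sqrt_op y)"
    unfolding sqrt_sum_sym by (intro cinner.tendsto sqrt_sum_tendsto tendsto_const)
qed

lemma norm_sqrt_op_le: "norm (sqrt_op x) \<le> \<sigma> 0 * norm x"
proof (rule LIMSEQ_le_const2[OF tendsto_norm[OF sqrt_sum_tendsto]])
  show "\<exists>N. \<forall>n\<ge>N. norm (sqrt_sum n x) \<le> \<sigma> 0 * norm x"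
    using sqrt_sum_dist[of 0 _ x] by (auto simp: sqrt_sum_def[of 0])
qed

lemma nonneg_sqrt_op: "nonneg_operator sqrt_op"
proof -
  have adj_sqrt_op: "adjoint_pair sqrt_op sqrt_op"
    by (simp add: adjoint_pair_def sqrt_op_sym)
  have "bounded_clinear sqrt_op"
    using adjoint_pair_clinear[OF adj_sqrt_op] norm_sqrt_op_le by (auto simp: bounded_clinear_iff)
  moreover have "cinner (sqrt_op x) x \<in> \<real>\<^sub>\<ge>\<^sub>0" for x
  proof (rule closed_sequentially[OF closed_nonneg_Reals_complex])
    show "(\<lambda>n. cinner (sqrt_sum n x) x) \<longlonglongrightarrow> cinner (sqrt_op x) x"
      by (intro cinner.tendsto sqrt_sum_tendsto tendsto_const)
    fix n
    have "cinner (sqrt_sum n x) x = complex_of_real (\<Sum>j<n. \<sigma> j * (cmod (cinner x (e j)))\<^sup>2)"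
      unfolding sqrt_sum_def cinner.sum_left of_real_sum
      by (intro sum.cong) (simp_all add: cinner_scaleC_left cinner_mult_cnj mult.assoc)
    moreover have "0 \<le> (\<Sum>j<n. \<sigma> j * (cmod (cinner x (e j)))\<^sup>2)"
      by (intro sum_nonneg mult_nonneg_nonneg \<sigma>_nonneg) auto
    ultimately show "cinner (sqrt_sum n x) x \<in> \<real>\<^sub>\<ge>\<^sub>0"
      by (simp only: nonneg_Reals_of_real_iff)
  qed
  ultimately show ?thesis
    by (auto simp: nonneg_operator_def selfadjoint_def sqrt_op_sym)
qed

text \<open>Applying S T to the projection of x onto the first n singular vectors gives exactly the
  n-th partial sum at \<open>sqrt_op x\<close>; the remaining part is small by
  \<open>residual\<close>.\<close>

lemma sqrt_op_sqrt_op: "sqrt_op (sqrt_op x) = S (T x)"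
proof -
  obtain L where L: "0 \<le> L" "\<And>x. norm (S x) \<le> L * norm x" using bound_S by blast
  have cinner_sqrt_op_e: "cinner (sqrt_op x) (e k) = complex_of_real (\<sigma> k) * cinner x (e k)" for x k
  proof (cases "e k = 0")
    case False
    have "cinner (sqrt_sum n x) (e k) = complex_of_real (\<sigma> k) * cinner x (e k)" if "k < n" for n
      unfolding sqrt_sum_def using that False by (intro cinner_sum_orthonormal0 orthonormal0_e) auto
    then have "\<forall>\<^sub>F n in sequentially. cinner (sqrt_sum n x) (e k) = complex_of_real (\<sigma> k) * cinner x (e k)"
      by (intro eventually_sequentiallyI[of "Suc k"]) simp
    then have "(\<lambda>n. cinner (sqrt_sum n x) (e k)) \<longlonglongrightarrow> complex_of_real (\<sigma> k) * cinner x (e k)"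
      by (rule tendsto_eventually)
    moreover have "(\<lambda>n. cinner (sqrt_sum n x) (e k)) \<longlonglongrightarrow> cinner (sqrt_op x) (e k)"
      by (intro cinner.tendsto sqrt_sum_tendsto tendsto_const)
    ultimately show ?thesis using LIMSEQ_unique by blast
  qed simp
  have eq: "sqrt_sum n (sqrt_op x) = S (T x) - S (T (x - oproj e {..<n} x))" for n
  proof -
    have "S (T (oproj e {..<n} x)) = sqrt_sum n (sqrt_op x)"
      unfolding oproj_def sqrt_sum_def
      by (simp add: clinear_sum[OF clin(1)] clinear_sum[OF clin(2)] clinear_scaleC[OF clin(1)]
          clinear_scaleC[OF clin(2)] singular_vector(3) cinner_sqrt_op_e scaleC_scaleC power2_eq_square mult_ac)
    then show ?thesis by (simp add: clinear_diff[OF clin(1)] clinear_diff[OF clin(2)])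
  qed
  have "(\<lambda>n. L * (\<sigma> n * norm x)) \<longlonglongrightarrow> 0"
    by (intro tendsto_mult_right_zero tendsto_mult_left_zero \<sigma>_tendsto_0)
  moreover have "norm (S (T (x - oproj e {..<n} x))) \<le> L * (\<sigma> n * norm x)" for n
    using L(2) mult_left_mono[OF residual L(1)] by (rule order_trans)
  ultimately have "(\<lambda>n. S (T (x - oproj e {..<n} x))) \<longlonglongrightarrow> 0"
    by (rule Lim_null_comparison[OF always_eventually[OF allI], rotated])
  then have "(\<lambda>n. sqrt_sum n (sqrt_op x)) \<longlonglongrightarrow> S (T x) - 0"
    unfolding eq by (intro tendsto_diff tendsto_const)
  then show ?thesis
    by (metis LIMSEQ_unique sqrt_sum_tendsto diff_zero)
qed

text \<open>Since (R + \<sigma>)(R - \<sigma>) annihilates e_n, the vector y = (R - \<sigma>) e_n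
  satisfies R y = - \<sigma> y. For \<sigma> > 0 non-negativity of \<open>R\<close> then forces y =
  0.\<close>

lemma sqrt_eigen:
  assumes R: "nonneg_operator R" "\<And>x. R (R x) = S (T x)"
  shows "R (e n) = complex_of_real (\<sigma> n) *\<^sub>C e n" and "norm (R x) = norm (T x)"
proof -
  have lin: "clinear R"
    using R(1) by (auto simp: nonneg_operator_def selfadjoint_def bounded_clinear_imp_clinear)
  have sym: "cinner (R x) y = cinner x (R y)" for x y
    using R(1) by (auto simp: nonneg_operator_def selfadjoint_def)
  have "complex_of_real ((norm (R x))\<^sup>2) = complex_of_real ((norm (T x))\<^sup>2)" for x
    by (simp only: cinner_self[symmetric] sym R(2) cinner_ST')
  then have nrm: "norm (R x) = norm (T x)" for x
    unfolding of_real_eq_iff by (simp add: power2_eq_iff_nonneg)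
  then show "norm (R x) = norm (T x)" .
  show "R (e n) = complex_of_real (\<sigma> n) *\<^sub>C e n"
  proof (cases "\<sigma> n = 0")
    case True
    then show ?thesis using nrm[of "e n"] by (simp add: \<sigma>_def)
  next
    case False
    define y where "y = R (e n) - complex_of_real (\<sigma> n) *\<^sub>C e n"
    have "R y = - complex_of_real (\<sigma> n) *\<^sub>C y"
      by (simp add: y_def clinear_diff[OF lin] clinear_scaleC[OF lin] R(2) singular_vector(3)
          complex_vector.scale_right_diff_distrib scaleC_scaleC power2_eq_square
          complex_vector.scale_minus_left)
    then have "cinner (R y) y = complex_of_real (- (\<sigma> n * (norm y)\<^sup>2))"
      by (simp add: cinner_scaleC_left cinner_self cinner.minus_left)
    moreover have "cinner (R y) y \<in> \<real>\<^sub>\<ge>\<^sub>0"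
      using R(1) by (simp add: nonneg_operator_def)
    ultimately have "\<sigma> n * (norm y)\<^sup>2 \<le> 0"
      by (metis neg_0_le_iff_le nonneg_Reals_of_real_iff)
    then have "y = 0"
      using False \<sigma>_nonneg[of n] by (metis dual_order.antisym less_eq_real_def mult_eq_0_iff
          norm_eq_zero zero_eq_power2 zero_le_mult_iff zero_le_power2)
    then show ?thesis by (simp add: y_def)
  qed
qed

text \<open>Every non-negative root acts on the singular vectors in the same way, and it is as small
  as \<open>T\<close> on what is left of x after projecting. So it is the limit of the same partial
  sums.\<close>

lemma sqrt_unique:
  assumes R: "nonneg_operator R" "\<And>x. R (R x) = S (T x)"
  shows "R = sqrt_op"
proof
  fix x
  have lin: "clinear R"
    using R(1) by (auto simp: nonneg_operator_def selfadjoint_def bounded_clinear_imp_clinear)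
  have eq: "sqrt_sum n x = R x - R (x - oproj e {..<n} x)" for n
    by (simp add: clinear_diff[OF lin] oproj_def sqrt_sum_def clinear_sum[OF lin] clinear_scaleC[OF lin]
        sqrt_eigen(1)[OF R] scaleC_scaleC mult.commute)
  have "(\<lambda>n. \<sigma> n * norm x) \<longlonglongrightarrow> 0"
    by (intro tendsto_mult_left_zero \<sigma>_tendsto_0)
  then have "(\<lambda>n. R (x - oproj e {..<n} x)) \<longlonglongrightarrow> 0"
    by (rule Lim_null_comparison[rotated]) (simp add: sqrt_eigen(2)[OF R] residual)
  then have "(\<lambda>n. sqrt_sum n x) \<longlonglongrightarrow> R x - 0"
    unfolding eq by (intro tendsto_diff tendsto_const)
  then show "R x = sqrt_op x"
    by (metis LIMSEQ_unique sqrt_sum_tendsto diff_zero)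
qed

lemma operator_abs_eq: "operator_abs T = sqrt_op"
  unfolding operator_abs_def hilbert_adjoint_eq[OF adj] operator_sqrt_def
proof (rule the_equality)
  show "nonneg_operator sqrt_op \<and> sqrt_op \<circ> sqrt_op = S \<circ> T"
    using nonneg_sqrt_op sqrt_op_sqrt_op by (auto simp: fun_eq_iff)
  show "R = sqrt_op" if "nonneg_operator R \<and> R \<circ> R = S \<circ> T" for R
    using that by (intro sqrt_unique) (auto simp: fun_eq_iff)
qed

lemma sqrt_op_e: "sqrt_op (e n) = complex_of_real (\<sigma> n) *\<^sub>C e n"
  by (rule sqrt_eigen(1)[OF nonneg_sqrt_op sqrt_op_sqrt_op])

section \<open>Identification of the s-numbers with the sequence of maxima\<close>

lemma level_set_finite: "0 < c \<Longrightarrow> finite {n. \<sigma> n = c}"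
proof -
  assume "0 < c"
  then have "\<forall>\<^sub>F n in sequentially. \<sigma> n < c"
    using \<sigma>_tendsto_0 by (simp add: order_tendstoD(2))
  then obtain N where "\<forall>n\<ge>N. \<sigma> n < c"
    by (auto simp: eventually_sequentially)
  then have "{n. \<sigma> n = c} \<subseteq> {..<N}"
    by (force simp: not_le[symmetric])
  then show ?thesis using finite_subset by blast
qed

text \<open>An eigenvector of |T| for c > 0 is orthogonal to every e_n with \<sigma>_n \<noteq> c.
  After subtracting its projection onto the level set it is orthogonal to all e_n, hence killed by
  \<open>T\<close>, and eigenvalue c > 0 leaves only zero. So the e_n of the level set form a basis
  of the eigenspace.\<close>

lemma s_number_sequence_\<sigma>: "s_number_sequence T \<sigma>"
  unfolding s_number_sequence_def operator_abs_eq
proof (intro conjI allI impI)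
  fix c :: real assume "0 < c"
  define J where "J = {n. \<sigma> n = c}"
  show fin: "finite {n. \<sigma> n = c}" by (rule level_set_finite) fact
  have on: "orthonormal e J"
    unfolding J_def using \<open>0 < c\<close> by (intro orthonormalI singular_vector(1) \<sigma>_pos) auto
  have lin_sqrt_op: "clinear sqrt_op"
    using nonneg_sqrt_op by (auto simp: nonneg_operator_def selfadjoint_def bounded_clinear_imp_clinear)
  have "complex_vector.dim (eigenspace sqrt_op (complex_of_real c)) = card (e ` J)"
  proof (rule complex_vector.dim_unique[OF _ _ orthonormal_independent[OF on] refl])
    show "e ` J \<subseteq> eigenspace sqrt_op (complex_of_real c)"
      by (auto simp: eigenspace_def J_def sqrt_op_e)
    show "eigenspace sqrt_op (complex_of_real c) \<subseteq> complex_vector.span (e ` J)"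
    proof
      fix x assume "x \<in> eigenspace sqrt_op (complex_of_real c)"
      then have x: "sqrt_op x = complex_of_real c *\<^sub>C x" by (simp add: eigenspace_def)
      have perp: "cinner x (e n) = 0" if "\<sigma> n \<noteq> c" for n
      proof -
        have "complex_of_real c * cinner x (e n) = complex_of_real (\<sigma> n) * cinner x (e n)"
          using sqrt_op_sym[of x "e n"] by (simp add: x sqrt_op_e cinner_simps)
        then show ?thesis using that by simp
      qed
      define w where "w = x - oproj e J x"
      have "sqrt_op (oproj e J x) = complex_of_real c *\<^sub>C oproj e J x"
        unfolding oproj_def
        by (auto simp: clinear_sum[OF lin_sqrt_op] clinear_scaleC[OF lin_sqrt_op] sqrt_op_e J_def
            complex_vector.scale_sum_right scaleC_scaleC mult.commute intro!: sum.cong)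
      then have Qw: "sqrt_op w = complex_of_real c *\<^sub>C w"
        by (simp add: w_def clinear_diff[OF lin_sqrt_op] x complex_vector.scale_right_diff_distrib)
      have wperp: "cinner w (e n) = 0" for n
      proof (cases "n \<in> J")
        case True
        then show ?thesis
          unfolding w_def using fin by (intro oproj_orthogonal orthonormal0_e) (auto simp: J_def)
      next
        case False
        then have "complex_of_real c * cinner w (e n) = complex_of_real (\<sigma> n) * cinner w (e n)"
          using sqrt_op_sym[of w "e n"] by (simp add: Qw sqrt_op_e cinner_simps)
        then show ?thesis using False by (simp add: J_def)
      qed
      have "norm (T w) \<le> \<sigma> n * norm w" for n
        by (rule singular_vector(4)) (simp add: wperp)
      moreover have "(\<lambda>n. \<sigma> n * norm w) \<longlonglongrightarrow> 0 * norm w"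
        by (intro tendsto_intros \<sigma>_tendsto_0)
      ultimately have "norm (T w) \<le> 0 * norm w"
        by (intro LIMSEQ_le_const) auto
      then have "sqrt_op w = 0"
        using sqrt_eigen(2)[OF nonneg_sqrt_op sqrt_op_sqrt_op, of w] by simp
      then have "w = 0" using Qw \<open>0 < c\<close> by simp
      then have "x = oproj e J x" by (simp add: w_def)
      also have "\<dots> \<in> complex_vector.span (e ` J)"
        unfolding oproj_def
        by (intro complex_vector.span_sum complex_vector.span_scale complex_vector.span_base) auto
      finally show "x \<in> complex_vector.span (e ` J)" .
    qed
  qed
  then show "card {n. \<sigma> n = c} = complex_vector.dim (eigenspace sqrt_op (complex_of_real c))"
    using card_image[OF orthonormal_inj[OF on]] by (simp add: J_def)
qed (simp_all add: decseq_\<sigma> \<sigma>_nonneg)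

end

text \<open>If s n < t n at the first disagreement, every index where s takes the value t n lies
  below n, where s and t agree. The level set of t at this value contains n in addition, so the
  cardinalities differ.\<close>

lemma decseq_level_sets_le:
  fixes s t :: "nat \<Rightarrow> real"
  assumes s: "decseq s" "\<And>n. 0 \<le> s n" and t: "decseq t"
    and card: "\<And>c. 0 < c \<Longrightarrow> finite {n. t n = c} \<and> card {n. s n = c} = card {n. t n = c}"
    and IH: "\<And>m. m < n \<Longrightarrow> s m = t m"
  shows "t n \<le> s n"
proof (rule ccontr)
  assume "\<not> t n \<le> s n"
  then have lt: "s n < t n" by simp
  have "m < n" if "s m = t n" for m
    by (rule ccontr) (use lt that decseqD[OF s(1), of n m] in simp)
  then have "{m. s m = t n} \<subset> {m. t m = t n}"
    using IH lt by fastforce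
  then have "card {m. s m = t n} < card {m. t m = t n}"
    using card[of "t n"] lt s(2)[of n] by (intro psubset_card_mono) auto
  then show False
    using card[of "t n"] lt s(2)[of n] by simp
qed

lemma s_number_sequence_unique:
  assumes "s_number_sequence T s" "s_number_sequence T t"
  shows "s = t"
proof
  fix n
  show "s n = t n"
  proof (induction n rule: less_induct)
    case (less n)
    have st: "decseq s" "\<And>n. 0 \<le> s n" "decseq t" "\<And>n. 0 \<le> t n"
      "\<And>c. 0 < c \<Longrightarrow> finite {n. t n = c} \<and> card {n. s n = c} = card {n. t n = c}"
      "\<And>c. 0 < c \<Longrightarrow> finite {n. s n = c} \<and> card {n. t n = c} = card {n. s n = c}"
      using assms unfolding s_number_sequence_def by auto
    show ?case
      using decseq_level_sets_le[OF st(1,2,3,5) less] decseq_level_sets_le[OF st(3,4,1,6)] less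
      by (metis order_antisym)
  qed
qed

lemma (in compact_adjoint) s_number_eq: "s_number T n = \<sigma> (n - 1)"
proof -
  have "(THE s. s_number_sequence T s) = \<sigma>"
    using s_number_sequence_\<sigma> s_number_sequence_unique by (intro the_equality) auto
  then show ?thesis by (simp add: s_number_def)
qed

section \<open>Finite orthonormal systems\<close>

lemma oproj_span:
  assumes "orthonormal e I" "finite I" "x \<in> complex_vector.span (e ` I)"
  shows "oproj e I x = x"
proof -
  have sub: "complex_vector.subspace {x. oproj e I x = x}"
    by (rule complex_vector.subspaceI)
      (simp_all add: clinear_0 clinear_add clinear_scaleC clinear_oproj)
  have "oproj e I (e k) = e k" if "k \<in> I" for k
  proof -
    have "oproj e I (e k) = (\<Sum>i\<in>I. if i = k then e k else 0)"
      unfolding oproj_def using assms(1) that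
      by (intro sum.cong) (auto simp: orthonormal_def scaleC_one)
    then show ?thesis using assms(2) that by simp
  qed
  then have "e ` I \<subseteq> {x. oproj e I x = x}" by auto
  then show ?thesis
    using complex_vector.span_minimal[OF _ sub] assms(3) by blast
qed

lemma oproj_in_span: "oproj e I x \<in> complex_vector.span (e ` I)"
  unfolding oproj_def
  by (intro complex_vector.span_sum complex_vector.span_scale complex_vector.span_base) auto

lemma parseval:
  assumes "orthonormal e I" "finite I" "x \<in> complex_vector.span (e ` I)"
  shows "(norm x)\<^sup>2 = (\<Sum>i\<in>I. (cmod (cinner x (e i)))\<^sup>2)"
proof -
  have "(norm (oproj e I x))\<^sup>2 = (\<Sum>i\<in>I. (cmod (cinner x (e i)))\<^sup>2)"
    unfolding oproj_def norm_sum_orthonormal0[OF orthonormal_imp_0[OF assms(1)] assms(2)]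
    by (intro sum.cong) (simp_all add: orthonormal_norm[OF assms(1)])
  then show ?thesis by (simp add: oproj_span[OF assms])
qed

text \<open>Otherwise \<open>x \<mapsto> \<Sum>\<^sub>i \<langle>x, s\<^sub>i\<rangle> e\<^sub>i\<close> would map a space of dimension \<open>n\<close> injectively into the
  span of fewer than \<open>n\<close> vectors.\<close>

lemma orthogonal_unit_vector:
  fixes e :: "nat \<Rightarrow> 'a::complex_hilbert_space"
  assumes e: "orthonormal e {..<n}" and F: "finite F" "card F < n"
  shows "\<exists>u\<in>complex_vector.span (e ` {..<n}). norm u = 1 \<and> (\<forall>s\<in>F. cinner u s = 0)"
proof (rule ccontr)
  assume no: "\<not> ?thesis"
  let ?V = "complex_vector.span (e ` {..<n})"
  obtain s where s: "bij_betw s {..<card F} F"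
    using ex_bij_betw_nat_finite[OF F(1)] by (auto simp: atLeast0LessThan)
  define L where "L x = (\<Sum>i<card F. cinner x (s i) *\<^sub>C e i)" for x
  have L: "clinear L"
    by (rule clinearI) (simp_all add: L_def cinner_simps scaleC_add_left sum.distrib
        complex_vector.scale_sum_right scaleC_scaleC)
  have ker: "x = 0" if "x \<in> ?V" "L x = 0" for x
  proof (rule ccontr)
    assume "x \<noteq> 0"
    have "orthonormal e {..<card F}"
      using e F(2) by (auto intro: orthonormal_subset)
    then have "cinner x (s i) = 0" if "i < card F" for i
      using cinner_sum_orthonormal0[OF orthonormal_imp_0, of e "{..<card F}" i "\<lambda>i. cinner x (s i)"]
        orthonormal_norm[of e "{..<card F}" i] that \<open>L x = 0\<close> by (force simp: L_def)
    then have "\<forall>t\<in>F. cinner x t = 0"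
      using s unfolding bij_betw_def by (metis imageE lessThan_iff)
    then have "\<forall>t\<in>F. cinner (complex_of_real (inverse (norm x)) *\<^sub>C x) t = 0"
      by (simp add: cinner_scaleC_left)
    moreover have "norm (complex_of_real (inverse (norm x)) *\<^sub>C x) = 1"
      using \<open>x \<noteq> 0\<close> by (simp add: norm_inverse)
    ultimately show False
      using no complex_vector.span_scale[OF that(1)] by blast
  qed
  have inj: "inj_on L ?V"
  proof (rule inj_onI)
    fix x y assume "x \<in> ?V" "y \<in> ?V" "L x = L y"
    then show "x = y"
      using ker[of "x - y"] by (simp add: complex_vector.span_diff clinear_diff[OF L])
  qed
  have pair: "vector_space_pair (scaleC :: complex \<Rightarrow> 'a \<Rightarrow> 'a) (scaleC :: complex \<Rightarrow> 'a \<Rightarrow> 'a)"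
    by unfold_locales
  have "complex_vector.independent (L ` e ` {..<n})"
    by (rule vector_space_pair.linear_independent_injective_image[OF pair clinear_imp_linear[OF L]
          orthonormal_independent[OF e] inj])
  moreover have "L ` e ` {..<n} \<subseteq> complex_vector.span (e ` {..<card F})"
    unfolding L_def
    by (auto intro!: complex_vector.span_sum complex_vector.span_scale
        intro: complex_vector.span_base)
  ultimately have "card (L ` e ` {..<n}) \<le> card (e ` {..<card F})"
    using complex_vector.independent_span_bound by blast
  also have "\<dots> \<le> card F"
    by (metis card_image_le card_lessThan finite_lessThan)
  finally have "card (e ` {..<n}) \<le> card F"
    using inj_on_subset[OF inj complex_vector.span_superset] by (simp add: card_image)
  then show False
    using card_image[OF orthonormal_inj[OF e]] F(2) by simp
qed

lemma orthonormal_extend: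
  assumes e: "orthonormal e {..<n}" and "k \<le> n"
    and "orthonormal f {..<k}" "f ` {..<k} \<subseteq> complex_vector.span (e ` {..<n})"
  shows "\<exists>g. orthonormal g {..<n} \<and> (\<forall>i<k. g i = f i) \<and>
    g ` {..<n} \<subseteq> complex_vector.span (e ` {..<n})"
  using assms(2-)
proof (induction "n - k" arbitrary: k f)
  case 0
  then show ?case by (intro exI[of _ f]) auto
next
  case (Suc d)
  then have "k < n" by simp
  have "card (f ` {..<k}) < n"
    using card_image_le[of "{..<k}" f] \<open>k < n\<close> by simp
  then obtain u where u: "u \<in> complex_vector.span (e ` {..<n})" "norm u = 1"
      "\<forall>s\<in>f ` {..<k}. cinner u s = 0"
    using orthogonal_unit_vector[OF e, of "f ` {..<k}"] by auto
  have "orthonormal (f(k := u)) {..<Suc k}"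
    using Suc.prems(2) u orthonormal_norm[OF Suc.prems(2)]
    by (intro orthonormalI) (auto simp: orthonormal_def less_Suc_eq)
  moreover have "(f(k := u)) ` {..<Suc k} \<subseteq> complex_vector.span (e ` {..<n})"
    using Suc.prems(3) u(1) by (auto simp: less_Suc_eq)
  moreover have "d = n - Suc k" using Suc.hyps(2) by simp
  ultimately obtain g where "orthonormal g {..<n}" "\<forall>i<Suc k. g i = (f(k := u)) i"
      "g ` {..<n} \<subseteq> complex_vector.span (e ` {..<n})"
    using Suc.hyps(1)[of "Suc k" "f(k := u)"] \<open>k < n\<close> by (meson Suc_leI)
  then show ?case by (intro exI[of _ g]) auto
qed

lemma orthonormal_span_eq:
  assumes e: "orthonormal e {..<n}" and g: "orthonormal g {..<n}"
    and sub: "g ` {..<n} \<subseteq> complex_vector.span (e ` {..<n})"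
  shows "complex_vector.span (g ` {..<n}) = complex_vector.span (e ` {..<n})"
proof
  show "complex_vector.span (g ` {..<n}) \<subseteq> complex_vector.span (e ` {..<n})"
    by (rule complex_vector.span_minimal[OF sub complex_vector.subspace_span])
  show "complex_vector.span (e ` {..<n}) \<subseteq> complex_vector.span (g ` {..<n})"
  proof (rule ccontr)
    assume "\<not> ?thesis"
    then obtain x where x: "x \<in> complex_vector.span (e ` {..<n})"
        "x \<notin> complex_vector.span (g ` {..<n})" by blast
    have "complex_vector.independent (insert x (g ` {..<n}))"
      by (rule complex_vector.independent_insertI[OF x(2) orthonormal_independent[OF g]])
    then have "card (insert x (g ` {..<n})) \<le> card (e ` {..<n})"
      using complex_vector.independent_span_bound[of "e ` {..<n}"] sub x(1) by auto
    moreover have "x \<notin> g ` {..<n}"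
      using x(2) complex_vector.span_base[of x "g ` {..<n}"] by blast
    ultimately show False
      using card_image[OF orthonormal_inj[OF g]] card_image_le[of "{..<n}" e] by simp
  qed
qed

text \<open>Extend u to an orthonormal basis of the span and drop it again. This is the dimension
  reduction behind the later inductions on n.\<close>

lemma orthonormal_complement:
  assumes e: "orthonormal e {..<Suc n}" and u: "u \<in> complex_vector.span (e ` {..<Suc n})" "norm u = 1"
  shows "\<exists>f. orthonormal f {..<n} \<and>
    complex_vector.span (f ` {..<n}) = {x \<in> complex_vector.span (e ` {..<Suc n}). cinner x u = 0}"
proof -
  have "orthonormal (\<lambda>i. u) {..<1}"
    using u(2) by (simp add: orthonormal_def cinner_self)
  then obtain g where g: "orthonormal g {..<Suc n}" "\<forall>i<1. g i = u"
      "g ` {..<Suc n} \<subseteq> complex_vector.span (e ` {..<Suc n})"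
    using orthonormal_extend[OF e, of 1 "\<lambda>i. u"] u(1) by auto
  define f where "f i = g (Suc i)" for i
  have f: "orthonormal f {..<n}"
    using g(1) by (auto simp: orthonormal_def f_def)
  have perp: "cinner (f i) u = 0" if "i < n" for i
    using g(1,2) that unfolding orthonormal_def f_def
    by (metis lessThan_iff less_one nat.distinct(1) not_less_eq zero_less_Suc)
  show ?thesis
  proof (intro exI[of _ f] conjI f equalityI)
    have "complex_vector.subspace {x \<in> complex_vector.span (e ` {..<Suc n}). cinner x u = 0}"
      by (rule complex_vector.subspaceI)
        (auto simp: cinner_simps complex_vector.span_add complex_vector.span_scale
          complex_vector.span_zero)
    moreover have "f ` {..<n} \<subseteq> {x \<in> complex_vector.span (e ` {..<Suc n}). cinner x u = 0}"
      using perp g(3) by (auto simp: f_def)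
    ultimately show "complex_vector.span (f ` {..<n}) \<subseteq>
        {x \<in> complex_vector.span (e ` {..<Suc n}). cinner x u = 0}"
      by (intro complex_vector.span_minimal)
    show "{x \<in> complex_vector.span (e ` {..<Suc n}). cinner x u = 0} \<subseteq>
        complex_vector.span (f ` {..<n})"
    proof
      fix x assume x: "x \<in> {x \<in> complex_vector.span (e ` {..<Suc n}). cinner x u = 0}"
      then have "x = oproj g {..<Suc n} x"
        using oproj_span[OF g(1)] orthonormal_span_eq[OF e g(1,3)] by simp
      also have "\<dots> = oproj f {..<n} x"
        using x g(2) by (simp add: oproj_def sum.lessThan_Suc_shift f_def del: sum.lessThan_Suc)
      also have "\<dots> \<in> complex_vector.span (f ` {..<n})"
        by (rule oproj_in_span)
      finally show "x \<in> complex_vector.span (f ` {..<n})" .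
    qed
  qed
qed

lemma orthonormal_append:
  assumes "orthonormal f {..<n}" "norm u = 1"
    and "\<And>x. x \<in> complex_vector.span (f ` {..<n}) \<Longrightarrow> cinner x u = 0"
  shows "orthonormal (f(n := u)) {..<Suc n}"
proof (rule orthonormalI)
  fix i j assume ij: "i \<in> {..<Suc n}" "j \<in> {..<Suc n}" "i < j"
  show "cinner ((f(n := u)) j) ((f(n := u)) i) = 0"
  proof (cases "j = n")
    case True
    then show ?thesis
      using assms(3)[OF complex_vector.span_base, of "f i"] ij cinner_sym_0 by auto
  next
    case False
    then show ?thesis using ij assms(1) by (auto simp: orthonormal_def)
  qed
qed (use assms(2) orthonormal_norm[OF assms(1)] in \<open>auto simp: less_Suc_eq\<close>)

subsection \<open>Eigenvectors and triangular form\<close>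

text \<open>The vector p(M) v in Horner form, which makes the equation for \<open>pCons\<close>
  immediate.\<close>

definition poly_apply ::
  "('a::complex_hilbert_space \<Rightarrow> 'a) \<Rightarrow> complex poly \<Rightarrow> 'a \<Rightarrow> 'a" where
  "poly_apply M p v = fold_coeffs (\<lambda>a w. a *\<^sub>C v + M w) p 0"

context
  fixes M :: "'a::complex_hilbert_space \<Rightarrow> 'a"
  assumes M: "clinear M"
begin

lemma poly_apply_pCons [simp]: "poly_apply M (pCons a p) v = a *\<^sub>C v + M (poly_apply M p v)"
  by (cases "p = 0 \<and> a = 0") (auto simp: poly_apply_def clinear_0[OF M])

lemma poly_apply_0 [simp]: "poly_apply M 0 v = 0"
  by (simp add: poly_apply_def)

lemma poly_apply_add: "poly_apply M (p + q) v = poly_apply M p v + poly_apply M q v"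
  by (induction p q rule: poly_induct2) (simp_all add: clinear_add[OF M] scaleC_add_left)

lemma poly_apply_smult: "poly_apply M (smult c p) v = c *\<^sub>C poly_apply M p v"
  by (induction p) (simp_all add: clinear_scaleC[OF M] scaleC_add_right scaleC_scaleC)

lemma poly_apply_sum: "poly_apply M (\<Sum>i\<in>I. p i) v = (\<Sum>i\<in>I. poly_apply M (p i) v)"
  by (induction I rule: infinite_finite_induct) (simp_all add: poly_apply_add)

lemma poly_apply_monom: "poly_apply M (monom c n) v = c *\<^sub>C (M ^^ n) v"
  by (induction n) (simp_all add: monom_0 monom_Suc clinear_scaleC[OF M] clinear_0[OF M])

lemma poly_apply_diff: "poly_apply M (p - q) v = poly_apply M p v - poly_apply M q v"
  using poly_apply_add[of p "smult (-1) q" v] poly_apply_smult[of "-1" q v]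
  by (simp add: complex_vector.scale_minus_left scaleC_one)

lemma poly_apply_linear_factor:
  "poly_apply M ([:- z, 1:] * q) v = M (poly_apply M q v) - z *\<^sub>C poly_apply M q v"
  by (simp add: poly_apply_diff poly_apply_smult)

context
  fixes e :: "nat \<Rightarrow> 'a" and n :: nat
  assumes inv: "\<And>x. x \<in> complex_vector.span (e ` {..<n}) \<Longrightarrow> M x \<in> complex_vector.span (e ` {..<n})"
begin

lemma poly_apply_in_span:
  "v \<in> complex_vector.span (e ` {..<n}) \<Longrightarrow> poly_apply M p v \<in> complex_vector.span (e ` {..<n})"
  by (induction p) (auto intro!: complex_vector.span_add complex_vector.span_scale inv
      complex_vector.span_zero)

text \<open>The n + 1 vectors v, M v, ..., M^n v lie in a space spanned by n vectors, and a linear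
  relation between them is a polynomial.\<close>

lemma annihilating_poly:
  assumes v: "v \<in> complex_vector.span (e ` {..<n})"
  shows "\<exists>p. p \<noteq> 0 \<and> poly_apply M p v = 0"
proof -
  define f where "f i = (M ^^ i) v" for i
  have f: "f i \<in> complex_vector.span (e ` {..<n})" for i
    by (induction i) (auto simp: f_def v inv)
  have card_e: "card (e ` {..<n}) \<le> n"
    using card_image_le[of "{..<n}" e] by simp
  show ?thesis
  proof (cases "inj_on f {..n}")
    \<comment> \<open>Coinciding iterates would be merged in the image set, where dependence is
      stated; they give a difference of two monomials instead.\<close>
    case False
    then obtain i j where "i \<noteq> j" "f i = f j" by (auto simp: inj_on_def)
    then show ?thesis
      by (intro exI[of _ "monom 1 i - monom 1 j"])
        (auto simp: poly_apply_diff poly_apply_monom f_def poly_eq_iff split: if_splits dest!: spec[of _ i])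
  next
    case True
    have "\<not> complex_vector.independent (f ` {..n})"
      using complex_vector.independent_span_bound[of "e ` {..<n}" "f ` {..n}"] f card_e
        card_image[OF True] by auto
    then obtain u w where u: "w \<in> f ` {..n}" "u w \<noteq> 0" "(\<Sum>w\<in>f ` {..n}. u w *\<^sub>C w) = 0"
      by (auto simp: complex_vector.dependent_finite)
    define p where "p = (\<Sum>i\<le>n. monom (u (f i)) i)"
    have "poly_apply M p v = 0"
      using u(3) by (simp add: p_def poly_apply_sum poly_apply_monom sum.reindex[OF True] flip: f_def)
    moreover obtain i where i: "i \<le> n" "w = f i" using u(1) by auto
    have "coeff p i = u w"
      using i by (simp add: p_def coeff_sum)
    then have "p \<noteq> 0" using u(2) by auto
    ultimately show ?thesis by blast
  qed
qed

text \<open>Split a root z off an annihilating polynomial of least degree, p = (X - z) q. By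
  minimality q(M) v \<noteq> 0, and M - z kills it.\<close>

lemma eigenvector_exists:
  assumes v: "v \<in> complex_vector.span (e ` {..<n})" "v \<noteq> 0"
  shows "\<exists>z. \<exists>w\<in>complex_vector.span (e ` {..<n}). w \<noteq> 0 \<and> M w = z *\<^sub>C w"
proof -
  obtain p where p: "p \<noteq> 0" "poly_apply M p v = 0"
    and min: "\<And>q. q \<noteq> 0 \<Longrightarrow> poly_apply M q v = 0 \<Longrightarrow> degree p \<le> degree q"
    using annihilating_poly[OF v(1)]
      ex_has_least_nat[of "\<lambda>p. p \<noteq> 0 \<and> poly_apply M p v = 0" _ degree] by blast
  have "degree p \<noteq> 0"
  proof
    assume "degree p = 0"
    then obtain c where "p = [:c:]" by (rule degree_eq_zeroE)
    then show False using p v(2) by (simp add: clinear_0[OF M])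
  qed
  then obtain z where "poly p z = 0"
    using fundamental_theorem_of_algebra[of p] by (auto simp: constant_degree)
  then obtain q where q: "p = [:- z, 1:] * q"
    by (auto simp: poly_eq_0_iff_dvd elim: dvdE)
  then have "q \<noteq> 0" using p by auto
  then have "degree q < degree p"
    unfolding q by (subst degree_mult_eq) auto
  then have "poly_apply M q v \<noteq> 0"
    using min[OF \<open>q \<noteq> 0\<close>] by auto
  then show ?thesis
    using p(2) poly_apply_in_span[OF v(1)] unfolding q poly_apply_linear_factor
    by (intro exI[of _ z] bexI[of _ "poly_apply M q v"]) auto
qed

end

text \<open>The last basis vector is taken orthogonal to the range of \<open>M - z\<close> for an eigenvalue \<open>z\<close>; then
  its orthogonal complement is invariant, so that the remaining diagonal entries are eigenvalues of
  \<open>M\<close> itself.\<close>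

lemma schur_triangular:
  assumes "orthonormal e {..<n}"
    and "\<And>x. x \<in> complex_vector.span (e ` {..<n}) \<Longrightarrow> M x \<in> complex_vector.span (e ` {..<n})"
  shows "\<exists>f d. orthonormal f {..<n} \<and>
    complex_vector.span (f ` {..<n}) = complex_vector.span (e ` {..<n}) \<and>
    (\<forall>j<n. M (f j) - d j *\<^sub>C f j \<in> complex_vector.span (f ` {..<j})) \<and>
    (\<forall>j<n. \<exists>w\<in>complex_vector.span (e ` {..<n}). w \<noteq> 0 \<and> M w = d j *\<^sub>C w)"
  using assms
proof (induction n arbitrary: e)
  case 0
  then show ?case by (intro exI[of _ e]) auto
next
  case (Suc n)
  let ?V = "complex_vector.span (e ` {..<Suc n})"
  have "e 0 \<in> ?V" by (intro complex_vector.span_base) auto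
  moreover have "e 0 \<noteq> 0" using orthonormal_norm[OF Suc.prems(1), of 0] by auto
  ultimately obtain z w where w: "w \<in> ?V" "w \<noteq> 0" "M w = z *\<^sub>C w"
    using eigenvector_exists[OF Suc.prems(2)] by blast
  define w1 where "w1 = complex_of_real (inverse (norm w)) *\<^sub>C w"
  have w1: "w1 \<in> ?V" "norm w1 = 1" "M w1 = z *\<^sub>C w1"
    using w by (auto simp: w1_def complex_vector.span_scale norm_inverse clinear_scaleC[OF M]
        scaleC_scaleC mult.commute)
  have "orthonormal (\<lambda>i. w1) {..<1}"
    using w1(2) by (simp add: orthonormal_def cinner_self)
  then obtain g where g: "orthonormal g {..<Suc n}" "\<forall>i<1. g i = w1" "g ` {..<Suc n} \<subseteq> ?V"
    using orthonormal_extend[OF Suc.prems(1), of 1 "\<lambda>i. w1"] w1(1) by auto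
  \<comment> \<open>The first basis vector of \<open>g\<close> is an eigenvector, so M - z kills it
    and its range is spanned by the n images collected in \<open>F\<close>. One less than the
    dimension leaves room for a unit vector orthogonal to the range.\<close>
  define F where "F = (\<lambda>j. M (g (Suc j)) - z *\<^sub>C g (Suc j)) ` {..<n}"
  have "card F < Suc n"
    unfolding F_def using card_image_le[of "{..<n}"] by (metis card_lessThan finite_lessThan less_Suc_eq_le)
  then obtain u where u: "u \<in> ?V" "norm u = 1" "\<forall>s\<in>F. cinner u s = 0"
    using orthogonal_unit_vector[OF Suc.prems(1), of F] by (auto simp: F_def)
  have range: "cinner (M x - z *\<^sub>C x) u = 0" if "x \<in> ?V" for x
  proof -
    have "x = oproj g {..<Suc n} x"
      using oproj_span[OF g(1)] orthonormal_span_eq[OF Suc.prems(1) g(1,3)] that by simp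
    also have "\<dots> = cinner x w1 *\<^sub>C w1 + (\<Sum>j<n. cinner x (g (Suc j)) *\<^sub>C g (Suc j))"
      using g(2) by (simp add: oproj_def sum.lessThan_Suc_shift del: sum.lessThan_Suc)
    finally have x: "x = \<dots>" .
    have "M x - z *\<^sub>C x = (\<Sum>j<n. cinner x (g (Suc j)) *\<^sub>C (M (g (Suc j)) - z *\<^sub>C g (Suc j)))"
      by (subst (1 2) x) (simp add: clinear_add[OF M] clinear_sum[OF M] clinear_scaleC[OF M] w1(3)
          scaleC_add_right complex_vector.scale_sum_right complex_vector.scale_right_diff_distrib
          scaleC_scaleC mult.commute sum_subtractf)
    moreover have "cinner s u = 0" if "s \<in> F" for s
      using u(3) that cinner_sym_0 by blast
    ultimately show ?thesis
      by (simp add: cinner.sum_left cinner_scaleC_left F_def)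
  qed
  obtain e' where e': "orthonormal e' {..<n}"
      "complex_vector.span (e' ` {..<n}) = {x \<in> ?V. cinner x u = 0}"
    using orthonormal_complement[OF Suc.prems(1) u(1,2)] by blast
  have "M x \<in> complex_vector.span (e' ` {..<n})" if "x \<in> complex_vector.span (e' ` {..<n})" for x
    using that range[of x] Suc.prems(2)[of x] unfolding e'(2) by (auto simp: cinner_simps)
  from Suc.IH[OF e'(1) this] obtain f d where f: "orthonormal f {..<n}"
      "complex_vector.span (f ` {..<n}) = complex_vector.span (e' ` {..<n})"
      "\<forall>j<n. M (f j) - d j *\<^sub>C f j \<in> complex_vector.span (f ` {..<j})"
      "\<forall>j<n. \<exists>w\<in>complex_vector.span (e' ` {..<n}). w \<noteq> 0 \<and> M w = d j *\<^sub>C w"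
    by blast
  have on: "orthonormal (f(n := u)) {..<Suc n}"
    using f(1) u(2) by (rule orthonormal_append) (simp add: f(2) e'(2))
  have img: "(f(n := u)) ` {..<j} = f ` {..<j}" if "j \<le> n" for j
    using that by auto
  have fV: "f j \<in> ?V" if "j < n" for j
    using complex_vector.span_base[of "f j" "f ` {..<n}"] that unfolding f(2) e'(2) by auto
  have "complex_vector.span ((f(n := u)) ` {..<Suc n}) = ?V"
    using fV u(1) by (intro orthonormal_span_eq[OF Suc.prems(1) on]) (auto simp: less_Suc_eq)
  \<comment> \<open>The range of M - z is orthogonal to u, so the column of u has no component along
    u after subtracting z: its diagonal entry is exactly z.\<close>
  moreover have "M u - z *\<^sub>C u \<in> complex_vector.span (f ` {..<n})"
    unfolding f(2) e'(2) using range[OF u(1)] u(1) Suc.prems(2)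
    by (auto intro!: complex_vector.span_diff complex_vector.span_scale)
  moreover have "M ((f(n := u)) j) - (d(n := z)) j *\<^sub>C (f(n := u)) j
      \<in> complex_vector.span ((f(n := u)) ` {..<j})" if "j < Suc n" for j
  proof (cases "j = n")
    case True
    then show ?thesis using calculation(2) by (simp only: img[OF order_refl] fun_upd_same)
  next
    case False
    then have "j < n" using that by simp
    then show ?thesis using f(3) img[of j] by (simp only: less_imp_le fun_upd_other)
  qed
  moreover have "\<exists>w\<in>?V. w \<noteq> 0 \<and> M w = (d(n := z)) j *\<^sub>C w" if "j < Suc n" for j
    using that f(4) w e'(2) by (cases "j = n") (auto simp: less_Suc_eq)
  ultimately show ?case
    using on by (intro exI[of _ "f(n := u)"] exI[of _ "d(n := z)"]) blast
qed

end

section \<open>Gelfand numbers\<close>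

text \<open>\<open>gelfand_le X m t\<close> says that the Gelfand number \<open>c\<^sub>m\<^sub>+\<^sub>1(X)\<close>, which for compact \<open>X\<close> is the
  \<open>(m+1)\<close>-st \<open>s\<close>-number, is at most \<open>t\<close>.\<close>

definition gelfand_le :: "('a::complex_hilbert_space \<Rightarrow> 'a) \<Rightarrow> nat \<Rightarrow> real \<Rightarrow> bool" where
  "gelfand_le X m t \<longleftrightarrow> (\<exists>F. finite F \<and> card F \<le> m \<and>
     (\<forall>x. (\<forall>s\<in>F. cinner x s = 0) \<longrightarrow> norm (X x) \<le> t * norm x))"

lemma gelfand_leI:
  "finite F \<Longrightarrow> card F \<le> m \<Longrightarrow> (\<And>x. (\<And>s. s \<in> F \<Longrightarrow> cinner x s = 0) \<Longrightarrow> norm (X x) \<le> t * norm x) \<Longrightarrow>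
    gelfand_le X m t"
  unfolding gelfand_le_def by blast

lemma gelfand_leE:
  assumes "gelfand_le X m t"
  obtains F where "finite F" "card F \<le> m"
    "\<And>x. (\<And>s. s \<in> F \<Longrightarrow> cinner x s = 0) \<Longrightarrow> norm (X x) \<le> t * norm x"
  using assms unfolding gelfand_le_def by blast

lemma gelfand_le_norm: "(\<And>x. norm (X x) \<le> t * norm x) \<Longrightarrow> gelfand_le X m t"
  by (rule gelfand_leI[of "{}"]) auto

lemma gelfand_le_mono:
  assumes "gelfand_le X m t" "m \<le> m'" "t \<le> t'"
  shows "gelfand_le X m' t'"
proof -
  obtain F where F: "finite F" "card F \<le> m"
    "\<And>x. (\<And>s. s \<in> F \<Longrightarrow> cinner x s = 0) \<Longrightarrow> norm (X x) \<le> t * norm x"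
    using gelfand_leE[OF assms(1)] by blast
  show ?thesis
  proof (rule gelfand_leI[OF F(1)])
    fix x assume "\<And>s. s \<in> F \<Longrightarrow> cinner x s = 0"
    then have "norm (X x) \<le> t * norm x" by (rule F(3))
    also have "\<dots> \<le> t' * norm x" using assms(3) by (intro mult_right_mono) auto
    finally show "norm (X x) \<le> t' * norm x" .
  qed (use F(2) assms(2) in simp)
qed

text \<open>Vectors orthogonal to both constraint sets satisfy both bounds at once. Any pointwise
  consequence is allowed, so that the quadratic estimate \<open>norm_X_le\<close> can be used as
  well as the triangle inequality.\<close>

lemma gelfand_le_combine:
  assumes "gelfand_le X m s" "gelfand_le Y n t"
    and "\<And>x. norm (X x) \<le> s * norm x \<Longrightarrow> norm (Y x) \<le> t * norm x \<Longrightarrow> norm (Z x) \<le> u * norm x"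
  shows "gelfand_le Z (m + n) u"
proof -
  obtain F where F: "finite F" "card F \<le> m"
    "\<And>x. (\<And>s. s \<in> F \<Longrightarrow> cinner x s = 0) \<Longrightarrow> norm (X x) \<le> s * norm x"
    using gelfand_leE[OF assms(1)] by blast
  obtain G where G: "finite G" "card G \<le> n"
    "\<And>x. (\<And>s. s \<in> G \<Longrightarrow> cinner x s = 0) \<Longrightarrow> norm (Y x) \<le> t * norm x"
    using gelfand_leE[OF assms(2)] by blast
  show ?thesis
  proof (rule gelfand_leI)
    show "finite (F \<union> G)" using F(1) G(1) by simp
    show "card (F \<union> G) \<le> m + n" using card_Un_le[of F G] F(2) G(2) by linarith
  qed (use F(3) G(3) assms(3) in simp)
qed

lemma gelfand_le_add:
  assumes "gelfand_le X m s" "gelfand_le Y n t"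
  shows "gelfand_le (\<lambda>x. X x + Y x) (m + n) (s + t)"
  using assms by (rule gelfand_le_combine)
    (metis add_mono_thms_linordered_semiring(1) distrib_right norm_triangle_le)

lemma gelfand_le_scaleC:
  assumes "gelfand_le X m s"
  shows "gelfand_le (\<lambda>x. c *\<^sub>C X x) m (cmod c * s)"
proof -
  obtain F where F: "finite F" "card F \<le> m"
    "\<And>x. (\<And>s. s \<in> F \<Longrightarrow> cinner x s = 0) \<Longrightarrow> norm (X x) \<le> s * norm x"
    using gelfand_leE[OF assms(1)] by blast
  show ?thesis
    by (rule gelfand_leI[OF F(1,2)]) (use F(3) in \<open>simp add: mult.assoc mult_left_mono\<close>)
qed

text \<open>A constraint on Y x is a constraint on x once it is moved through the adjoint of
  \<open>Y\<close>.\<close>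

lemma gelfand_le_comp:
  assumes "gelfand_le X m s" "gelfand_le Y n t" and adj: "adjoint_pair Y Y'" and "0 \<le> s"
  shows "gelfand_le (\<lambda>x. X (Y x)) (m + n) (s * t)"
proof -
  obtain F where F: "finite F" "card F \<le> m"
    "\<And>x. (\<And>s. s \<in> F \<Longrightarrow> cinner x s = 0) \<Longrightarrow> norm (X x) \<le> s * norm x"
    using gelfand_leE[OF assms(1)] by blast
  obtain G where G: "finite G" "card G \<le> n"
    "\<And>x. (\<And>s. s \<in> G \<Longrightarrow> cinner x s = 0) \<Longrightarrow> norm (Y x) \<le> t * norm x"
    using gelfand_leE[OF assms(2)] by blast
  show ?thesis
  proof (rule gelfand_leI)
    show "finite (Y' ` F \<union> G)" using F(1) G(1) by simp
    show "card (Y' ` F \<union> G) \<le> m + n"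
      using card_Un_le[of "Y' ` F" G] card_image_le[OF F(1), of Y'] F(2) G(2) by linarith
    fix x assume x: "\<And>s. s \<in> Y' ` F \<union> G \<Longrightarrow> cinner x s = 0"
    have "norm (X (Y x)) \<le> s * norm (Y x)"
      by (rule F(3)) (simp add: adjoint_pairD[OF adj] x)
    also have "\<dots> \<le> s * (t * norm x)"
      using G(3)[of x] x \<open>0 \<le> s\<close> by (intro mult_left_mono) auto
    finally show "norm (X (Y x)) \<le> s * t * norm x" by (simp add: mult.assoc)
  qed
qed

text \<open>If x is orthogonal to X F, then X' x is orthogonal to F, so \<open>X\<close> is small at
  X' x; and the square of the norm of X' x is the inner product of X X' x with x.\<close>

lemma gelfand_le_adjoint:
  assumes "gelfand_le X m t" and adj: "adjoint_pair X X'" and "0 \<le> t"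
  shows "gelfand_le X' m t"
proof -
  obtain F where F: "finite F" "card F \<le> m"
    "\<And>x. (\<And>s. s \<in> F \<Longrightarrow> cinner x s = 0) \<Longrightarrow> norm (X x) \<le> t * norm x"
    using gelfand_leE[OF assms(1)] by blast
  show ?thesis
  proof (rule gelfand_leI)
    show "finite (X ` F)" using F(1) by simp
    show "card (X ` F) \<le> m" using card_image_le[OF F(1), of X] F(2) by simp
    fix x assume x: "\<And>s. s \<in> X ` F \<Longrightarrow> cinner x s = 0"
    have le: "norm (X (X' x)) \<le> t * norm (X' x)"
      by (rule F(3)) (simp add: adjoint_pairD[OF adjoint_pair_sym[OF adj]] x)
    have "(norm (X' x))\<^sup>2 = cmod (cinner (X (X' x)) x)"
      by (simp add: adjoint_pairD[OF adj] cinner_self norm_power)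
    also have "\<dots> \<le> norm (X (X' x)) * norm x" by (rule cinner_bound)
    also have "\<dots> \<le> t * norm (X' x) * norm x" using le by (rule mult_right_mono) simp
    finally have "norm (X' x) * norm (X' x) \<le> norm (X' x) * (t * norm x)"
      by (simp add: power2_eq_square mult_ac)
    then show "norm (X' x) \<le> t * norm x"
      using \<open>0 \<le> t\<close> by (cases "X' x = 0") (auto simp: mult_le_cancel_left)
  qed
qed

lemma gelfand_le_compress:
  assumes "gelfand_le Z m t" "0 \<le> t" and P: "adjoint_pair P P" "\<And>x. norm (P x) \<le> norm x"
  shows "gelfand_le (\<lambda>x. P (Z (P x))) m t"
proof -
  have "gelfand_le P 0 1"
    using P(2) by (intro gelfand_le_norm) simp
  from gelfand_le_comp[OF assms(1) this P(1) assms(2)]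
  have "gelfand_le (\<lambda>x. Z (P x)) m t" by simp
  then obtain F where F: "finite F" "card F \<le> m"
    "\<And>x. (\<And>s. s \<in> F \<Longrightarrow> cinner x s = 0) \<Longrightarrow> norm (Z (P x)) \<le> t * norm x"
    using gelfand_leE by blast
  show ?thesis
    by (rule gelfand_leI[OF F(1,2)]) (use F(3) P(2) order_trans in blast)
qed

lemma (in compact_adjoint) gelfand_le_\<sigma>: "gelfand_le T m (\<sigma> m)"
  by (rule gelfand_leI[of "e ` {..<m}"])
    (use card_image_le[of "{..<m}" e] singular_vector(4) in auto)

subsection \<open>Power weights\<close>

text \<open>The index m counts orthogonality constraints from 0 and belongs to the (m+1)-st
  s-number, hence the shift.\<close>

definition weight :: "nat \<Rightarrow> real \<Rightarrow> real" where
  "weight m s = (real m + 1) powr (- s)"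

lemma weight_pos: "0 < weight m s"
  by (simp add: weight_def)

lemma weight_nonneg: "0 \<le> weight m s"
  by (simp add: weight_def)

lemma summable_weight: "1 < s \<Longrightarrow> summable (\<lambda>m. weight m s)"
  using summable_Suc_iff[of "\<lambda>m. real m powr (- s)"]
  by (simp add: weight_def summable_real_powr_iff add.commute)

lemma weight_add: "weight m (s + t) = weight m s * weight m t"
  by (simp add: weight_def powr_add flip: powr_add)

lemma weight_antimono: "s \<le> t \<Longrightarrow> weight m t \<le> weight m s"
  by (simp add: weight_def powr_mono)

lemma weight_div:
  assumes "0 < p" "0 \<le> s" "s \<le> 1"
  shows "weight (m div p) s \<le> real p * weight m s"
proof -
  define k where "k = m div p"
  have "m < p * (k + 1)"
    using \<open>0 < p\<close> unfolding k_def by (simp add: dividend_less_times_div)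
  then have "real m + 1 \<le> real p * (real k + 1)"
    by (metis Suc_leI of_nat_1 of_nat_Suc of_nat_add of_nat_le_iff of_nat_mult add.commute)
  then have "(real p * (real k + 1)) powr (- s) \<le> weight m s"
    unfolding weight_def using \<open>0 \<le> s\<close> by (intro powr_mono2') auto
  then have "real p powr s * (real p powr (- s) * weight k s) \<le> real p powr s * weight m s"
    by (intro mult_left_mono) (simp_all add: weight_def powr_mult)
  then have "weight k s \<le> real p powr s * weight m s"
    using \<open>0 < p\<close> by (simp add: powr_minus field_simps)
  also have "\<dots> \<le> real p * weight m s"
    using powr_mono[of s 1 "real p"] \<open>s \<le> 1\<close> \<open>0 < p\<close> weight_pos[of m s]
    by (intro mult_right_mono) auto
  finally show ?thesis by (simp add: k_def)
qed

text \<open>Sums and products of operators multiply the number of constraints by some p. Going back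
  to m via m div p costs a factor p^s, which is at most p because s \<le> 1.\<close>

lemma gelfand_le_rescale:
  assumes gel: "\<And>m. gelfand_le Z (p * m) (t * weight m s)"
    and "0 < p" "0 \<le> s" "s \<le> 1" "0 \<le> t"
  shows "gelfand_le Z m (real p * t * weight m s)"
proof (rule gelfand_le_mono[OF gel[of "m div p"]])
  show "t * weight (m div p) s \<le> real p * t * weight m s"
    using mult_left_mono[OF weight_div[OF assms(2-4), of m] \<open>0 \<le> t\<close>] by (simp add: mult_ac)
qed simp

subsection \<open>Hilbert--Schmidt estimates\<close>

text \<open>The basis is chosen from its last vector downwards: in dimension n + 1 some unit vector
  satisfies the n constraints belonging to t n, and the induction continues in its orthogonal
  complement.\<close>

lemma basis_from_gelfand:
  assumes "orthonormal e {..<n}" and "\<And>m. m < n \<Longrightarrow> gelfand_le Y m (t m)"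
  shows "\<exists>f. orthonormal f {..<n} \<and> f ` {..<n} \<subseteq> complex_vector.span (e ` {..<n}) \<and>
    (\<forall>j<n. norm (Y (f j)) \<le> t j)"
  using assms
proof (induction n arbitrary: e)
  case 0
  then show ?case by (intro exI[of _ e]) auto
next
  case (Suc n)
  let ?V = "complex_vector.span (e ` {..<Suc n})"
  obtain F where F: "finite F" "card F \<le> n"
    "\<And>x. (\<And>s. s \<in> F \<Longrightarrow> cinner x s = 0) \<Longrightarrow> norm (Y x) \<le> t n * norm x"
    using gelfand_leE[OF Suc.prems(2)[of n]] by blast
  obtain u where u: "u \<in> ?V" "norm u = 1" "\<forall>s\<in>F. cinner u s = 0"
    using orthogonal_unit_vector[OF Suc.prems(1) F(1)] F(2) by auto
  obtain e' where e': "orthonormal e' {..<n}"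
      "complex_vector.span (e' ` {..<n}) = {x \<in> ?V. cinner x u = 0}"
    using orthonormal_complement[OF Suc.prems(1) u(1,2)] by blast
  obtain f where f: "orthonormal f {..<n}" "f ` {..<n} \<subseteq> complex_vector.span (e' ` {..<n})"
      "\<forall>j<n. norm (Y (f j)) \<le> t j"
    using Suc.IH[OF e'(1)] Suc.prems(2) by (metis less_SucI)
  have sub: "complex_vector.span (f ` {..<n}) \<subseteq> {x \<in> ?V. cinner x u = 0}"
    using complex_vector.span_minimal[OF f(2) complex_vector.subspace_span] e'(2) by simp
  have "orthonormal (f(n := u)) {..<Suc n}"
    using f(1) u(2) by (rule orthonormal_append) (use sub in blast)
  moreover have "norm (Y u) \<le> t n" using F(3)[of u] u by simp
  moreover have "f j \<in> ?V" if "j < n" for j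
    using f(2) e'(2) that by auto
  then have "(f(n := u)) ` {..<Suc n} \<subseteq> ?V"
    using u(1) by (auto simp: less_Suc_eq)
  moreover have "\<forall>j<Suc n. norm (Y ((f(n := u)) j)) \<le> t j"
    using f(3) \<open>norm (Y u) \<le> t n\<close> by (auto simp: less_Suc_eq)
  ultimately show ?case by blast
qed

lemma cmod_cinner_adjoint: "adjoint_pair Y Y' \<Longrightarrow> cmod (cinner (Y x) y) = cmod (cinner (Y' y) x)"
  using adjoint_pairD[of Y Y' x y] cinner_commute[of x "Y' y"] by simp

text \<open>Both sides compare with the double sum of the squared entries of \<open>Y\<close>
  between the two bases. On the right Bessel's inequality replaces Parseval's identity, as the range
  of \<open>Y'\<close> is not restricted.\<close>

lemma hilbert_schmidt_basis_change:
  assumes e: "orthonormal e {..<n}" and f: "orthonormal f {..<n}"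
    and sub: "f ` {..<n} \<subseteq> complex_vector.span (e ` {..<n})"
    and adj: "adjoint_pair Y Y'" and range: "\<And>x. Y x \<in> complex_vector.span (e ` {..<n})"
  shows "(\<Sum>i<n. (norm (Y (e i)))\<^sup>2) \<le> (\<Sum>j<n. (norm (Y' (f j)))\<^sup>2)"
proof -
  have "(\<Sum>i<n. (norm (Y (e i)))\<^sup>2) = (\<Sum>i<n. \<Sum>j<n. (cmod (cinner (Y (e i)) (f j)))\<^sup>2)"
    using range orthonormal_span_eq[OF e f sub] by (intro sum.cong refl parseval[OF f]) auto
  also have "\<dots> = (\<Sum>j<n. \<Sum>i<n. (cmod (cinner (Y' (f j)) (e i)))\<^sup>2)"
    by (subst sum.swap) (simp add: cmod_cinner_adjoint[OF adj])
  also have "\<dots> \<le> (\<Sum>j<n. (norm (Y' (f j)))\<^sup>2)"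
    by (intro sum_mono bessel orthonormal_imp_0[OF e]) auto
  finally show ?thesis .
qed

text \<open>If the bound failed, one could choose greedily m + 1 orthonormal vectors at which
  \<open>X\<close> exceeds t = K (m+1)^(-1/2). Their squares would add up to more than (m+1) t^2 =
  K^2, against the Hilbert-Schmidt norm.\<close>

lemma gelfand_from_hilbert_schmidt:
  assumes e: "orthonormal e {..<n}"
    and adj: "adjoint_pair X X" and range: "\<And>x. X x \<in> complex_vector.span (e ` {..<n})"
    and K: "0 \<le> K" "(\<Sum>i<n. (norm (X (e i)))\<^sup>2) \<le> K\<^sup>2"
  shows "gelfand_le X m (K * weight m (1/2))"
proof (rule ccontr)
  assume not: "\<not> ?thesis"
  let ?t = "K * weight m (1/2)"
  have X: "clinear X" by (rule adjoint_pair_clinear[OF adj])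
  have "\<exists>f. orthonormal f {..<k} \<and> (\<forall>j<k. ?t < norm (X (f j)))" if "k \<le> Suc m" for k
    using that
  proof (induction k)
    case 0
    then show ?case by (simp add: orthonormal_def)
  next
    case (Suc k)
    then obtain f where f: "orthonormal f {..<k}" "\<forall>j<k. ?t < norm (X (f j))" by auto
    have "card (f ` {..<k}) \<le> m"
      using card_image_le[of "{..<k}" f] Suc.prems by simp
    then obtain x where x: "\<And>s. s \<in> f ` {..<k} \<Longrightarrow> cinner x s = 0" "?t * norm x < norm (X x)"
      using not gelfand_leI[of "f ` {..<k}" m X ?t] by (force simp: not_le)
    have "x \<noteq> 0" using x(2) by (auto simp: clinear_0[OF X])
    define u where "u = complex_of_real (inverse (norm x)) *\<^sub>C x"
    have c: "cmod (complex_of_real (inverse (norm x))) = inverse (norm x)"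
      by (simp add: norm_inverse)
    have u: "norm u = 1" "?t < norm (X u)" "\<And>j. j < k \<Longrightarrow> cinner u (f j) = 0"
      using x \<open>x \<noteq> 0\<close>
      unfolding u_def norm_scaleC clinear_scaleC[OF X] cinner_scaleC_left c
      by (auto simp: field_simps)
    have "orthonormal (f(k := u)) {..<Suc k}"
      using u f(1) orthonormal_norm[OF f(1)]
      by (intro orthonormalI) (auto simp: orthonormal_def less_Suc_eq)
    moreover have "\<forall>j<Suc k. ?t < norm (X ((f(k := u)) j))"
      using f(2) u(2) by (auto simp: less_Suc_eq)
    ultimately show ?case by blast
  qed
  then obtain f where f: "orthonormal f {..<Suc m}" "\<And>j. j < Suc m \<Longrightarrow> ?t < norm (X (f j))"
    by blast
  have "0 \<le> ?t" using K(1) weight_pos[of m "1/2"] by simp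
  have "(real m + 1) * ?t\<^sup>2 = K\<^sup>2"
    unfolding weight_def by (simp add: power_mult_distrib powr_minus powr_half_sqrt field_simps)
  moreover have "(real m + 1) * ?t\<^sup>2 = (\<Sum>j<Suc m. ?t\<^sup>2)" by simp
  moreover have "\<dots> < (\<Sum>j<Suc m. (norm (X (f j)))\<^sup>2)"
    using f(2) \<open>0 \<le> ?t\<close> by (intro sum_strict_mono power_strict_mono) auto
  moreover have "\<dots> = (\<Sum>j<Suc m. \<Sum>i<n. (cmod (cinner (X (f j)) (e i)))\<^sup>2)"
    by (intro sum.cong refl parseval[OF e] range) auto
  moreover have "\<dots> = (\<Sum>i<n. \<Sum>j<Suc m. (cmod (cinner (X (e i)) (f j)))\<^sup>2)"
    by (subst sum.swap) (simp only: cmod_cinner_adjoint[OF adj])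
  moreover have "\<dots> \<le> (\<Sum>i<n. (norm (X (e i)))\<^sup>2)"
    by (intro sum_mono bessel orthonormal_imp_0[OF f(1)]) auto
  ultimately show False using K(2) by linarith
qed

section \<open>Matsaev's inequality for triangular operators\<close>

text \<open>The number \<open>cinner (M (e j)) (e i)\<close> is the matrix entry in row i and column
  j, so M is upper triangular. As both ranges lie in the span, M and its adjoint \<open>N\<close>
  vanish on the orthogonal complement: they are matrices extended by zero.\<close>

locale triangular =
  fixes e :: "nat \<Rightarrow> 'a::complex_hilbert_space" and n :: nat and M N :: "'a \<Rightarrow> 'a"
  assumes orth: "orthonormal e {..<n}"
    and adj: "adjoint_pair M N"
    and M_range: "\<And>x. M x \<in> complex_vector.span (e ` {..<n})"
    and N_range: "\<And>x. N x \<in> complex_vector.span (e ` {..<n})"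
    and triangular: "\<And>i j. j < i \<Longrightarrow> i < n \<Longrightarrow> cinner (M (e j)) (e i) = 0"
    and imaginary_diag: "\<And>j. j < n \<Longrightarrow> Re (cinner (M (e j)) (e j)) = 0"
begin

lemma lin: "clinear M" "clinear N"
  using adjoint_pair_clinear adj adjoint_pair_sym by blast+

definition \<beta> :: "nat \<Rightarrow> real" where "\<beta> j = Im (cinner (M (e j)) (e j))"

lemma diag: "j < n \<Longrightarrow> cinner (M (e j)) (e j) = \<i> * complex_of_real (\<beta> j)"
  using imaginary_diag[of j] by (simp add: \<beta>_def complex_eq_iff)

text \<open>A product of entries along j, k, i can be non-zero only for j \<le> k \<le> i. On the
  diagonal this leaves the square of \<i> \<beta>_j.\<close>

lemma square_entry:
  assumes "j \<le> i" "i < n"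
  shows "cinner (M (M (e j))) (e i) = (if i = j then - complex_of_real ((\<beta> j)\<^sup>2) else 0)"
proof -
  have "M (e j) = (\<Sum>k<n. cinner (M (e j)) (e k) *\<^sub>C e k)"
    using oproj_span[OF orth _ M_range] by (simp add: oproj_def)
  from arg_cong[OF this, of M]
  have "M (M (e j)) = (\<Sum>k<n. cinner (M (e j)) (e k) *\<^sub>C M (e k))"
    by (simp only: clinear_sum[OF lin(1)] clinear_scaleC[OF lin(1)])
  then have "cinner (M (M (e j))) (e i) =
      (\<Sum>k<n. cinner (M (e j)) (e k) * cinner (M (e k)) (e i))"
    by (simp only: cinner.sum_left cinner_scaleC_left)
  also have "\<dots> = (\<Sum>k<n. if k = i \<and> i = j then - complex_of_real ((\<beta> j)\<^sup>2) else 0)"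
  proof (rule sum.cong[OF refl])
    fix k assume "k \<in> {..<n}"
    then consider "j < k" | "k < i" | "k = i" "i = j" using assms by force
    then show "cinner (M (e j)) (e k) * cinner (M (e k)) (e i) =
        (if k = i \<and> i = j then - complex_of_real ((\<beta> j)\<^sup>2) else 0)"
    proof cases
      case 3
      then show ?thesis using diag[of j] assms by (simp add: power2_eq_square complex_eq_iff)
    qed (use triangular assms \<open>k \<in> {..<n}\<close> in auto)
  qed
  also have "\<dots> = (if i = j then - complex_of_real ((\<beta> j)\<^sup>2) else 0)"
    using assms by (cases "i = j") auto
  finally show ?thesis .
qed

text \<open>Minus the diagonal part of M^2. It is non-negative precisely because the diagonal of M
  is imaginary.\<close>

definition \<Delta> :: "'a \<Rightarrow> 'a" where
  "\<Delta> x = (\<Sum>j<n. (complex_of_real ((\<beta> j)\<^sup>2) * cinner x (e j)) *\<^sub>C e j)"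

lemma \<Delta>_sym: "adjoint_pair \<Delta> \<Delta>"
  unfolding adjoint_pair_def \<Delta>_def cinner.sum_left cinner.sum_right
  by (intro allI sum.cong) (auto simp: cinner_simps mult.assoc cinner_commute[of "e _"])

lemma \<Delta>_nonneg: "0 \<le> Re (cinner (\<Delta> x) x)"
proof -
  have "cinner (\<Delta> x) x = (\<Sum>j<n. complex_of_real ((\<beta> j)\<^sup>2 * (cmod (cinner x (e j)))\<^sup>2))"
    unfolding \<Delta>_def cinner.sum_left
    by (intro sum.cong) (simp_all add: cinner_scaleC_left cinner_mult_cnj mult.assoc)
  also have "Re \<dots> = (\<Sum>j<n. (\<beta> j)\<^sup>2 * (cmod (cinner x (e j)))\<^sup>2)" by simp
  also have "0 \<le> \<dots>" by (intro sum_nonneg) simp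
  finally show ?thesis .
qed

lemma \<Delta>_entry: "i < n \<Longrightarrow> j < n \<Longrightarrow>
  cinner (\<Delta> (e j)) (e i) = (if i = j then complex_of_real ((\<beta> j)\<^sup>2) else 0)"
  using cinner_sum_orthonormal0[OF orthonormal_imp_0[OF orth], of i
      "\<lambda>k. complex_of_real ((\<beta> k)\<^sup>2) * cinner (e j) (e k)"] orthonormal_norm[OF orth, of i] orth
  unfolding \<Delta>_def orthonormal_def by force

lemma \<Delta>_range: "\<Delta> x \<in> complex_vector.span (e ` {..<n})"
  unfolding \<Delta>_def
  by (intro complex_vector.span_sum complex_vector.span_scale complex_vector.span_base) auto

text \<open>Adding \<open>\<Delta>\<close> makes the diagonal of the square zero, in particular
  imaginary, so the induction hypothesis of Matsaev's inequality applies to it.\<close>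

lemma triangular_square: "triangular e n (\<lambda>x. M (M x) + \<Delta> x) (\<lambda>x. N (N x) + \<Delta> x)"
proof
  show "adjoint_pair (\<lambda>x. M (M x) + \<Delta> x) (\<lambda>x. N (N x) + \<Delta> x)"
    unfolding adjoint_pair_def
    by (simp add: cinner_simps adjoint_pairD[OF adj] adjoint_pairD[OF \<Delta>_sym])
  show "M (M x) + \<Delta> x \<in> complex_vector.span (e ` {..<n})"
    "N (N x) + \<Delta> x \<in> complex_vector.span (e ` {..<n})" for x
    using M_range N_range \<Delta>_range by (auto intro: complex_vector.span_add)
qed (simp_all add: orth cinner_simps square_entry \<Delta>_entry)

abbreviation X :: "'a \<Rightarrow> 'a" where "X \<equiv> \<lambda>x. M x + N x"
abbreviation Y :: "'a \<Rightarrow> 'a" where "Y \<equiv> \<lambda>x. M x - N x"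

lemma X_sym: "adjoint_pair X X"
  unfolding adjoint_pair_def
  by (simp add: cinner_simps adjoint_pairD[OF adj] adjoint_pairD[OF adjoint_pair_sym[OF adj]])

lemma Y_adj: "adjoint_pair Y (\<lambda>x. - Y x)"
  unfolding adjoint_pair_def
  by (simp add: cinner_simps adjoint_pairD[OF adj] adjoint_pairD[OF adjoint_pair_sym[OF adj]])

text \<open>Expanding gives X^2 = 2 (M^2 + N^2) - Y^2, where - Y^2 = Y*Y. Restoring the diagonals of
  the squares contributes - 4 \<Delta>, which may be dropped in an upper bound.\<close>

lemma norm_X_le:
  "(norm (X x))\<^sup>2 \<le> 2 * norm ((M (M x) + \<Delta> x) + (N (N x) + \<Delta> x)) * norm x + (norm (Y x))\<^sup>2"
proof -
  let ?Z = "(M (M x) + \<Delta> x) + (N (N x) + \<Delta> x)"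
  have "complex_of_real ((norm (X x))\<^sup>2) = cinner (X (X x)) x"
    by (simp only: cinner_self[symmetric] adjoint_pairD[OF X_sym])
  also have "\<dots> = 2 * cinner ?Z x - 4 * cinner (\<Delta> x) x - cinner (Y (Y x)) x"
    by (simp add: cinner_simps clinear_add[OF lin(1)] clinear_add[OF lin(2)]
        clinear_diff[OF lin(1)] clinear_diff[OF lin(2)])
  also have "cinner (Y (Y x)) x = - complex_of_real ((norm (Y x))\<^sup>2)"
    by (simp only: cinner_self[symmetric] adjoint_pairD[OF Y_adj] cinner.minus_right)
  finally have "(norm (X x))\<^sup>2 = 2 * Re (cinner ?Z x) - 4 * Re (cinner (\<Delta> x) x) + (norm (Y x))\<^sup>2"
    by (simp add: complex_eq_iff)
  moreover have "Re (cinner ?Z x) \<le> norm ?Z * norm x"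
    using cinner_bound complex_Re_le_cmod order_trans by blast
  ultimately show ?thesis using \<Delta>_nonneg[of x] by simp
qed

text \<open>The two sides differ by 4 Re <M e_i, N e_i> = 4 Re <M^2 e_i, e_i> = - 4
  \<beta>_i^2.\<close>

lemma norm_X_basis_le: "i < n \<Longrightarrow> (norm (X (e i)))\<^sup>2 \<le> (norm (Y (e i)))\<^sup>2"
proof -
  assume "i < n"
  have "Re (cinner (M (e i)) (N (e i))) = - (\<beta> i)\<^sup>2"
    using square_entry[of i i] \<open>i < n\<close> by (simp flip: adjoint_pairD[OF adj])
  then have "inner (M (e i)) (N (e i)) = - (\<beta> i)\<^sup>2" by (simp add: Re_cinner)
  then have "(norm (X (e i)))\<^sup>2 = (norm (Y (e i)))\<^sup>2 - 4 * (\<beta> i)\<^sup>2"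
    by (simp add: power2_norm_eq_inner inner_simps inner_commute)
  then show ?thesis by simp
qed

lemma X_range: "X x \<in> complex_vector.span (e ` {..<n})"
  using M_range N_range by (intro complex_vector.span_add)

lemma Y_range: "Y x \<in> complex_vector.span (e ` {..<n})"
  using M_range N_range by (intro complex_vector.span_diff)

text \<open>The case \<open>p = 2\<close>, where the trace of \<open>M\<^sup>2\<close> is non-positive.\<close>

lemma matsaev_base:
  assumes g: "0 < g" and b: "0 \<le> b" and Y: "\<And>m. gelfand_le Y m (b * weight m (g + 1/2))"
  shows "gelfand_le X m (sqrt (\<Sum>j. weight j (2 * g + 1)) * b * weight m (1/2))"
proof -
  let ?Z = "\<Sum>j. weight j (2 * g + 1)"
  have summ: "summable (\<lambda>j. weight j (2 * g + 1))"
    using g by (simp add: summable_weight)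
  have Z0: "0 \<le> ?Z"
    by (intro suminf_nonneg summ less_imp_le weight_pos)
  obtain f where f: "orthonormal f {..<n}" "f ` {..<n} \<subseteq> complex_vector.span (e ` {..<n})"
      "\<forall>j<n. norm (Y (f j)) \<le> b * weight j (g + 1/2)"
    using basis_from_gelfand[OF orth, of Y "\<lambda>m. b * weight m (g + 1/2)"] Y by blast
  have "(\<Sum>i<n. (norm (X (e i)))\<^sup>2) \<le> (\<Sum>i<n. (norm (Y (e i)))\<^sup>2)"
    by (intro sum_mono norm_X_basis_le) simp
  also have "\<dots> \<le> (\<Sum>j<n. (norm (- Y (f j)))\<^sup>2)"
    using f(1,2) by (intro hilbert_schmidt_basis_change[OF orth _ _ Y_adj] Y_range)
  \<comment> \<open>Squaring doubles the exponent to 2 g + 1 > 1. Here the surplus g is spent: it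
    bounds the sum independently of n.\<close>
  also have "\<dots> \<le> (\<Sum>j<n. b\<^sup>2 * weight j (2 * g + 1))"
  proof (rule sum_mono)
    fix j assume "j \<in> {..<n}"
    then have "(norm (- Y (f j)))\<^sup>2 \<le> (b * weight j (g + 1/2))\<^sup>2"
      using f(3) unfolding norm_minus_cancel by (intro power_mono) auto
    also have "(g + 1/2) + (g + 1/2) = 2 * g + 1" by simp
    then have "(b * weight j (g + 1/2))\<^sup>2 = b\<^sup>2 * weight j (2 * g + 1)"
      using weight_add[of j "g + 1/2" "g + 1/2"] by (simp add: power2_eq_square)
    finally show "(norm (- Y (f j)))\<^sup>2 \<le> b\<^sup>2 * weight j (2 * g + 1)" .
  qed
  also have "\<dots> \<le> b\<^sup>2 * ?Z"
    unfolding sum_distrib_left[symmetric] using weight_pos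
    by (intro mult_left_mono sum_le_suminf[OF summ]) (auto intro: less_imp_le)
  also have "\<dots> = (sqrt ?Z * b)\<^sup>2"
    using Z0 by (simp add: power_mult_distrib)
  finally show ?thesis
    using b Z0 by (intro gelfand_from_hilbert_schmidt[OF orth X_sym X_range]) auto
qed

end

section \<open>From one exponent to the next by absorbing the constant\<close>

context triangular
begin

lemma X_kernel:
  assumes "\<And>i. i < n \<Longrightarrow> cinner x (e i) = 0"
  shows "X x = 0"
proof -
  have "cinner (X x) y = 0" for y
  proof -
    have "cinner x (X y) = cinner x (oproj e {..<n} (X y))"
      using oproj_span[OF orth _ X_range] by simp
    also have "\<dots> = 0"
      using assms by (simp add: oproj_def cinner.sum_right cinner_scaleC_right)
    finally show ?thesis by (simp only: adjoint_pairD[OF X_sym])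
  qed
  then show ?thesis using cinner_eq_0_iff by blast
qed

text \<open>Only finiteness matters, and the constant may depend on n: \<open>X\<close> is bounded
  and of rank at most n, so that nothing is left to estimate for m \<ge> n. It ensures that the
  infimum in \<open>matsaev_step\<close> is taken over a non-empty set.\<close>

lemma X_weight_bound:
  assumes "s \<le> 1"
  shows "\<exists>h>0. \<forall>m. gelfand_le X m (h * weight m s)"
proof -
  have linX: "clinear X" by (rule adjoint_pair_clinear[OF X_sym])
  define K where "K = (\<Sum>i<n. norm (X (e i)))"
  have "0 \<le> K" unfolding K_def by (intro sum_nonneg) simp
  have bound: "norm (X x) \<le> K * norm x" for x
  proof -
    have "X (x - oproj e {..<n} x) = 0"
      by (rule X_kernel) (simp add: oproj_orthogonal[OF orthonormal_imp_0[OF orth]])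
    then have "X x = X (oproj e {..<n} x)" by (simp only: clinear_diff[OF linX]) simp
    also have "\<dots> = (\<Sum>i<n. cinner x (e i) *\<^sub>C X (e i))"
      unfolding oproj_def by (simp only: clinear_sum[OF linX] clinear_scaleC[OF linX])
    also have "norm \<dots> \<le> (\<Sum>i<n. norm (X (e i)) * norm x)"
    proof (rule sum_norm_le)
      fix i assume "i \<in> {..<n}"
      then have "cmod (cinner x (e i)) \<le> norm x"
        using cinner_bound[of x "e i"] orthonormal_norm[OF orth] by simp
      then show "norm (cinner x (e i) *\<^sub>C X (e i)) \<le> norm (X (e i)) * norm x"
        by (simp add: mult.commute[of _ "norm x"] mult_right_mono)
    qed
    finally show ?thesis by (simp add: K_def sum_distrib_right)
  qed
  let ?h = "(K + 1) * (real n + 1)"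
  have "gelfand_le X m (?h * weight m s)" for m
  proof (cases "n \<le> m")
    case True
    show ?thesis
    proof (rule gelfand_leI)
      show "card (e ` {..<n}) \<le> m"
        using card_image_le[of "{..<n}" e] True by simp
      fix x assume "\<And>s. s \<in> e ` {..<n} \<Longrightarrow> cinner x s = 0"
      then have "X x = 0" by (intro X_kernel) auto
      then show "norm (X x) \<le> ?h * weight m s * norm x"
        using \<open>0 \<le> K\<close> weight_pos[of m s] by simp
    qed simp
  next
    case False
    have "K \<le> ?h * (1 / (real m + 1))"
    proof -
      have "K * (real m + 1) \<le> ?h"
        using \<open>0 \<le> K\<close> False by (intro mult_mono) auto
      then show ?thesis by (simp add: field_simps)
    qed
    also have "\<dots> \<le> ?h * weight m s"
    proof (rule mult_left_mono)
      have "(real m + 1) powr (- 1) \<le> weight m s"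
        unfolding weight_def using assms by (intro powr_mono) auto
      then show "1 / (real m + 1) \<le> weight m s"
        by (simp add: powr_minus divide_inverse)
    qed (use \<open>0 \<le> K\<close> in simp)
    finally have "K \<le> ?h * weight m s" .
    moreover have "gelfand_le X 0 K" by (rule gelfand_le_norm) (rule bound)
    ultimately show ?thesis using gelfand_le_mono by blast
  qed
  moreover have "?h > 0" using \<open>0 \<le> K\<close> by (intro mult_pos_pos) auto
  ultimately show ?thesis by blast
qed

text \<open>The skew part of the square factors: X Y + Y X = 2 (M^2 - N^2). Hence an a priori bound
  h on \<open>X\<close>, times the bound b on \<open>Y\<close>, gives decay g + r for it, the
  induction hypothesis gives decay r for the Hermitian part of the square, and
  \<open>norm_X_le\<close> takes a square root. The gain is that h now stands under the
  root.\<close>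

lemma matsaev_improve:
  assumes "0 \<le> c" "0 < b" "0 < h" and g: "0 < g" "0 \<le> r" "g + r \<le> 1"
    and IH: "\<And>b. 0 < b \<Longrightarrow>
      (\<And>m. gelfand_le (\<lambda>x. (M (M x) + \<Delta> x) - (N (N x) + \<Delta> x)) m (b * weight m (g + r))) \<Longrightarrow>
      (\<And>m. gelfand_le (\<lambda>x. (M (M x) + \<Delta> x) + (N (N x) + \<Delta> x)) m (c * b * weight m r))"
    and Y: "\<And>m. gelfand_le Y m (b * weight m (g + r / 2))"
    and X: "\<And>m. gelfand_le X m (h * weight m (r / 2))"
  shows "gelfand_le X m (2 * sqrt (8 * c * h * b + b\<^sup>2) * weight m (r / 2))"
proof -
  have w: "weight m (r / 2) * weight m (g + r / 2) = weight m (g + r)" for m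
    by (simp flip: weight_add) (simp add: add.commute)
  have "gelfand_le (\<lambda>x. X (Y x)) (m + m) (h * weight m (r / 2) * (b * weight m (g + r / 2)))" for m
    using \<open>0 < h\<close> by (intro gelfand_le_comp[OF X Y Y_adj]) (simp add: weight_nonneg)
  moreover have "gelfand_le (\<lambda>x. Y (X x)) (m + m) (b * weight m (g + r / 2) * (h * weight m (r / 2)))" for m
    using \<open>0 < b\<close> by (intro gelfand_le_comp[OF Y X X_sym]) (simp add: weight_nonneg)
  ultimately have "gelfand_le (\<lambda>x. (1/2) *\<^sub>C (X (Y x) + Y (X x))) (m + m + (m + m))
      (cmod (1/2) * (h * weight m (r / 2) * (b * weight m (g + r / 2)) +
        b * weight m (g + r / 2) * (h * weight m (r / 2))))" for m
    by (intro gelfand_le_scaleC gelfand_le_add)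
  moreover have "(1/2) *\<^sub>C (X (Y x) + Y (X x)) = (M (M x) + \<Delta> x) - (N (N x) + \<Delta> x)" for x
  proof -
    have "X (Y x) + Y (X x) = 2 *\<^sub>C (M (M x) - N (N x))"
      by (simp add: clinear_add[OF lin(1)] clinear_add[OF lin(2)]
          clinear_diff[OF lin(1)] clinear_diff[OF lin(2)] flip: scaleC_2)
    then show ?thesis by (simp add: scaleC_scaleC scaleC_one)
  qed
  moreover have "cmod (1/2) * (h * weight m (r / 2) * (b * weight m (g + r / 2)) +
        b * weight m (g + r / 2) * (h * weight m (r / 2))) = h * b * weight m (g + r)" for m
    by (simp add: norm_divide flip: w)
  moreover have "m + m + (m + m) = 4 * m" for m :: nat by simp
  ultimately have "gelfand_le (\<lambda>x. (M (M x) + \<Delta> x) - (N (N x) + \<Delta> x)) (4 * m)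
      (h * b * weight m (g + r))" for m
    by (simp only:)
  \<comment> \<open>Two products with 2 m constraints each make 4 m; rescaling turns this into the
    factor 4.\<close>
  then have "gelfand_le (\<lambda>x. (M (M x) + \<Delta> x) - (N (N x) + \<Delta> x)) m
      (real 4 * (h * b) * weight m (g + r))" for m
    using g \<open>0 < h\<close> \<open>0 < b\<close> by (intro gelfand_le_rescale) simp_all
  then have X2: "gelfand_le (\<lambda>x. (M (M x) + \<Delta> x) + (N (N x) + \<Delta> x)) m
      (c * (real 4 * (h * b)) * weight m r)" for m
    using \<open>0 < h\<close> \<open>0 < b\<close> by (intro IH) simp_all
  have "gelfand_le X (m + m) (sqrt (8 * c * h * b + b\<^sup>2) * weight m (r / 2))" for m
  proof (rule gelfand_le_combine[OF X2[of m] Y[of m]])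
    fix x
    let ?Z = "(M (M x) + \<Delta> x) + (N (N x) + \<Delta> x)"
    assume Z: "norm ?Z \<le> c * (real 4 * (h * b)) * weight m r * norm x"
      and Yx: "norm (Y x) \<le> b * weight m (g + r / 2) * norm x"
    have "weight m (g + r / 2) \<le> weight m (r / 2)"
      using g by (intro weight_antimono) simp
    then have "b * weight m (g + r / 2) * norm x \<le> b * weight m (r / 2) * norm x"
      using \<open>0 < b\<close> by (intro mult_right_mono mult_left_mono) auto
    with Yx have "(norm (Y x))\<^sup>2 \<le> (b * weight m (r / 2) * norm x)\<^sup>2"
      by (intro power_mono) auto
    moreover have "(norm (X x))\<^sup>2 \<le> 2 * norm ?Z * norm x + (norm (Y x))\<^sup>2"
      by (rule norm_X_le)
    moreover have "2 * norm ?Z * norm x \<le> 2 * (c * (real 4 * (h * b)) * weight m r * norm x) * norm x"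
      using Z by (intro mult_right_mono mult_left_mono) auto
    moreover have "weight m r = (weight m (r / 2))\<^sup>2"
      using weight_add[of m "r/2" "r/2"] by (simp add: power2_eq_square)
    ultimately have "(norm (X x))\<^sup>2 \<le> (8 * c * h * b + b\<^sup>2) * (weight m (r / 2) * norm x)\<^sup>2"
      by (simp add: power2_eq_square algebra_simps)
    also have "\<dots> = (sqrt (8 * c * h * b + b\<^sup>2) * weight m (r / 2) * norm x)\<^sup>2"
      using assms(1-3) by (simp add: power_mult_distrib)
    finally show "norm (X x) \<le> sqrt (8 * c * h * b + b\<^sup>2) * weight m (r / 2) * norm x"
      using assms(1-3) weight_pos[of m "r/2"] by (simp add: power2_le_iff_abs_le abs_le_iff)
  qed
  \<comment> \<open>The bounds for the square and for \<open>Y\<close> use m constraints each,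
    whence the final factor 2.\<close>
  then have "gelfand_le X (2 * m) (sqrt (8 * c * h * b + b\<^sup>2) * weight m (r / 2))" for m
    by (simp add: mult_2)
  then have "gelfand_le X m (real 2 * sqrt (8 * c * h * b + b\<^sup>2) * weight m (r / 2))"
    using g assms(1-3) by (intro gelfand_le_rescale) simp_all
  then show ?thesis by simp
qed

text \<open>The best constant \<open>h\<close> is finite; if it exceeded \<open>(128 c + 8) b\<close>, the previous lemma would
  halve it.\<close>

lemma matsaev_step:
  assumes "0 \<le> c" "0 < b" and g: "0 < g" "0 \<le> r" "g + r \<le> 1"
    and IH: "\<And>b. 0 < b \<Longrightarrow>
      (\<And>m. gelfand_le (\<lambda>x. (M (M x) + \<Delta> x) - (N (N x) + \<Delta> x)) m (b * weight m (g + r))) \<Longrightarrow>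
      (\<And>m. gelfand_le (\<lambda>x. (M (M x) + \<Delta> x) + (N (N x) + \<Delta> x)) m (c * b * weight m r))"
    and Y: "\<And>m. gelfand_le Y m (b * weight m (g + r / 2))"
  shows "gelfand_le X m ((128 * c + 8) * b * weight m (r / 2))"
proof -
  define H where "H = {h. 0 < h \<and> (\<forall>m. gelfand_le X m (h * weight m (r / 2)))}"
  define h0 where "h0 = Inf H"
  have "r / 2 \<le> 1" using g by simp
  then have "H \<noteq> {}" using X_weight_bound[of "r / 2"] by (auto simp: H_def)
  have bdd: "bdd_below H" by (rule bdd_belowI[of _ 0]) (auto simp: H_def)
  have "\<exists>h\<in>H. h < (128 * c + 8) * b"
  proof (rule ccontr)
    assume no: "\<not> ?thesis"
    then have h0: "(128 * c + 8) * b \<le> h0"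
      unfolding h0_def by (intro cInf_greatest \<open>H \<noteq> {}\<close>) (meson not_le)
    have "0 < (128 * c + 8) * b" using assms(1,2) by simp
    then obtain h where h: "h \<in> H" "h < 2 * h0"
      using cInf_lessD[OF \<open>H \<noteq> {}\<close>, of "2 * h0"] h0 unfolding h0_def by auto
    then have "0 < h" by (simp add: H_def)
    have "h0 \<le> h" unfolding h0_def by (rule cInf_lower[OF h(1) bdd])
    then have hb: "(128 * c + 8) * b \<le> h" using h0 by simp
    let ?h' = "2 * sqrt (8 * c * h * b + b\<^sup>2)"
    have "0 < 8 * c * h * b + b\<^sup>2"
      using assms(1,2) \<open>0 < h\<close> by (intro add_nonneg_pos) auto
    moreover have "gelfand_le X m (?h' * weight m (r / 2))" for m
      using h(1) \<open>0 < h\<close> by (intro matsaev_improve[OF assms(1,2) _ g IH Y]) (auto simp: H_def)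
    ultimately have "?h' \<in> H" by (simp add: H_def)
    then have "h0 \<le> ?h'" unfolding h0_def using bdd by (rule cInf_lower)
    \<comment> \<open>Sixteen times the radicand is 128 c h b + 16 b^2. The number 128 in the
      constant covers the first term, and 8 covers the second because 8 b \<le> h. Since h < 2
      \<open>h0\<close>, this puts \<open>?h'\<close> below the infimum.\<close>
    moreover have "?h' \<le> h / 2"
    proof -
      have "8 * b \<le> h"
        using hb assms(1,2) by (intro order_trans[OF _ hb]) (simp add: algebra_simps)
      then have "16 * (b * b) \<le> 8 * (b * h)"
        using assms(2) by (simp add: mult_left_mono)
      moreover have "(128 * c + 8) * b * h \<le> h * h"
        using hb \<open>0 < h\<close> by (intro mult_right_mono) auto
      ultimately have "16 * (8 * c * h * b + b\<^sup>2) \<le> h\<^sup>2"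
        by (simp add: power2_eq_square algebra_simps)
      then have "8 * c * h * b + b\<^sup>2 \<le> (h / 4)\<^sup>2" by (simp add: power_divide)
      then have "sqrt (8 * c * h * b + b\<^sup>2) \<le> h / 4"
        using \<open>0 < h\<close> by (intro real_le_lsqrt) auto
      then show ?thesis by simp
    qed
    ultimately show False using h(2) by simp
  qed
  then obtain h where h: "h \<in> H" "h < (128 * c + 8) * b" by blast
  then have "h * weight m (r / 2) \<le> (128 * c + 8) * b * weight m (r / 2)"
    using weight_pos[of m "r/2"] by (intro mult_right_mono) auto
  then show ?thesis
    using h(1) gelfand_le_mono[of X m "h * weight m (r / 2)" m] by (auto simp: H_def)
qed

end

text \<open>The constant is chosen before the basis, its length, the operators and b; this
  uniformity is what allows arbitrarily large compressions. The bound g \<le> 1/2 keeps all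
  exponents at most 1, as rescaling demands.\<close>

theorem matsaev:
  fixes g :: real and k :: nat
  assumes g: "0 < g" "g \<le> 1/2"
  shows "\<exists>c\<ge>0. \<forall>(e :: nat \<Rightarrow> 'a::complex_hilbert_space) n M N b. triangular e n M N \<longrightarrow> 0 < b \<longrightarrow>
    (\<forall>m. gelfand_le (\<lambda>x. M x - N x) m (b * weight m (g + (1/2) ^ Suc k))) \<longrightarrow>
    (\<forall>m. gelfand_le (\<lambda>x. M x + N x) m (c * b * weight m ((1/2) ^ Suc k)))"
proof (induction k)
  case 0
  have "summable (\<lambda>j. weight j (2 * g + 1))"
    using g by (intro summable_weight) simp
  then have "0 \<le> (\<Sum>j. weight j (2 * g + 1))"
    by (intro suminf_nonneg weight_nonneg)
  then have "0 \<le> sqrt (\<Sum>j. weight j (2 * g + 1))"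
    by simp
  have r1: "(1/2 :: real) ^ Suc 0 = 1/2" by simp
  show ?case
    unfolding r1
  proof (intro exI[of _ "sqrt (\<Sum>j. weight j (2 * g + 1))"] conjI allI impI)
    fix e :: "nat \<Rightarrow> 'a" and n M N and b :: real and m
    assume "triangular e n M N" "0 < b"
      and "\<forall>m. gelfand_le (\<lambda>x. M x - N x) m (b * weight m (g + 1/2))"
    then show "gelfand_le (\<lambda>x. M x + N x) m
        (sqrt (\<Sum>j. weight j (2 * g + 1)) * b * weight m (1/2))"
      by (intro triangular.matsaev_base g(1)) auto
  qed fact
next
  case (Suc k)
  then obtain c where c: "0 \<le> c" and IH: "\<And>(e :: nat \<Rightarrow> 'a) n M N b m. triangular e n M N \<Longrightarrow> 0 < b \<Longrightarrow>
      (\<And>m. gelfand_le (\<lambda>x. M x - N x) m (b * weight m (g + (1/2) ^ Suc k))) \<Longrightarrow>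
      gelfand_le (\<lambda>x. M x + N x) m (c * b * weight m ((1/2) ^ Suc k))"
    by blast
  let ?r = "(1/2 :: real) ^ Suc k"
  have r: "0 \<le> ?r" "g + ?r \<le> 1"
    using g power_le_one[of "1/2 :: real" k] by auto
  have r2: "(1/2 :: real) ^ Suc (Suc k) = ?r / 2" by simp
  show ?case
    unfolding r2
  proof (intro exI[of _ "128 * c + 8"] conjI allI impI)
    fix e :: "nat \<Rightarrow> 'a" and n M N and b :: real and m
    assume tri: "triangular e n M N" and "0 < b"
      and Y: "\<forall>m. gelfand_le (\<lambda>x. M x - N x) m (b * weight m (g + ?r / 2))"
    show "gelfand_le (\<lambda>x. M x + N x) m ((128 * c + 8) * b * weight m (?r / 2))"
      using Y by (intro triangular.matsaev_step[OF tri c \<open>0 < b\<close> g(1) r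
            IH[OF triangular.triangular_square[OF tri]]]) auto
  qed (use c in simp)
qed

section \<open>Compressions of compact operators\<close>

lemma volterra_no_eigenvalue:
  assumes "volterra_operator A" "A v = z *\<^sub>C v" "v \<noteq> 0"
  shows "z = 0"
proof -
  have "z \<in> spectrum A"
  proof (rule ccontr)
    assume "z \<notin> spectrum A"
    then obtain R where R: "bounded_clinear R" "\<And>x. R (A x - z *\<^sub>C x) = x"
      unfolding spectrum_def by blast
    have "v = R 0" using R(2)[of v] assms(2) by simp
    also have "\<dots> = 0" using R(1) clinear_0 bounded_clinear_imp_clinear by blast
    finally show False using assms(3) by simp
  qed
  then show ?thesis
    using assms(1) by (simp add: volterra_operator_def quasinilpotent_def)
qed

lemma finite_subset_orthonormal_span:
  fixes B :: "'a::complex_hilbert_space set"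
  assumes "finite B"
  shows "\<exists>e n. orthonormal e {..<n} \<and> B \<subseteq> complex_vector.span (e ` {..<n})"
  using assms
proof (induction B)
  case empty
  show ?case by (intro exI[of _ "\<lambda>_. 0"] exI[of _ 0]) (simp add: orthonormal_def)
next
  case (insert b B)
  then obtain e n where e: "orthonormal e {..<n}" "B \<subseteq> complex_vector.span (e ` {..<n})"
    by blast
  define w where "w = b - oproj e {..<n} b"
  show ?case
  proof (cases "w = 0")
    case True
    then have "b \<in> complex_vector.span (e ` {..<n})"
      using oproj_in_span[of e "{..<n}" b] by (simp add: w_def)
    then show ?thesis using e by blast
  next
    case False
    define u where "u = complex_of_real (inverse (norm w)) *\<^sub>C w"
    have "norm u = 1" using False by (simp add: u_def norm_inverse)
    have perp: "cinner (e i) u = 0" if "i < n" for i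
      using oproj_orthogonal[OF orthonormal_imp_0[OF e(1)], of i b] that cinner_sym_0
      by (auto simp: u_def w_def cinner_scaleC_right)
    have "complex_vector.subspace {x. cinner x u = 0}"
      by (rule complex_vector.subspaceI) (auto simp: cinner_simps)
    then have "complex_vector.span (e ` {..<n}) \<subseteq> {x. cinner x u = 0}"
      using perp by (intro complex_vector.span_minimal) auto
    then have on: "orthonormal (e(n := u)) {..<Suc n}"
      by (intro orthonormal_append e(1) \<open>norm u = 1\<close>) auto
    have mono: "complex_vector.span (e ` {..<n}) \<subseteq> complex_vector.span ((e(n := u)) ` {..<Suc n})"
      by (intro complex_vector.span_mono) (auto simp: image_iff intro!: bexI)
    have "u \<in> complex_vector.span ((e(n := u)) ` {..<Suc n})"
      by (intro complex_vector.span_base) auto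
    then have "oproj e {..<n} b + complex_of_real (norm w) *\<^sub>C u
        \<in> complex_vector.span ((e(n := u)) ` {..<Suc n})"
      using mono oproj_in_span by (intro complex_vector.span_add complex_vector.span_scale) blast+
    moreover have "oproj e {..<n} b + complex_of_real (norm w) *\<^sub>C u = b"
      using False by (simp add: u_def w_def scaleC_scaleC scaleC_one)
    ultimately have "insert b B \<subseteq> complex_vector.span ((e(n := u)) ` {..<Suc n})"
      using e(2) mono by auto
    then show ?thesis using on by blast
  qed
qed

lemma oproj_dist_le:
  assumes "orthonormal e {..<n}" "y \<in> complex_vector.span (e ` {..<n})"
  shows "norm (x - oproj e {..<n} x) \<le> norm (x - y)"
proof -
  have eq: "x - oproj e {..<n} x = (x - y) - oproj e {..<n} (x - y)"
    by (simp add: clinear_diff[OF clinear_oproj] oproj_span[OF assms(1) _ assms(2)])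
  show ?thesis
    by (subst eq) (simp add: oproj_diff_norm_le[OF orthonormal_imp_0[OF assms(1)]])
qed

lemma compact_operator_finite_net:
  assumes "compact_operator A" "0 < \<delta>"
  shows "\<exists>F. finite F \<and> (\<forall>x. norm x \<le> 1 \<longrightarrow> (\<exists>y\<in>F. norm (A x - y) < \<delta>))"
proof -
  have "compact (closure (A ` cball 0 1))"
    using assms(1) by (simp add: compact_operator_def)
  then obtain F where "finite F" and F: "closure (A ` cball 0 1) \<subseteq> (\<Union>y\<in>F. ball y \<delta>)"
    using assms(2) unfolding compact_eq_totally_bounded by metis
  have "\<exists>y\<in>F. norm (A x - y) < \<delta>" if "norm x \<le> 1" for x
  proof -
    have "A x \<in> closure (A ` cball 0 1)"
      using that closure_subset[of "A ` cball 0 1"] by auto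
    then obtain y where "y \<in> F" "dist y (A x) < \<delta>" using F by auto
    then show ?thesis by (auto simp: dist_norm norm_minus_commute)
  qed
  then show ?thesis using \<open>finite F\<close> by blast
qed

text \<open>A limit of eigenvectors of compressions with eigenvalues outside a disc is an eigenvector
  of \<open>A\<close>, provided the compressions exhaust the range of \<open>A\<close>.\<close>

lemma compression_small_eigenvalues:
  assumes A: "compact_operator A" and no: "\<And>z v. A v = z *\<^sub>C v \<Longrightarrow> v \<noteq> 0 \<Longrightarrow> z = 0"
    and "finite G" "0 < \<epsilon>"
  shows "\<exists>e n. orthonormal e {..<n} \<and> G \<subseteq> complex_vector.span (e ` {..<n}) \<and>
    (\<forall>z v. v \<noteq> 0 \<longrightarrow> oproj e {..<n} (A v) = z *\<^sub>C v \<longrightarrow> cmod z \<le> \<epsilon>)"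
proof (rule ccontr)
  assume neg: "\<not> ?thesis"
  have linA: "clinear A" and blA: "bounded_linear A"
    using A by (auto simp: compact_operator_def bounded_clinear_imp_clinear bounded_clinear_def)
  have "\<exists>q. norm (fst q) = 1 \<and> \<epsilon> < cmod (snd q) \<and>
      norm (A (fst q) - snd q *\<^sub>C fst q) < inverse (Suc k)" for k :: nat
  proof -
    \<comment> \<open>A finite net for the image of the unit ball, put into the span, keeps the
      projection within 1/(k+1) of A u for all unit vectors u, whichever eigenvector the compression
      then produces.\<close>
    obtain F where F: "finite F" "\<And>x. norm x \<le> 1 \<Longrightarrow> \<exists>y\<in>F. norm (A x - y) < inverse (Suc k)"
      using compact_operator_finite_net[OF A, of "inverse (Suc k)"] by auto
    obtain e n where e: "orthonormal e {..<n}" "F \<union> G \<subseteq> complex_vector.span (e ` {..<n})"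
      using finite_subset_orthonormal_span[of "F \<union> G"] F(1) \<open>finite G\<close> by auto
    then obtain z v where v: "v \<noteq> 0" "oproj e {..<n} (A v) = z *\<^sub>C v" "\<epsilon> < cmod z"
      using neg by (metis (no_types, lifting) le_sup_iff not_le)
    define u where "u = complex_of_real (inverse (norm v)) *\<^sub>C v"
    have u: "norm u = 1" "oproj e {..<n} (A u) = z *\<^sub>C u"
      using v(1,2) by (simp_all add: u_def norm_inverse clinear_scaleC[OF linA]
          clinear_scaleC[OF clinear_oproj] scaleC_scaleC mult.commute)
    obtain y where "y \<in> F" "norm (A u - y) < inverse (Suc k)"
      using F(2)[of u] u(1) by auto
    then have "norm (A u - oproj e {..<n} (A u)) < inverse (Suc k)"
      using oproj_dist_le[OF e(1), of y "A u"] e(2) by auto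
    then show ?thesis using u v(3) by (intro exI[of _ "(u, z)"]) simp
  qed
  then obtain q where q: "\<And>k::nat. norm (fst (q k)) = 1 \<and> \<epsilon> < cmod (snd (q k)) \<and>
      norm (A (fst (q k)) - snd (q k) *\<^sub>C fst (q k)) < inverse (Suc k)"
    by metis
  \<comment> \<open>The vectors v k need not converge a priori. The products p k do, along the
    subsequence for which A (v k) converges, and since |z k| > \<epsilon> the limit is not
    zero.\<close>
  define v z p where "v k = fst (q k)" and "z k = snd (q k)" and "p k = z k *\<^sub>C v k" for k
  have v: "norm (v k) = 1" "p k = z k *\<^sub>C v k" "\<epsilon> < cmod (z k)"
      "norm (A (v k) - p k) < inverse (Suc k)" for k
    using q[of k] by (simp_all add: v_def z_def p_def)
  have d0: "(\<lambda>k. A (v k) - p k) \<longlonglongrightarrow> 0"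
    by (rule Lim_null_comparison[OF always_eventually LIMSEQ_inverse_real_of_nat])
      (intro allI less_imp_le v(4))
  obtain r y where r: "strict_mono (r :: nat \<Rightarrow> nat)" and y: "(\<lambda>k. A (v (r k))) \<longlonglongrightarrow> y"
    using compact_operator_subseq[OF A, of v 1] v(1) by auto
  have "(\<lambda>k. A (v (r k)) - (A (v (r k)) - p (r k))) \<longlonglongrightarrow> y - 0"
    by (intro tendsto_diff y LIMSEQ_subseq_LIMSEQ[OF d0 r, unfolded comp_def])
  then have p: "(\<lambda>k. p (r k)) \<longlonglongrightarrow> y" by simp
  have "\<epsilon> \<le> norm y"
    by (rule LIMSEQ_le_const[OF tendsto_norm[OF p]]) (use v(1,3) in \<open>auto simp: v(2) intro: less_imp_le\<close>)
  then have "y \<noteq> 0" using \<open>0 < \<epsilon>\<close> by auto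
  \<comment> \<open>As A (p k) = z k A (v k), the scalar z k is a quotient of inner products of
    convergent sequences, so it converges to c. The same identity gives A y = c y in the
    limit.\<close>
  define c where "c = cinner (A y) y / complex_of_real ((norm y)\<^sup>2)"
  have Ap: "(\<lambda>k. A (p (r k))) \<longlonglongrightarrow> A y"
    by (rule bounded_linear.tendsto[OF blA p])
  have "z k = cinner (A (p k)) (A (v k)) / complex_of_real ((norm (A (v k)))\<^sup>2)"
    if "A (v k) \<noteq> 0" for k
    using that by (simp add: v(2) clinear_scaleC[OF linA] cinner_scaleC_left cinner_self)
  moreover have "\<forall>\<^sub>F k in sequentially. A (v (r k)) \<noteq> 0"
    using tendsto_imp_eventually_ne[OF y \<open>y \<noteq> 0\<close>] .
  ultimately have ev: "\<forall>\<^sub>F k in sequentially. z (r k) =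
      cinner (A (p (r k))) (A (v (r k))) / complex_of_real ((norm (A (v (r k))))\<^sup>2)"
    by (auto elim!: eventually_mono)
  have "(\<lambda>k. cinner (A (p (r k))) (A (v (r k))) / complex_of_real ((norm (A (v (r k))))\<^sup>2)) \<longlonglongrightarrow> c"
    unfolding c_def using \<open>y \<noteq> 0\<close> by (intro tendsto_intros cinner.tendsto Ap y) simp
  then have z: "(\<lambda>k. z (r k)) \<longlonglongrightarrow> c"
    using ev by (simp add: tendsto_cong)
  have "(\<lambda>k. z (r k) *\<^sub>C A (v (r k))) \<longlonglongrightarrow> c *\<^sub>C y"
    by (intro scaleC.tendsto z y)
  then have "A y = c *\<^sub>C y"
    using LIMSEQ_unique[OF Ap] by (simp add: v(2) clinear_scaleC[OF linA])
  then have "c = 0" using no \<open>y \<noteq> 0\<close> by blast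
  have "\<epsilon> \<le> cmod c"
    by (rule LIMSEQ_le_const[OF tendsto_norm[OF z]]) (use v(3) in \<open>auto intro: less_imp_le\<close>)
  then show False using \<open>c = 0\<close> \<open>0 < \<epsilon>\<close> by simp
qed

section \<open>The estimate for the non-negative part\<close>

lemma orthonormal_span_perp:
  assumes "orthonormal f {..<n}" "x \<in> complex_vector.span (f ` {..<j})" "j \<le> i" "i < n"
  shows "cinner x (f i) = 0"
proof -
  have "complex_vector.subspace {x. cinner x (f i) = 0}"
    by (rule complex_vector.subspaceI) (auto simp: cinner_simps)
  moreover have "f ` {..<j} \<subseteq> {x. cinner x (f i) = 0}"
    using assms(1,3,4) by (auto simp: orthonormal_def)
  ultimately show ?thesis
    using complex_vector.span_minimal assms(2) by blast
qed

text \<open>Subtracting only the real part of the diagonal leaves the skew-adjoint part of the compression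
  untouched.\<close>

lemma triangular_part:
  fixes M0 N0 :: "'a::complex_hilbert_space \<Rightarrow> 'a"
  assumes f: "orthonormal f {..<n}" and adj: "adjoint_pair M0 N0"
    and range: "\<And>x. M0 x \<in> complex_vector.span (f ` {..<n})"
      "\<And>x. N0 x \<in> complex_vector.span (f ` {..<n})"
    and tri: "\<And>j. j < n \<Longrightarrow> M0 (f j) - d j *\<^sub>C f j \<in> complex_vector.span (f ` {..<j})"
    and d: "\<And>j. j < n \<Longrightarrow> cmod (d j) \<le> \<epsilon>" and "0 \<le> \<epsilon>"
  shows "\<exists>D. triangular f n (\<lambda>x. M0 x - D x) (\<lambda>x. N0 x - D x) \<and> (\<forall>x. norm (D x) \<le> \<epsilon> * norm x)"
proof -
  define D where "D x = (\<Sum>j<n. (complex_of_real (Re (d j)) * cinner x (f j)) *\<^sub>C f j)" for x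
  have D_sym: "adjoint_pair D D"
    unfolding adjoint_pair_def D_def cinner.sum_left cinner.sum_right
    by (intro allI sum.cong) (auto simp: cinner_simps mult.assoc cinner_commute[of "f _"])
  have D_range: "D x \<in> complex_vector.span (f ` {..<n})" for x
    unfolding D_def
    by (intro complex_vector.span_sum complex_vector.span_scale complex_vector.span_base) auto
  have f1: "f i \<noteq> 0" if "i < n" for i
    using orthonormal_norm[OF f, of i] that by auto
  have D_entry: "cinner (D x) (f i) = complex_of_real (Re (d i)) * cinner x (f i)" if "i < n" for x i
    unfolding D_def using that f1 by (intro cinner_sum_orthonormal0 orthonormal_imp_0[OF f]) auto
  have entry: "cinner (M0 (f j)) (f i) = (if i = j then d j else 0)" if "j \<le> i" "i < n" for i j
    using orthonormal_span_perp[OF f tri[of j] that(1,2)] that f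
    by (auto simp: orthonormal_def cinner_simps)
  have "triangular f n (\<lambda>x. M0 x - D x) (\<lambda>x. N0 x - D x)"
  proof
    show "adjoint_pair (\<lambda>x. M0 x - D x) (\<lambda>x. N0 x - D x)"
      unfolding adjoint_pair_def
      by (simp add: cinner_simps adjoint_pairD[OF adj] adjoint_pairD[OF D_sym])
    show "cinner (M0 (f j) - D (f j)) (f i) = 0" if "j < i" "i < n" for i j
      using that f by (simp add: cinner.diff_left entry D_entry orthonormal_def)
    show "Re (cinner (M0 (f j) - D (f j)) (f j)) = 0" if "j < n" for j
      using that f by (simp add: cinner.diff_left entry D_entry orthonormal_def)
  qed (auto intro!: complex_vector.span_diff range D_range f)
  moreover have "norm (D x) \<le> \<epsilon> * norm x" for x
  proof -
    have "(norm (D x))\<^sup>2 = (\<Sum>j<n. (cmod (complex_of_real (Re (d j)) * cinner x (f j)) * norm (f j))\<^sup>2)"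
      unfolding D_def by (rule norm_sum_orthonormal0[OF orthonormal_imp_0[OF f]]) simp
    also have "\<dots> \<le> (\<Sum>j<n. \<epsilon>\<^sup>2 * (cmod (cinner x (f j)))\<^sup>2)"
    proof (rule sum_mono)
      fix j assume j: "j \<in> {..<n}"
      then have "\<bar>Re (d j)\<bar> \<le> \<epsilon>" using d[of j] abs_Re_le_cmod[of "d j"] by simp
      then have "(\<bar>Re (d j)\<bar> * cmod (cinner x (f j)))\<^sup>2 \<le> (\<epsilon> * cmod (cinner x (f j)))\<^sup>2"
        by (intro power_mono mult_right_mono) auto
      then show "(cmod (complex_of_real (Re (d j)) * cinner x (f j)) * norm (f j))\<^sup>2 \<le>
          \<epsilon>\<^sup>2 * (cmod (cinner x (f j)))\<^sup>2"
        using orthonormal_norm[OF f j] by (simp add: norm_mult power_mult_distrib)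
    qed
    also have "\<dots> \<le> \<epsilon>\<^sup>2 * (norm x)\<^sup>2"
      unfolding sum_distrib_left[symmetric]
      by (intro mult_left_mono bessel orthonormal_imp_0[OF f]) auto
    finally show ?thesis
      using \<open>0 \<le> \<epsilon>\<close> by (simp add: power2_le_iff_abs_le flip: power_mult_distrib)
  qed
  ultimately show ?thesis by blast
qed

text \<open>On the span \<open>T\<close> is diagonal with entries at least
  \<open>\<sigma> k\<close>. This is the lower half of the min-max principle: in this
  (k+1)-dimensional space some unit vector meets any k constraints, so a Gelfand bound with k
  constraints is also a bound on \<open>\<sigma> k\<close>.\<close>

lemma (in compact_adjoint) singular_span_bound:
  assumes eig: "\<And>j. T (e j) = complex_of_real (\<sigma> j) *\<^sub>C e j" and "0 < \<sigma> k"
    and x: "x \<in> complex_vector.span (e ` {..k})"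
  shows "\<sigma> k * norm x \<le> norm (T x)"
proof -
  have on: "orthonormal e {..k}" by (rule orthonormal_e) (use assms in auto)
  have "x = (\<Sum>j\<le>k. cinner x (e j) *\<^sub>C e j)"
    using oproj_span[OF on _ x] by (simp add: oproj_def)
  from arg_cong[OF this, of T]
  have "T x = (\<Sum>j\<le>k. (complex_of_real (\<sigma> j) * cinner x (e j)) *\<^sub>C e j)"
    by (simp add: clinear_sum[OF clin(1)] clinear_scaleC[OF clin(1)] eig scaleC_scaleC mult.commute)
  then have "(norm (T x))\<^sup>2 = (\<Sum>j\<le>k. (cmod (complex_of_real (\<sigma> j) * cinner x (e j)) * norm (e j))\<^sup>2)"
    by (simp only: norm_sum_orthonormal0[OF orthonormal_imp_0[OF on] finite_atMost])
  also have "\<dots> \<ge> (\<Sum>j\<le>k. (\<sigma> k)\<^sup>2 * (cmod (cinner x (e j)))\<^sup>2)"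
  proof (rule sum_mono)
    fix j assume j: "j \<in> {..k}"
    then have "(\<sigma> k)\<^sup>2 \<le> (\<sigma> j)\<^sup>2"
      using decseqD[OF decseq_\<sigma>] \<sigma>_nonneg by (intro power_mono) auto
    then show "(\<sigma> k)\<^sup>2 * (cmod (cinner x (e j)))\<^sup>2 \<le>
        (cmod (complex_of_real (\<sigma> j) * cinner x (e j)) * norm (e j))\<^sup>2"
      using orthonormal_norm[OF on j] by (simp add: norm_mult power_mult_distrib mult_right_mono)
  qed
  finally have "(\<sigma> k)\<^sup>2 * (norm x)\<^sup>2 \<le> (norm (T x))\<^sup>2"
    unfolding parseval[OF on finite_atMost x] sum_distrib_left .
  then show ?thesis by (simp add: power2_le_iff_abs_le flip: power_mult_distrib)
qed

lemma (in compact_adjoint) nonneg_eigen: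
  assumes "nonneg_operator T"
  shows "T (e j) = complex_of_real (\<sigma> j) *\<^sub>C e j"
proof -
  have "adjoint_pair T T"
    using assms by (auto simp: nonneg_operator_def selfadjoint_def adjoint_pair_def)
  then have "S = T" using adjoint_pair_unique adj by blast
  then show ?thesis by (intro sqrt_eigen(1)[OF assms]) simp
qed


lemma adjoint_pair_selfadjoint: "selfadjoint C \<Longrightarrow> adjoint_pair C C"
  by (simp add: selfadjoint_def adjoint_pair_def)

text \<open>Fix N and \<epsilon> and compress to a span containing the first N + 1 eigenvectors of
  \<open>C\<close>. Matsaev's inequality controls the Hermitian part of the compressed sum by its
  skew part, which stems from \<open>T\<close> alone. Subtracting the Hermitian part of
  \<open>T\<close> leaves a bound for the compression of \<open>C\<close>, with an error \<epsilon>
  from the diagonal.\<close>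

lemma nonneg_part_estimate:
  fixes C T T' :: "'a::complex_hilbert_space \<Rightarrow> 'a"
  assumes C: "nonneg_operator C" "compact_adjoint C C"
    and T: "adjoint_pair T T'" "\<And>m. gelfand_le T m (\<tau> * weight m p)" and "0 < \<tau>" "0 < p"
    and A: "compact_operator (\<lambda>x. C x + T x)"
      "\<And>z v. C v + T v = z *\<^sub>C v \<Longrightarrow> v \<noteq> 0 \<Longrightarrow> z = 0"
  shows "\<exists>K>0. \<exists>r>0. \<forall>N. compact_adjoint.\<sigma> C C N \<le> K * weight N r"
proof -
  interpret C: compact_adjoint C C by fact
  obtain k where k: "(1/2) ^ k < p / 2"
    using real_arch_pow_inv[of "p / 2" "1/2"] \<open>0 < p\<close> by auto
  \<comment> \<open>With g and r both at most about p/2, the decay p of \<open>T\<close> covers the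
    required decay g + r; the caps 1/2 keep g + r \<le> 1.\<close>
  define r where "r = (1/2 :: real) ^ Suc k"
  define g where "g = min (1/2) (p / 2)"
  have "g \<le> 1/2" "g \<le> p / 2" by (auto simp: g_def)
  then have r: "0 < r" "r \<le> 1/2" "g + r \<le> p" "g + r \<le> 1"
  proof -
    define w where "w = (1/2 :: real) ^ k"
    have "0 < w" "w \<le> 1" "w < p / 2" "r = w / 2"
      using k by (simp_all add: w_def r_def power_le_one)
    then show "0 < r" "r \<le> 1/2" "g + r \<le> p" "g + r \<le> 1"
      using \<open>g \<le> 1/2\<close> \<open>g \<le> p / 2\<close> by linarith+
  qed
  have g: "0 < g" "g \<le> 1/2" using \<open>0 < p\<close> by (auto simp: g_def)
  obtain c where c: "0 \<le> c" and matsaev: "\<And>(e :: nat \<Rightarrow> 'a) n M N b m. triangular e n M N \<Longrightarrow>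
      0 < b \<Longrightarrow> (\<And>m. gelfand_le (\<lambda>x. M x - N x) m (b * weight m (g + r))) \<Longrightarrow>
      gelfand_le (\<lambda>x. M x + N x) m (c * b * weight m r)"
    using matsaev[OF g, of k, where ?'a = 'a, folded r_def] by blast
  let ?A = "\<lambda>x. C x + T x"
  have T': "gelfand_le T' m (\<tau> * weight m p)" for m
    using \<open>0 < \<tau>\<close> by (intro gelfand_le_adjoint[OF T(2) T(1)]) (simp add: weight_nonneg)
  \<comment> \<open>Matsaev's inequality is applied with b = 4 \<tau>: one factor 2 from T - T', one
    from rescaling. Adding 2 \<tau> for T + T' and halving gives (2 c + 1) \<tau>, and 3 comes from
    passing to N div 3.\<close>
  define K where "K = 3 * ((2 * c + 1) * \<tau>)"
  have "K > 0" using c \<open>0 < \<tau>\<close> by (simp add: K_def)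
  have "C.\<sigma> N \<le> K * weight N r + \<epsilon>" if "0 < \<epsilon>" for N \<epsilon>
  proof (cases "C.\<sigma> N = 0")
    case True
    then show ?thesis using \<open>K > 0\<close> weight_nonneg[of N r] that by simp
  next
    case False
    then have "0 < C.\<sigma> N" using C.\<sigma>_nonneg[of N] by simp
    \<comment> \<open>The vectors \<open>C.e\<close> up to N are put into the span because on their
      span the compression of \<open>C\<close> coincides with \<open>C\<close>.\<close>
    obtain e n where e: "orthonormal e {..<n}" "C.e ` {..N} \<subseteq> complex_vector.span (e ` {..<n})"
      and small: "\<And>z v. v \<noteq> 0 \<Longrightarrow> oproj e {..<n} (?A v) = z *\<^sub>C v \<Longrightarrow> cmod z \<le> \<epsilon>"
    proof -
      have "\<exists>e n. orthonormal e {..<n} \<and> C.e ` {..N} \<subseteq> complex_vector.span (e ` {..<n}) \<and>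
          (\<forall>z v. v \<noteq> 0 \<longrightarrow> oproj e {..<n} (?A v) = z *\<^sub>C v \<longrightarrow> cmod z \<le> \<epsilon>)"
        by (rule compression_small_eigenvalues[OF A(1)]) (use A(2) \<open>0 < \<epsilon>\<close> in auto)
      then show ?thesis using that by blast
    qed
    define P where "P = oproj e {..<n}"
    have P: "adjoint_pair P P" "\<And>x. norm (P x) \<le> norm x"
      "\<And>x. P x \<in> complex_vector.span (e ` {..<n})"
      "\<And>x. x \<in> complex_vector.span (e ` {..<n}) \<Longrightarrow> P x = x" "clinear P"
      using e(1) by (auto simp: P_def adjoint_pair_oproj oproj_norm_le orthonormal_imp_0
          oproj_in_span oproj_span clinear_oproj)
    define M0 where "M0 x = P (?A (P x))" for x
    define N0 where "N0 x = P (C (P x) + T' (P x))" for x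
    have adj0: "adjoint_pair M0 N0"
      unfolding adjoint_pair_def M0_def N0_def
      by (simp add: cinner_simps adjoint_pairD[OF P(1)] adjoint_pairD[OF C.adj]
          adjoint_pairD[OF T(1)] clinear_add[OF P(5)])
    have "M0 x \<in> complex_vector.span (e ` {..<n})" for x
      by (simp add: M0_def P(3))
    from schur_triangular[OF adjoint_pair_clinear[OF adj0] e(1) this]
    obtain f d where f: "orthonormal f {..<n}"
        "complex_vector.span (f ` {..<n}) = complex_vector.span (e ` {..<n})"
        "\<forall>j<n. M0 (f j) - d j *\<^sub>C f j \<in> complex_vector.span (f ` {..<j})"
        "\<forall>j<n. \<exists>w\<in>complex_vector.span (e ` {..<n}). w \<noteq> 0 \<and> M0 w = d j *\<^sub>C w"
      by blast
    \<comment> \<open>The eigenvector w for d j lies in the span, so P w = w and it is an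
      eigenvector of the compression, to which \<open>small\<close> applies.\<close>
    have "cmod (d j) \<le> \<epsilon>" if "j < n" for j
      using f(4) that small P(4) unfolding M0_def P_def by metis
    then obtain D where D: "triangular f n (\<lambda>x. M0 x - D x) (\<lambda>x. N0 x - D x)"
        "\<And>x. norm (D x) \<le> \<epsilon> * norm x"
      using triangular_part[OF f(1) adj0, of d \<epsilon>] f(2,3) P(3) \<open>0 < \<epsilon>\<close>
      unfolding M0_def N0_def by auto
    have wpr: "weight m p \<le> weight m (g + r)" "weight m (g + r) \<le> weight m r" for m
      using r g by (auto intro!: weight_antimono)
    have "gelfand_le (\<lambda>x. T x + (-1) *\<^sub>C T' x) (m + m)
        (\<tau> * weight m p + cmod (-1) * (\<tau> * weight m p))" for m
      by (intro gelfand_le_add gelfand_le_scaleC T(2) T')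
    then have "gelfand_le (\<lambda>x. P (T (P x) + (-1) *\<^sub>C T' (P x))) (m + m)
        (\<tau> * weight m p + cmod (-1) * (\<tau> * weight m p))" for m
      by (rule gelfand_le_compress[OF _ _ P(1,2)]) (use \<open>0 < \<tau>\<close> in \<open>simp add: weight_nonneg\<close>)
    then have "gelfand_le (\<lambda>x. P (T (P x) + (-1) *\<^sub>C T' (P x))) (2 * m) (2 * \<tau> * weight m (g + r))" for m
      by (rule gelfand_le_mono) (use \<open>0 < \<tau>\<close> wpr(1)[of m] in simp_all)
    then have "gelfand_le (\<lambda>x. P (T (P x) + (-1) *\<^sub>C T' (P x))) m
        (real 2 * (2 * \<tau>) * weight m (g + r))" for m
      using \<open>0 < \<tau>\<close> r g by (intro gelfand_le_rescale) simp_all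
    moreover have "P (T (P x) + (-1) *\<^sub>C T' (P x)) = (M0 x - D x) - (N0 x - D x)" for x
      by (simp add: M0_def N0_def clinear_diff[OF P(5), symmetric] complex_vector.scale_minus_left
          scaleC_one)
    ultimately have "gelfand_le (\<lambda>x. (M0 x - D x) - (N0 x - D x)) m (4 * \<tau> * weight m (g + r))" for m
      by simp
    then have X: "gelfand_le (\<lambda>x. (M0 x - D x) + (N0 x - D x)) m (c * (4 * \<tau>) * weight m r)" for m
      using \<open>0 < \<tau>\<close> by (intro matsaev[OF D(1)]) simp_all
    \<comment> \<open>m constraints for the Hermitian part and 2 m for T + T' are at most N, fewer
      than the N + 1 available dimensions.\<close>
    define m where "m = N div 3"
    have "gelfand_le (\<lambda>x. T x + T' x) (m + m) (\<tau> * weight m p + \<tau> * weight m p)"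
      by (intro gelfand_le_add T(2) T')
    then have TT: "gelfand_le (\<lambda>x. P (T (P x) + T' (P x))) (m + m)
        (\<tau> * weight m p + \<tau> * weight m p)"
      by (rule gelfand_le_compress[OF _ _ P(1,2)]) (use \<open>0 < \<tau>\<close> in \<open>simp add: weight_nonneg\<close>)
    have "gelfand_le (\<lambda>x. P (C (P x))) (m + (m + m)) ((2 * c + 1) * \<tau> * weight m r + \<epsilon>)"
    proof (rule gelfand_le_combine[OF X[of m] TT])
      fix x
      let ?X = "(M0 x - D x) + (N0 x - D x)" and ?T = "P (T (P x) + T' (P x))"
      assume 1: "norm ?X \<le> c * (4 * \<tau>) * weight m r * norm x"
        and 2: "norm ?T \<le> (\<tau> * weight m p + \<tau> * weight m p) * norm x"
      \<comment> \<open>As \<open>C\<close> is self-adjoint, M0 + N0 is twice its compression plus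
        the compression of T + T', and each of M0 and N0 has lost one \<open>D\<close>.\<close>
      have "2 *\<^sub>C P (C (P x)) = ?X - ?T + 2 *\<^sub>C D x"
        by (simp add: M0_def N0_def clinear_add[OF P(5)] flip: scaleC_2)
      then have "2 * norm (P (C (P x))) = norm (?X - ?T + 2 *\<^sub>C D x)"
        by (metis norm_numeral norm_scaleC)
      also have "\<dots> \<le> norm ?X + norm ?T + 2 * norm (D x)"
        by (metis (no_types) add_mono_thms_linordered_semiring(3) norm_numeral norm_scaleC
            norm_triangle_le norm_triangle_ineq4)
      also have "\<dots> \<le> c * (4 * \<tau>) * weight m r * norm x + (\<tau> * weight m p + \<tau> * weight m p) * norm x
          + 2 * (\<epsilon> * norm x)"
        using 1 2 D(2)[of x] by (intro add_mono mult_left_mono) auto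
      also have "(\<tau> * weight m p + \<tau> * weight m p) * norm x \<le> 2 * \<tau> * weight m r * norm x"
        using \<open>0 < \<tau>\<close> wpr[of m] by (intro mult_right_mono) auto
      finally show "norm (P (C (P x))) \<le> ((2 * c + 1) * \<tau> * weight m r + \<epsilon>) * norm x"
        by (simp add: algebra_simps)
    qed
    then obtain F where F: "finite F" "card F \<le> 3 * m"
        "\<And>x. (\<And>s. s \<in> F \<Longrightarrow> cinner x s = 0) \<Longrightarrow>
          norm (P (C (P x))) \<le> ((2 * c + 1) * \<tau> * weight m r + \<epsilon>) * norm x"
      using gelfand_leE[of "\<lambda>x. P (C (P x))"] by (metis mult.commute mult_2 mult_Suc_right numeral_3_eq_3 numeral_2_eq_2)
    have "orthonormal C.e {..<Suc N}"
      using \<open>0 < C.\<sigma> N\<close> by (intro C.orthonormal_e) auto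
    moreover have "card F < Suc N" using F(2) by (simp add: m_def)
    ultimately obtain u where u: "u \<in> complex_vector.span (C.e ` {..N})" "norm u = 1"
        "\<forall>s\<in>F. cinner u s = 0"
      using orthogonal_unit_vector[of C.e "Suc N" F] F(1) by (auto simp: lessThan_Suc_atMost)
    have V: "complex_vector.span (C.e ` {..N}) \<subseteq> complex_vector.span (e ` {..<n})"
      by (rule complex_vector.span_minimal[OF e(2) complex_vector.subspace_span])
    have inv: "C u \<in> complex_vector.span (C.e ` {..N})"
    proof -
      have "orthonormal C.e {..N}"
        using \<open>0 < C.\<sigma> N\<close> by (intro C.orthonormal_e) auto
      then have "u = (\<Sum>j\<le>N. cinner u (C.e j) *\<^sub>C C.e j)"
        using oproj_span[of C.e "{..N}" u] u(1) by (simp add: oproj_def)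
      from arg_cong[OF this, of C] show ?thesis
        by (simp add: clinear_sum[OF C.clin(1)] clinear_scaleC[OF C.clin(1)] C.nonneg_eigen[OF C(1)])
          (intro complex_vector.span_sum complex_vector.span_scale
            complex_vector.span_base[OF imageI])
    qed
    have "C.\<sigma> N \<le> norm (C u)"
      using C.singular_span_bound[OF C.nonneg_eigen[OF C(1)] \<open>0 < C.\<sigma> N\<close> u(1)] u(2) by simp
    also have "C u = P (C (P u))"
      using P(4) V u(1) inv by (metis subsetD)
    also have "norm \<dots> \<le> (2 * c + 1) * \<tau> * weight m r + \<epsilon>"
      using F(3)[of u] u(2,3) by simp
    also have "(2 * c + 1) * \<tau> * weight m r \<le> (2 * c + 1) * \<tau> * (real 3 * weight N r)"
      unfolding m_def using r c \<open>0 < \<tau>\<close> by (intro mult_left_mono weight_div) auto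
    finally show ?thesis by (simp add: K_def algebra_simps)
  qed
  \<comment> \<open>The compression depends on \<epsilon> and N, but K and r do not; so \<epsilon>
    may tend to 0.\<close>
  then have "C.\<sigma> N \<le> K * weight N r" for N
    using field_le_epsilon by blast
  then show ?thesis using \<open>K > 0\<close> r(1) by blast
qed

section \<open>Slow variation\<close>

text \<open>By monotonicity (m+1) s_m^q is at most the sum of the first m + 1 terms, hence at most
  the whole sum S. The summand 1 in the constant keeps it positive when S = 0.\<close>

lemma decseq_summable_powr_weight:
  fixes s :: "nat \<Rightarrow> real"
  assumes s: "decseq s" "\<And>n. 0 \<le> s n" and "0 < q" and summ: "summable (\<lambda>n. s n powr q)"
  shows "\<exists>\<tau>>0. \<forall>m. s m \<le> \<tau> * weight m (1 / q)"
proof -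
  define S where "S = (\<Sum>n. s n powr q)"
  have "0 \<le> S" unfolding S_def by (intro suminf_nonneg summ) simp
  have "s m \<le> (S powr (1 / q) + 1) * weight m (1 / q)" for m
  proof -
    have "(real m + 1) * s m powr q = (\<Sum>n<Suc m. s m powr q)" by simp
    also have "\<dots> \<le> (\<Sum>n<Suc m. s n powr q)"
      using decseqD[OF s(1)] s(2) \<open>0 < q\<close> by (intro sum_mono powr_mono2) auto
    also have "\<dots> \<le> S"
      unfolding S_def by (intro sum_le_suminf summ) auto
    finally have "s m powr q \<le> S / (real m + 1)" by (simp add: field_simps)
    then have "(s m powr q) powr (1 / q) \<le> (S / (real m + 1)) powr (1 / q)"
      using \<open>0 < q\<close> by (intro powr_mono2) auto
    moreover have "(s m powr q) powr (1 / q) = s m"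
      using s(2)[of m] \<open>0 < q\<close> by (simp add: powr_powr)
    moreover have "(S / (real m + 1)) powr (1 / q) = S powr (1 / q) * weight m (1 / q)"
      using \<open>0 \<le> S\<close> by (simp add: weight_def powr_divide powr_minus_divide)
    ultimately have "s m \<le> S powr (1 / q) * weight m (1 / q)"
      by (simp only:)
    also have "\<dots> \<le> (S powr (1 / q) + 1) * weight m (1 / q)"
      by (intro mult_right_mono weight_nonneg) simp
    finally show ?thesis .
  qed
  moreover have "0 < S powr (1 / q) + 1" by (intro add_nonneg_pos) auto
  ultimately show ?thesis by blast
qed

text \<open>The derivative of l(x) x^s is x^(s-1) (x l'(x) + s l(x)), which is positive once x l'/l
  exceeds - s. So l(x) x^s is eventually non-decreasing and stays above a positive constant.\<close>

lemma slowly_varying_lower_bound: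
  assumes "slowly_varying l" "0 < s"
  shows "\<exists>\<kappa>>0. \<exists>X>0. \<forall>x\<ge>X. \<kappa> * x powr (- s) \<le> l x"
proof -
  obtain b l' where "0 < b" and pos: "\<And>x. b \<le> x \<Longrightarrow> 0 < l x"
    and der: "\<And>x. b \<le> x \<Longrightarrow> (l has_real_derivative l' x) (at x within {b..})"
    and lim: "((\<lambda>x. x * l' x / l x) \<longlongrightarrow> 0) at_top"
    using assms(1) unfolding slowly_varying_def by blast
  have "\<forall>\<^sub>F x in at_top. - s < x * l' x / l x"
    using order_tendstoD(1)[OF lim, of "- s"] assms(2) by simp
  then obtain X0 where X0: "\<And>x. X0 \<le> x \<Longrightarrow> - s < x * l' x / l x"
    by (auto simp: eventually_at_top_linorder)
  \<comment> \<open>The summand 1 keeps x in the interior of the half-line, where the one-sided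
    derivative is an ordinary one.\<close>
  define X where "X = max X0 b + 1"
  have X: "X0 \<le> X" "b < X" "0 < X" using \<open>0 < b\<close> by (auto simp: X_def)
  have mono: "l X * X powr s \<le> l x * x powr s" if "X \<le> x" for x
  proof (rule DERIV_nonneg_imp_nondecreasing[OF that])
    fix y assume y: "X \<le> y" "y \<le> x"
    then have "b < y" "0 < y" using X by auto
    then have "at y within {b..} = at y"
      by (intro at_within_interior) simp
    then have d: "(l has_real_derivative l' y) (at y)"
      using der[of y] \<open>b < y\<close> by simp
    have "((\<lambda>x. l x * x powr s) has_real_derivative
        l' y * y powr s + s * y powr (s - 1) * l y) (at y)"
      using DERIV_mult[OF d has_real_derivative_powr[OF \<open>0 < y\<close>, of s]] by (simp add: mult_ac)
    moreover have "0 \<le> l' y * y powr s + s * y powr (s - 1) * l y"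
    proof -
      have "- s * l y < y * l' y"
        using X0[of y] X y pos[of y] \<open>b < y\<close> by (simp add: field_simps)
      then have "0 \<le> y powr (s - 1) * (y * l' y + s * l y)" by simp
      also have "\<dots> = l' y * y powr s + s * y powr (s - 1) * l y"
        using \<open>0 < y\<close> by (simp add: powr_diff algebra_simps)
      finally show ?thesis .
    qed
    ultimately show "\<exists>z. ((\<lambda>x. l x * x powr s) has_real_derivative z) (at y) \<and> 0 \<le> z" by blast
  qed
  have "l X * X powr s * x powr (- s) \<le> l x" if "X \<le> x" for x
  proof -
    have "l X * X powr s * x powr (- s) \<le> l x * x powr s * x powr (- s)"
      using mono[OF that] by (intro mult_right_mono) auto
    also have "\<dots> = l x" using X that by (simp add: powr_minus)
    finally show ?thesis .
  qed
  moreover have "0 < l X * X powr s" using pos[of X] X by simp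
  ultimately show ?thesis using X(3) by blast
qed

theorem theorem2p3:
  fixes A C T :: "'a::complex_hilbert_space \<Rightarrow> 'a"
    and l :: "real \<Rightarrow> real" and a q :: real
  assumes "compact_operator A"
    and "A = (\<lambda>x. C x + T x)"
    and "nonneg_operator C" and "compact_operator C"
    and "slowly_varying l" and "0 < a"
    and "(\<lambda>n. 1 / l (real n) * s_number C n) \<longlonglongrightarrow> a"
    and "0 < q" and "T \<in> schatten_class q"
  shows "\<not> volterra_operator A"
proof
  assume volterra: "volterra_operator A"
  have "compact_operator T" and summ: "summable (\<lambda>j. s_number T (Suc j) powr q)"
    using assms(9) by (auto simp: schatten_class_def)
  then obtain T' where T': "adjoint_pair T T'"
    using adjoint_pair_exists compact_operatorD by blast
  interpret T: compact_adjoint T T'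
    by unfold_locales fact+
  interpret C: compact_adjoint C C
    using assms(3,4) by unfold_locales (simp_all add: nonneg_operator_def adjoint_pair_selfadjoint)
  obtain \<tau> where \<tau>: "0 < \<tau>" "\<And>m. T.\<sigma> m \<le> \<tau> * weight m (1 / q)"
    using decseq_summable_powr_weight[OF T.decseq_\<sigma> T.\<sigma>_nonneg assms(8)] summ
    by (auto simp: T.s_number_eq)
  obtain K r where K: "0 < K" "0 < r" "\<And>N. C.\<sigma> N \<le> K * weight N r"
    using nonneg_part_estimate[OF assms(3) C.compact_adjoint_axioms T'
        gelfand_le_mono[OF T.gelfand_le_\<sigma> order_refl \<tau>(2)] \<tau>(1)] assms(1,2,8)
      volterra_no_eigenvalue[OF volterra] by auto
  \<comment> \<open>Half of the exponent r is given up to bound l from below; the other half still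
    drives the quotient of s_n(C) by l(n) to 0, against the positive limit a.\<close>
  obtain \<kappa> X where \<kappa>: "0 < \<kappa>" "0 < X" "\<And>x. X \<le> x \<Longrightarrow> \<kappa> * x powr (- (r / 2)) \<le> l x"
    using slowly_varying_lower_bound[OF assms(5), of "r / 2"] K(2) by auto
  have "\<forall>\<^sub>F n in sequentially. 1 / l (real n) * s_number C n \<le> K / \<kappa> * real n powr (- (r / 2))"
    using eventually_ge_at_top[of "max 1 (nat \<lceil>X\<rceil>)"]
  proof eventually_elim
    case (elim n)
    then have n: "1 \<le> n" "X \<le> real n" by (auto simp: nat_le_iff ceiling_le_iff)
    have "0 < real n powr (- (r / 2))" using n by simp
    then have l: "0 < \<kappa> * real n powr (- (r / 2))" using \<kappa>(1) by simp
    \<comment> \<open>The n-th s-number is \<open>C.\<sigma> (n - 1)\<close>, and the shift in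
      \<open>weight\<close> turns its bound into exactly n^(-r); this uses n \<ge> 1.\<close>
    have "s_number C n \<le> K * real n powr (- r)"
      using K(3)[of "n - 1"] n by (simp add: C.s_number_eq weight_def of_nat_diff)
    then have "1 / l (real n) * s_number C n \<le>
        1 / (\<kappa> * real n powr (- (r / 2))) * (K * real n powr (- r))"
      using \<kappa>(3)[OF n(2)] l C.\<sigma>_nonneg
      by (intro mult_mono divide_left_mono) (auto simp: C.s_number_eq)
    also have "real n powr (- r) = real n powr (- (r / 2)) * real n powr (- (r / 2))"
      by (simp flip: powr_add)
    also have "1 / (\<kappa> * real n powr (- (r / 2))) * (K * (real n powr (- (r / 2)) * real n powr (- (r / 2)))) =
        K / \<kappa> * real n powr (- (r / 2))"
      using l \<kappa>(1) n by simp
    finally show ?case .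
  qed
  moreover have "(\<lambda>n. K / \<kappa> * real n powr (- (r / 2))) \<longlonglongrightarrow> K / \<kappa> * 0"
    using K(2) by (intro tendsto_mult tendsto_const tendsto_neg_powr filterlim_real_sequentially) simp
  ultimately have "a \<le> K / \<kappa> * 0"
    by (intro tendsto_le[OF trivial_limit_sequentially _ assms(7)])
  then show False using assms(6) by simp
qed

end
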